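(* Let $R$ be a left or right noetherian ring. If $R$ is left automorphism-invariant, then $R$ is quasi-Frobenius.
   Context: Rings are associative with identity and modules are unital. A module $M$ is automorphism-invariant if $\varphi(M)\subseteq M$ for every automorphism $\varphi$ of its injective envelope $E(M)$. A ring $R$ is left automorphism-invariant if the left module ${}_RR$ is automorphism-invariant. A ring $R$ is quasi-Frobenius if it is left and right artinian and left and right self-injective (i.e. ${}_RR$ and $R_R$ are injective modules). *)

theory Defs
  imports "HOL-Algebra.Module"
begin

text \<open>
  The locale \<open>module\<close> of HOL-Algebra is restricted to commutative rings, so modules over
  arbitrary rings are introduced here, on the same record type \<open>('a, 'b) module\<close>.
  The library locale \<open>submodule\<close> does not mention commutativity and is reused.
\<close>

locale left_module = R?: ring R + M?: abelian_group M
  for R :: "('a, 'm) ring_scheme" (structure) and M :: "('a, 'b, 'n) module_scheme" (structure) +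
  assumes smult_closed [simp, intro]:
      "\<lbrakk>a \<in> carrier R; x \<in> carrier M\<rbrakk> \<Longrightarrow> a \<odot>\<^bsub>M\<^esub> x \<in> carrier M"
    and smult_l_distr:
      "\<lbrakk>a \<in> carrier R; b \<in> carrier R; x \<in> carrier M\<rbrakk> \<Longrightarrow>
        (a \<oplus>\<^bsub>R\<^esub> b) \<odot>\<^bsub>M\<^esub> x = a \<odot>\<^bsub>M\<^esub> x \<oplus>\<^bsub>M\<^esub> b \<odot>\<^bsub>M\<^esub> x"
    and smult_r_distr:
      "\<lbrakk>a \<in> carrier R; x \<in> carrier M; y \<in> carrier M\<rbrakk> \<Longrightarrow>
        a \<odot>\<^bsub>M\<^esub> (x \<oplus>\<^bsub>M\<^esub> y) = a \<odot>\<^bsub>M\<^esub> x \<oplus>\<^bsub>M\<^esub> a \<odot>\<^bsub>M\<^esub> y"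
    and smult_assoc1:
      "\<lbrakk>a \<in> carrier R; b \<in> carrier R; x \<in> carrier M\<rbrakk> \<Longrightarrow>
        (a \<otimes>\<^bsub>R\<^esub> b) \<odot>\<^bsub>M\<^esub> x = a \<odot>\<^bsub>M\<^esub> (b \<odot>\<^bsub>M\<^esub> x)"
    and smult_one [simp]:
      "x \<in> carrier M \<Longrightarrow> \<one>\<^bsub>R\<^esub> \<odot>\<^bsub>M\<^esub> x = x"

definition module_homs ::
  "('a, 'm) ring_scheme \<Rightarrow> ('a, 'b, 'n) module_scheme \<Rightarrow> ('a, 'c, 'k) module_scheme \<Rightarrow> ('b \<Rightarrow> 'c) set"
  where "module_homs R M N =
    {f \<in> carrier M \<rightarrow> carrier N.
       (\<forall>x\<in>carrier M. \<forall>y\<in>carrier M. f (x \<oplus>\<^bsub>M\<^esub> y) = f x \<oplus>\<^bsub>N\<^esub> f y) \<and>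
       (\<forall>r\<in>carrier R. \<forall>x\<in>carrier M. f (r \<odot>\<^bsub>M\<^esub> x) = r \<odot>\<^bsub>N\<^esub> f x)}"

definition module_auts ::
  "('a, 'm) ring_scheme \<Rightarrow> ('a, 'b, 'n) module_scheme \<Rightarrow> ('b \<Rightarrow> 'b) set"
  where "module_auts R M = {f \<in> module_homs R M M. bij_betw f (carrier M) (carrier M)}"

text \<open>
  HOL cannot quantify over types inside a formula, so injectivity carries the type \<open>'c\<close> of
  the elements of the test modules \<open>A\<close>, \<open>B\<close> as a parameter. The choice \<open>'c = 'a\<close> (the type of
  the ring elements) already gives injectivity with respect to test modules over every type:
  see \<open>injective_module_any_type\<close> below.
\<close>

definition injective_module ::
  "'c itself \<Rightarrow> ('a, 'm) ring_scheme \<Rightarrow> ('a, 'b, 'n) module_scheme \<Rightarrow> bool"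
  where "injective_module (_ :: 'c itself) R M \<longleftrightarrow> left_module R M \<and>
    (\<forall>(A :: ('a, 'c) module) (B :: ('a, 'c) module) i f.
       left_module R A \<and> left_module R B \<and>
       i \<in> module_homs R A B \<and> inj_on i (carrier A) \<and> f \<in> module_homs R A M \<longrightarrow>
       (\<exists>g \<in> module_homs R B M. \<forall>a\<in>carrier A. g (i a) = f a))"

definition essential_submodule ::
  "('a, 'm) ring_scheme \<Rightarrow> 'b set \<Rightarrow> ('a, 'b, 'n) module_scheme \<Rightarrow> bool"
  where "essential_submodule R N E \<longleftrightarrow> submodule N R E \<and>
    (\<forall>K. submodule K R E \<and> K \<noteq> {\<zero>\<^bsub>E\<^esub>} \<longrightarrow> N \<inter> K \<noteq> {\<zero>\<^bsub>E\<^esub>})"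

text \<open>
  An injective envelope of \<open>M\<close> need not fit into the element type of \<open>M\<close>, so it comes with an
  embedding \<open>\<iota>\<close> of \<open>M\<close> into it.
\<close>

definition injective_envelope ::
  "('a, 'm) ring_scheme \<Rightarrow> ('a, 'b, 'n) module_scheme \<Rightarrow> ('a, 'e, 'k) module_scheme \<Rightarrow> ('b \<Rightarrow> 'e) \<Rightarrow> bool"
  where "injective_envelope R M E \<iota> \<longleftrightarrow>
    left_module R M \<and> injective_module TYPE('a) R E \<and>
    \<iota> \<in> module_homs R M E \<and> inj_on \<iota> (carrier M) \<and>
    essential_submodule R (\<iota> ` carrier M) E"

text \<open>
  The type \<open>'e\<close> is where the injective envelope \<open>E(M)\<close> is taken. A universal quantifier over the
  envelopes in \<open>'e\<close> would be vacuous if \<open>'e\<close> is too small, hence the existential one; since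
  envelopes are unique up to isomorphism over \<open>M\<close>, the condition does not depend on the one
  chosen: see \<open>automorphism_invariant_any_envelope\<close> below.
\<close>

definition automorphism_invariant ::
  "'e itself \<Rightarrow> ('a, 'm) ring_scheme \<Rightarrow> ('a, 'b, 'n) module_scheme \<Rightarrow> bool"
  where "automorphism_invariant (_ :: 'e itself) R M \<longleftrightarrow>
    (\<exists>(E :: ('a, 'e) module) \<iota>. injective_envelope R M E \<iota> \<and>
       (\<forall>\<phi>\<in>module_auts R E. \<phi> ` (\<iota> ` carrier M) \<subseteq> \<iota> ` carrier M))"

definition noetherian_module :: "('a, 'm) ring_scheme \<Rightarrow> ('a, 'b, 'n) module_scheme \<Rightarrow> bool"
  where "noetherian_module R M \<longleftrightarrow> left_module R M \<and>
    (\<forall>C :: nat \<Rightarrow> 'b set. (\<forall>n. submodule (C n) R M \<and> C n \<subseteq> C (Suc n)) \<longrightarrow>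
       (\<exists>k. \<forall>n\<ge>k. C n = C k))"

definition artinian_module :: "('a, 'm) ring_scheme \<Rightarrow> ('a, 'b, 'n) module_scheme \<Rightarrow> bool"
  where "artinian_module R M \<longleftrightarrow> left_module R M \<and>
    (\<forall>C :: nat \<Rightarrow> 'b set. (\<forall>n. submodule (C n) R M \<and> C (Suc n) \<subseteq> C n) \<longrightarrow>
       (\<exists>k. \<forall>n\<ge>k. C n = C k))"

definition regular_module :: "('a, 'm) ring_scheme \<Rightarrow> ('a, 'a) module"
  where "regular_module R =
    \<lparr>carrier = carrier R, mult = mult R, one = one R, zero = zero R, add = add R, smult = mult R\<rparr>"

text \<open>
  Right modules over \<open>R\<close> are left modules over the opposite ring; in particular
  \<open>regular_module (opposite_ring R)\<close> is \<open>R\<close> as a right module over itself.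
\<close>

definition opposite_ring :: "('a, 'm) ring_scheme \<Rightarrow> ('a, 'm) ring_scheme"
  where "opposite_ring R = R\<lparr>mult := \<lambda>x y. y \<otimes>\<^bsub>R\<^esub> x\<rparr>"

definition left_noetherian :: "('a, 'm) ring_scheme \<Rightarrow> bool"
  where "left_noetherian R \<longleftrightarrow> noetherian_module R (regular_module R)"

definition right_noetherian :: "('a, 'm) ring_scheme \<Rightarrow> bool"
  where "right_noetherian R \<longleftrightarrow> left_noetherian (opposite_ring R)"

definition left_artinian :: "('a, 'm) ring_scheme \<Rightarrow> bool"
  where "left_artinian R \<longleftrightarrow> artinian_module R (regular_module R)"

definition right_artinian :: "('a, 'm) ring_scheme \<Rightarrow> bool"
  where "right_artinian R \<longleftrightarrow> left_artinian (opposite_ring R)"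

definition left_self_injective :: "'c itself \<Rightarrow> ('a, 'm) ring_scheme \<Rightarrow> bool"
  where "left_self_injective T R \<longleftrightarrow> injective_module T R (regular_module R)"

definition right_self_injective :: "'c itself \<Rightarrow> ('a, 'm) ring_scheme \<Rightarrow> bool"
  where "right_self_injective T R \<longleftrightarrow> left_self_injective T (opposite_ring R)"

definition left_automorphism_invariant :: "'e itself \<Rightarrow> ('a, 'm) ring_scheme \<Rightarrow> bool"
  where "left_automorphism_invariant T R \<longleftrightarrow> automorphism_invariant T R (regular_module R)"

definition quasi_frobenius :: "'c itself \<Rightarrow> ('a, 'm) ring_scheme \<Rightarrow> bool"
  where "quasi_frobenius T R \<longleftrightarrow> ring R \<and>
    left_artinian R \<and> right_artinian R \<and> left_self_injective T R \<and> right_self_injective T R"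

subsection \<open>Elementary facts\<close>

context left_module
begin

lemma smult_l_null: "x \<in> carrier M \<Longrightarrow> \<zero>\<^bsub>R\<^esub> \<odot>\<^bsub>M\<^esub> x = \<zero>\<^bsub>M\<^esub>"
  by (metis M.add.r_cancel_one' R.l_zero R.zero_closed smult_closed smult_l_distr)

lemma smult_r_null: "a \<in> carrier R \<Longrightarrow> a \<odot>\<^bsub>M\<^esub> \<zero>\<^bsub>M\<^esub> = \<zero>\<^bsub>M\<^esub>"
  by (metis M.add.r_cancel_one' M.l_zero M.zero_closed smult_closed smult_r_distr)

lemma smult_minus_one: "x \<in> carrier M \<Longrightarrow> (\<ominus>\<^bsub>R\<^esub> \<one>\<^bsub>R\<^esub>) \<odot>\<^bsub>M\<^esub> x = \<ominus>\<^bsub>M\<^esub> x"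
  by (metis M.minus_equality R.add.inv_closed R.l_neg R.one_closed smult_closed smult_l_distr
      smult_l_null smult_one)

lemma submodule_iff:
  "submodule N R M \<longleftrightarrow> N \<subseteq> carrier M \<and> \<zero>\<^bsub>M\<^esub> \<in> N \<and>
    (\<forall>x\<in>N. \<forall>y\<in>N. x \<oplus>\<^bsub>M\<^esub> y \<in> N) \<and> (\<forall>r\<in>carrier R. \<forall>x\<in>N. r \<odot>\<^bsub>M\<^esub> x \<in> N)"
proof
  assume *: "submodule N R M"
  show "N \<subseteq> carrier M \<and> \<zero>\<^bsub>M\<^esub> \<in> N \<and>
    (\<forall>x\<in>N. \<forall>y\<in>N. x \<oplus>\<^bsub>M\<^esub> y \<in> N) \<and> (\<forall>r\<in>carrier R. \<forall>x\<in>N. r \<odot>\<^bsub>M\<^esub> x \<in> N)"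
    using subgroup.subset[OF submodule.axioms(1)[OF *]]
      subgroup.one_closed[OF submodule.axioms(1)[OF *]]
      subgroup.m_closed[OF submodule.axioms(1)[OF *]] submodule.smult_closed[OF *]
    by auto
next
  assume *: "N \<subseteq> carrier M \<and> \<zero>\<^bsub>M\<^esub> \<in> N \<and>
    (\<forall>x\<in>N. \<forall>y\<in>N. x \<oplus>\<^bsub>M\<^esub> y \<in> N) \<and> (\<forall>r\<in>carrier R. \<forall>x\<in>N. r \<odot>\<^bsub>M\<^esub> x \<in> N)"
  have "inv\<^bsub>add_monoid M\<^esub> x \<in> N" if "x \<in> N" for x
    using * that smult_minus_one[of x] R.add.inv_closed[OF R.one_closed]
    by (metis a_inv_def subset_iff)
  with * show "submodule N R M"
    by (auto intro!: submodule.intro subgroup.intro submodule_axioms.intro)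
qed

lemma submodule_left_module:
  assumes "submodule N R M"
  shows "left_module R (M\<lparr>carrier := N\<rparr>)"
proof -
  have N: "N \<subseteq> carrier M" "\<zero>\<^bsub>M\<^esub> \<in> N"
    "\<And>x y. x \<in> N \<Longrightarrow> y \<in> N \<Longrightarrow> x \<oplus>\<^bsub>M\<^esub> y \<in> N" "\<And>r x. r \<in> carrier R \<Longrightarrow> x \<in> N \<Longrightarrow> r \<odot>\<^bsub>M\<^esub> x \<in> N"
    using assms unfolding submodule_iff by auto
  have c: "\<And>x. x \<in> N \<Longrightarrow> x \<in> carrier M" using N by auto
  have neg: "\<exists>y\<in>N. y \<oplus>\<^bsub>M\<^esub> x = \<zero>\<^bsub>M\<^esub>" if "x \<in> N" for x
    using that N c smult_minus_one[of x] R.add.inv_closed[OF R.one_closed]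
    by (metis M.l_neg)
  have "abelian_group (M\<lparr>carrier := N\<rparr>)"
    by (rule abelian_groupI) (use N c neg M.a_assoc M.a_comm in auto)
  then show ?thesis
    by (intro left_module.intro left_module_axioms.intro R.ring_axioms)
       (use N c smult_l_distr smult_r_distr smult_assoc1 in auto)
qed

end

lemma (in ring) regular_left_module: "left_module R (regular_module R)"
proof -
  have "abelian_group (regular_module R)"
    by (rule abelian_groupI)
       (use l_neg a_comm a_assoc in \<open>auto simp: regular_module_def intro: exI[of _ "\<ominus> _"]\<close>)
  then show ?thesis
    by (intro left_module.intro left_module_axioms.intro ring_axioms)
       (auto simp: regular_module_def l_distr r_distr m_assoc)
qed

lemma module_homsD:
  assumes "f \<in> module_homs R M N"
  shows "x \<in> carrier M \<Longrightarrow> f x \<in> carrier N"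
    and "x \<in> carrier M \<Longrightarrow> y \<in> carrier M \<Longrightarrow> f (x \<oplus>\<^bsub>M\<^esub> y) = f x \<oplus>\<^bsub>N\<^esub> f y"
    and "r \<in> carrier R \<Longrightarrow> x \<in> carrier M \<Longrightarrow> f (r \<odot>\<^bsub>M\<^esub> x) = r \<odot>\<^bsub>N\<^esub> f x"
  using assms unfolding module_homs_def by auto

lemma module_homs_zero:
  assumes "f \<in> module_homs R M N" "left_module R M" "left_module R N"
  shows "f \<zero>\<^bsub>M\<^esub> = \<zero>\<^bsub>N\<^esub>"
proof -
  interpret M: left_module R M by fact
  interpret N: left_module R N by fact
  show ?thesis
    by (metis M.smult_l_null M.R.zero_closed M.M.zero_closed N.smult_l_null assms(1)
        module_homsD(1,3))
qed

lemma injective_module_imp_left_module: "injective_module T R M \<Longrightarrow> left_module R M"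
  unfolding injective_module_def by blast

lemma injective_moduleD:
  fixes A B :: "('a, 'c) module"
  assumes "injective_module TYPE('c) R M" "left_module R A" "left_module R B"
    "i \<in> module_homs R A B" "inj_on i (carrier A)" "f \<in> module_homs R A M"
  shows "\<exists>g \<in> module_homs R B M. \<forall>a\<in>carrier A. g (i a) = f a"
  using assms unfolding injective_module_def by blast

subsection \<open>Independence of the test type (Baer's criterion)\<close>

theorem injective_module_any_type:
  fixes R :: "('a, 'm) ring_scheme" and M :: "('a, 'b, 'n) module_scheme"
  assumes inj: "injective_module TYPE('a) R M"
  shows "injective_module TYPE('c) R M"
proof -
  have lM: "left_module R M" using inj unfolding injective_module_def by blast
  interpret M: left_module R M by fact
  have "\<exists>g \<in> module_homs R B M. \<forall>a\<in>carrier A. g (i a) = f a"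
    if lA: "left_module R A" and lB: "left_module R B" and i: "i \<in> module_homs R A B"
      and ii: "inj_on i (carrier A)" and f: "f \<in> module_homs R A M"
    for A B :: "('a, 'c) module" and i f
  proof -
    interpret A: left_module R A by fact
    interpret B: left_module R B by fact
    define P where "P G \<longleftrightarrow> G \<subseteq> carrier B \<times> carrier M \<and>
      (\<forall>a\<in>carrier A. (i a, f a) \<in> G) \<and>
      (\<forall>x p y q. (x, p) \<in> G \<longrightarrow> (y, q) \<in> G \<longrightarrow> (x \<oplus>\<^bsub>B\<^esub> y, p \<oplus>\<^bsub>M\<^esub> q) \<in> G) \<and>
      (\<forall>r\<in>carrier R. \<forall>x p. (x, p) \<in> G \<longrightarrow> (r \<odot>\<^bsub>B\<^esub> x, r \<odot>\<^bsub>M\<^esub> p) \<in> G) \<and>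
      (\<forall>p. (\<zero>\<^bsub>B\<^esub>, p) \<in> G \<longrightarrow> p = \<zero>\<^bsub>M\<^esub>)" for G :: "('c \<times> 'b) set"
    have P_base: "P ((\<lambda>a. (i a, f a)) ` carrier A)"
      unfolding P_def
    proof (intro conjI allI ballI impI)
      show "(\<lambda>a. (i a, f a)) ` carrier A \<subseteq> carrier B \<times> carrier M"
        using i f by (auto simp: module_homsD)
    next
      fix x p y q
      assume "(x, p) \<in> (\<lambda>a. (i a, f a)) ` carrier A" "(y, q) \<in> (\<lambda>a. (i a, f a)) ` carrier A"
      then obtain a b where "a \<in> carrier A" "b \<in> carrier A" "x = i a" "p = f a" "y = i b" "q = f b"
        by auto
      then show "(x \<oplus>\<^bsub>B\<^esub> y, p \<oplus>\<^bsub>M\<^esub> q) \<in> (\<lambda>a. (i a, f a)) ` carrier A"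
        using module_homsD(2)[OF i] module_homsD(2)[OF f]
        by (intro image_eqI[of _ _ "a \<oplus>\<^bsub>A\<^esub> b"]) auto
    next
      fix r x p
      assume "r \<in> carrier R" "(x, p) \<in> (\<lambda>a. (i a, f a)) ` carrier A"
      then obtain a where "a \<in> carrier A" "x = i a" "p = f a" by auto
      with \<open>r \<in> carrier R\<close> show "(r \<odot>\<^bsub>B\<^esub> x, r \<odot>\<^bsub>M\<^esub> p) \<in> (\<lambda>a. (i a, f a)) ` carrier A"
        using module_homsD(3)[OF i] module_homsD(3)[OF f]
        by (intro image_eqI[of _ _ "r \<odot>\<^bsub>A\<^esub> a"]) auto
    next
      fix p assume "(\<zero>\<^bsub>B\<^esub>, p) \<in> (\<lambda>a. (i a, f a)) ` carrier A"
      then obtain a where a: "a \<in> carrier A" "\<zero>\<^bsub>B\<^esub> = i a" "p = f a" by auto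
      then have "a = \<zero>\<^bsub>A\<^esub>"
        using ii module_homs_zero[OF i lA lB] by (auto dest: inj_onD)
      then show "p = \<zero>\<^bsub>M\<^esub>" using a module_homs_zero[OF f lA lM] by simp
    qed auto
    have "\<exists>G\<in>Collect P. \<forall>X\<in>Collect P. G \<subseteq> X \<longrightarrow> X = G"
    proof (rule subset_Zorn_nonempty)
      show "Collect P \<noteq> {}" using P_base by auto
      fix \<C> assume ne: "\<C> \<noteq> {}" and ch: "subset.chain (Collect P) \<C>"
      have PC: "\<And>G. G \<in> \<C> \<Longrightarrow> P G" using ch by (auto simp: subset.chain_def)
      have dir: "\<exists>G\<in>\<C>. u \<in> G \<and> v \<in> G" if "u \<in> \<Union>\<C>" "v \<in> \<Union>\<C>" for u v
        using that ch unfolding subset_chain_def by blast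
      have "P (\<Union>\<C>)"
        unfolding P_def
      proof (intro conjI allI ballI impI)
        show "\<Union>\<C> \<subseteq> carrier B \<times> carrier M" using PC unfolding P_def by blast
        show "(i a, f a) \<in> \<Union>\<C>" if "a \<in> carrier A" for a
          using PC ne that unfolding P_def by blast
        show "(x \<oplus>\<^bsub>B\<^esub> y, p \<oplus>\<^bsub>M\<^esub> q) \<in> \<Union>\<C>" if "(x, p) \<in> \<Union>\<C>" "(y, q) \<in> \<Union>\<C>" for x p y q
          using dir[OF that] PC unfolding P_def by blast
        show "(r \<odot>\<^bsub>B\<^esub> x, r \<odot>\<^bsub>M\<^esub> p) \<in> \<Union>\<C>" if "r \<in> carrier R" "(x, p) \<in> \<Union>\<C>" for r x p
          using that PC unfolding P_def by blast
        show "p = \<zero>\<^bsub>M\<^esub>" if "(\<zero>\<^bsub>B\<^esub>, p) \<in> \<Union>\<C>" for p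
          using that PC unfolding P_def by blast
      qed
      then show "\<Union>\<C> \<in> Collect P" by simp
    qed
    then obtain G where PG: "P G" and max: "\<And>X. P X \<Longrightarrow> G \<subseteq> X \<Longrightarrow> X = G" by blast
    have Gc: "x \<in> carrier B" "p \<in> carrier M" if "(x, p) \<in> G" for x p
      using PG that unfolding P_def by auto
    have GA: "(i a, f a) \<in> G" if "a \<in> carrier A" for a
      using PG that unfolding P_def by auto
    have Gadd: "(x \<oplus>\<^bsub>B\<^esub> y, p \<oplus>\<^bsub>M\<^esub> q) \<in> G" if "(x, p) \<in> G" "(y, q) \<in> G" for x p y q
      using PG that unfolding P_def by auto
    have Gsm: "(r \<odot>\<^bsub>B\<^esub> x, r \<odot>\<^bsub>M\<^esub> p) \<in> G" if "r \<in> carrier R" "(x, p) \<in> G" for r x p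
      using PG that unfolding P_def by auto
    have Gz: "p = \<zero>\<^bsub>M\<^esub>" if "(\<zero>\<^bsub>B\<^esub>, p) \<in> G" for p
      using PG that unfolding P_def by auto
    have G0: "(\<zero>\<^bsub>B\<^esub>, \<zero>\<^bsub>M\<^esub>) \<in> G"
      using GA[of "\<zero>\<^bsub>A\<^esub>"] module_homs_zero[OF i lA lB] module_homs_zero[OF f lA lM] by simp
    have Gneg: "(\<ominus>\<^bsub>B\<^esub> x, \<ominus>\<^bsub>M\<^esub> p) \<in> G" if "(x, p) \<in> G" for x p
      using Gsm[of "\<ominus>\<^bsub>R\<^esub> \<one>\<^bsub>R\<^esub>", OF _ that] Gc[OF that] B.smult_minus_one M.smult_minus_one by simp
    have Gfun: "p = q" if "(x, p) \<in> G" "(x, q) \<in> G" for x p q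
    proof -
      have "p \<oplus>\<^bsub>M\<^esub> \<ominus>\<^bsub>M\<^esub> q = \<zero>\<^bsub>M\<^esub>"
        using Gz Gadd[OF that(1) Gneg[OF that(2)]] Gc[OF that(1)] by (simp add: B.M.r_neg)
      then show ?thesis
        using Gc[OF that(1)] Gc[OF that(2)] M.M.minus_equality[of p "\<ominus>\<^bsub>M\<^esub> q"] by simp
    qed
    have total: "\<exists>p. (b, p) \<in> G" if b: "b \<in> carrier B" for b
    proof -
      define I where "I = {r \<in> carrier R. \<exists>p. (r \<odot>\<^bsub>B\<^esub> b, p) \<in> G}"
      define h where "h r = (THE p. (r \<odot>\<^bsub>B\<^esub> b, p) \<in> G)" for r
      have hI: "h r = p" if "(r \<odot>\<^bsub>B\<^esub> b, p) \<in> G" for r p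
        unfolding h_def using that Gfun by blast
      have hG: "(r \<odot>\<^bsub>B\<^esub> b, h r) \<in> G" if "r \<in> I" for r
        using that hI unfolding I_def by auto
      let ?Q = "regular_module R"
      have lQ: "left_module R ?Q" by (rule M.R.regular_left_module)
      interpret Q: left_module R ?Q by fact
      have Q: "carrier ?Q = carrier R" "add ?Q = add R" "smult ?Q = mult R" "zero ?Q = zero R"
        by (simp_all add: regular_module_def)
      have Iadd: "(r \<oplus>\<^bsub>R\<^esub> s) \<odot>\<^bsub>B\<^esub> b = r \<odot>\<^bsub>B\<^esub> b \<oplus>\<^bsub>B\<^esub> s \<odot>\<^bsub>B\<^esub> b" if "r \<in> carrier R" "s \<in> carrier R" for r s
        using that b B.smult_l_distr by simp
      have Ism: "(r \<otimes>\<^bsub>R\<^esub> s) \<odot>\<^bsub>B\<^esub> b = r \<odot>\<^bsub>B\<^esub> (s \<odot>\<^bsub>B\<^esub> b)" if "r \<in> carrier R" "s \<in> carrier R" for r s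
        using that b B.smult_assoc1 by simp
      have Ic: "r \<in> carrier R" if "r \<in> I" for r using that unfolding I_def by simp
      have G1: "((r \<oplus>\<^bsub>R\<^esub> s) \<odot>\<^bsub>B\<^esub> b, h r \<oplus>\<^bsub>M\<^esub> h s) \<in> G" if "r \<in> I" "s \<in> I" for r s
        using Gadd[OF hG[OF that(1)] hG[OF that(2)]] Iadd Ic that by simp
      have G2: "((r \<otimes>\<^bsub>R\<^esub> s) \<odot>\<^bsub>B\<^esub> b, r \<odot>\<^bsub>M\<^esub> h s) \<in> G" if "r \<in> carrier R" "s \<in> I" for r s
        using Gsm[OF that(1) hG[OF that(2)]] Ism Ic that by simp
      have I: "submodule I R ?Q"
        unfolding Q.submodule_iff Q
      proof (intro conjI ballI)
        show "\<zero>\<^bsub>R\<^esub> \<in> I" using G0 B.smult_l_null[OF b] unfolding I_def by auto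
        show "r \<oplus>\<^bsub>R\<^esub> s \<in> I" if "r \<in> I" "s \<in> I" for r s
          using G1[OF that] Ic that unfolding I_def by auto
        show "r \<otimes>\<^bsub>R\<^esub> s \<in> I" if "r \<in> carrier R" "s \<in> I" for r s
          using G2[OF that] Ic that unfolding I_def by auto
      qed (use Ic in auto)
      have hh: "h \<in> module_homs R (?Q\<lparr>carrier := I\<rparr>) M"
        unfolding module_homs_def using hI[OF G1] hI[OF G2] Gc(2)[OF hG] by (auto simp: Q)
      have "(\<lambda>x. x) \<in> module_homs R (?Q\<lparr>carrier := I\<rparr>) ?Q"
        unfolding module_homs_def using Ic by (auto simp: Q)
      from injective_moduleD[OF inj Q.submodule_left_module[OF I] lQ this _ hh]
      obtain k where k: "k \<in> module_homs R ?Q M" "\<And>r. r \<in> I \<Longrightarrow> k r = h r"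
        by auto
      define m where "m = k \<one>\<^bsub>R\<^esub>"
      have m: "m \<in> carrier M" unfolding m_def using module_homsD(1)[OF k(1)] by (simp add: Q)
      have km: "k r = r \<odot>\<^bsub>M\<^esub> m" if "r \<in> carrier R" for r
        unfolding m_def using module_homsD(3)[OF k(1), of r "\<one>\<^bsub>R\<^esub>"] that by (simp add: Q)
      define H where "H = {(x \<oplus>\<^bsub>B\<^esub> r \<odot>\<^bsub>B\<^esub> b, p \<oplus>\<^bsub>M\<^esub> r \<odot>\<^bsub>M\<^esub> m) | x p r. (x, p) \<in> G \<and> r \<in> carrier R}"
      have GH: "G \<subseteq> H"
      proof clarify
        fix x p assume xp: "(x, p) \<in> G"
        have "x = x \<oplus>\<^bsub>B\<^esub> \<zero>\<^bsub>R\<^esub> \<odot>\<^bsub>B\<^esub> b" "p = p \<oplus>\<^bsub>M\<^esub> \<zero>\<^bsub>R\<^esub> \<odot>\<^bsub>M\<^esub> m"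
          using Gc[OF xp] b m B.smult_l_null M.smult_l_null by auto
        then show "(x, p) \<in> H" unfolding H_def using xp by blast
      qed
      have "P H"
        unfolding P_def
      proof (intro conjI allI ballI impI)
        show "H \<subseteq> carrier B \<times> carrier M" unfolding H_def using Gc b m by auto
        show "(i a, f a) \<in> H" if "a \<in> carrier A" for a using GA[OF that] GH by auto
      next
        fix x p y q assume "(x, p) \<in> H" "(y, q) \<in> H"
        then obtain x' p' r y' q' s where *: "(x', p') \<in> G" "(y', q') \<in> G" "r \<in> carrier R" "s \<in> carrier R"
          "x = x' \<oplus>\<^bsub>B\<^esub> r \<odot>\<^bsub>B\<^esub> b" "p = p' \<oplus>\<^bsub>M\<^esub> r \<odot>\<^bsub>M\<^esub> m" "y = y' \<oplus>\<^bsub>B\<^esub> s \<odot>\<^bsub>B\<^esub> b" "q = q' \<oplus>\<^bsub>M\<^esub> s \<odot>\<^bsub>M\<^esub> m"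
          unfolding H_def by blast
        have "x \<oplus>\<^bsub>B\<^esub> y = (x' \<oplus>\<^bsub>B\<^esub> y') \<oplus>\<^bsub>B\<^esub> (r \<oplus>\<^bsub>R\<^esub> s) \<odot>\<^bsub>B\<^esub> b"
          using * Gc b by (simp add: B.smult_l_distr B.M.a_ac)
        moreover have "p \<oplus>\<^bsub>M\<^esub> q = (p' \<oplus>\<^bsub>M\<^esub> q') \<oplus>\<^bsub>M\<^esub> (r \<oplus>\<^bsub>R\<^esub> s) \<odot>\<^bsub>M\<^esub> m"
          using * Gc m by (simp add: M.smult_l_distr M.M.a_ac)
        ultimately show "(x \<oplus>\<^bsub>B\<^esub> y, p \<oplus>\<^bsub>M\<^esub> q) \<in> H"
          unfolding H_def using Gadd[OF *(1,2)] M.R.a_closed[OF *(3,4)] by blast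
      next
        fix t x p assume t: "t \<in> carrier R" and "(x, p) \<in> H"
        then obtain x' p' r where *: "(x', p') \<in> G" "r \<in> carrier R"
          "x = x' \<oplus>\<^bsub>B\<^esub> r \<odot>\<^bsub>B\<^esub> b" "p = p' \<oplus>\<^bsub>M\<^esub> r \<odot>\<^bsub>M\<^esub> m"
          unfolding H_def by blast
        have "t \<odot>\<^bsub>B\<^esub> x = t \<odot>\<^bsub>B\<^esub> x' \<oplus>\<^bsub>B\<^esub> (t \<otimes>\<^bsub>R\<^esub> r) \<odot>\<^bsub>B\<^esub> b"
          using * Gc[OF *(1)] b t by (simp add: B.smult_r_distr B.smult_assoc1)
        moreover have "t \<odot>\<^bsub>M\<^esub> p = t \<odot>\<^bsub>M\<^esub> p' \<oplus>\<^bsub>M\<^esub> (t \<otimes>\<^bsub>R\<^esub> r) \<odot>\<^bsub>M\<^esub> m"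
          using * Gc[OF *(1)] m t by (simp add: M.smult_r_distr M.smult_assoc1)
        ultimately show "(t \<odot>\<^bsub>B\<^esub> x, t \<odot>\<^bsub>M\<^esub> p) \<in> H"
          unfolding H_def using Gsm[OF t *(1)] M.R.m_closed[OF t *(2)] by blast
      next
        fix p assume "(\<zero>\<^bsub>B\<^esub>, p) \<in> H"
        then obtain x' p' r where *: "(x', p') \<in> G" "r \<in> carrier R"
          "\<zero>\<^bsub>B\<^esub> = x' \<oplus>\<^bsub>B\<^esub> r \<odot>\<^bsub>B\<^esub> b" "p = p' \<oplus>\<^bsub>M\<^esub> r \<odot>\<^bsub>M\<^esub> m"
          unfolding H_def by blast
        have "r \<odot>\<^bsub>B\<^esub> b = \<ominus>\<^bsub>B\<^esub> x'"
          using *(2,3) Gc[OF *(1)] b B.M.minus_equality[of "r \<odot>\<^bsub>B\<^esub> b" x'] B.M.a_comm by simp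
        then have rb: "(r \<odot>\<^bsub>B\<^esub> b, \<ominus>\<^bsub>M\<^esub> p') \<in> G" using Gneg[OF *(1)] by simp
        then have "r \<in> I" unfolding I_def using *(2) by auto
        then have "r \<odot>\<^bsub>M\<^esub> m = \<ominus>\<^bsub>M\<^esub> p'" using k(2) km[OF *(2)] hI[OF rb] by simp
        then show "p = \<zero>\<^bsub>M\<^esub>" using *(4) Gc[OF *(1)] by (simp add: M.M.r_neg)
      qed
      then have "H = G" using max GH by blast
      moreover have "(\<zero>\<^bsub>B\<^esub> \<oplus>\<^bsub>B\<^esub> \<one>\<^bsub>R\<^esub> \<odot>\<^bsub>B\<^esub> b, \<zero>\<^bsub>M\<^esub> \<oplus>\<^bsub>M\<^esub> \<one>\<^bsub>R\<^esub> \<odot>\<^bsub>M\<^esub> m) \<in> H"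
        unfolding H_def using G0 M.R.one_closed by blast
      ultimately show ?thesis using b m by auto
    qed
    define g where "g x = (THE p. (x, p) \<in> G)" for x
    have gI: "g x = p" if "(x, p) \<in> G" for x p
      unfolding g_def using that Gfun by blast
    have gG: "(x, g x) \<in> G" if "x \<in> carrier B" for x
      using total[OF that] gI by auto
    have "g \<in> module_homs R B M"
      unfolding module_homs_def using gG Gc(2)[OF gG] gI[OF Gadd] gI[OF Gsm] by auto
    moreover have "g (i a) = f a" if "a \<in> carrier A" for a
      using gI[OF GA[OF that]] .
    ultimately show ?thesis by blast
  qed
  then show ?thesis
    unfolding injective_module_def using lM by blast
qed

subsection \<open>Independence of the injective envelope\<close>

lemma injective_module_extend:
  fixes A :: "('a, 'b) module" and B :: "('a, 'c) module"
  assumes F: "injective_module TYPE('a) R F"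
    and lA: "left_module R A" and lB: "left_module R B"
    and i: "i \<in> module_homs R A B" and ii: "inj_on i (carrier A)"
    and f: "f \<in> module_homs R A F"
  shows "\<exists>g \<in> module_homs R B F. \<forall>a\<in>carrier A. g (i a) = f a"
proof -
  interpret A: left_module R A by fact
  interpret B: left_module R B by fact
  let ?N = "i ` carrier A"
  let ?j = "the_inv_into (carrier A) i"
  have j: "?j (i a) = a" if "a \<in> carrier A" for a
    using the_inv_into_f_f[OF ii that] .
  have i0: "\<zero>\<^bsub>B\<^esub> = i \<zero>\<^bsub>A\<^esub>" using module_homs_zero[OF i lA lB] by simp
  have ia: "i a \<oplus>\<^bsub>B\<^esub> i b = i (a \<oplus>\<^bsub>A\<^esub> b)" if "a \<in> carrier A" "b \<in> carrier A" for a b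
    using module_homsD(2)[OF i that] by simp
  have ism: "r \<odot>\<^bsub>B\<^esub> i a = i (r \<odot>\<^bsub>A\<^esub> a)" if "r \<in> carrier R" "a \<in> carrier A" for r a
    using module_homsD(3)[OF i that] by simp
  have sub: "submodule ?N R B"
    unfolding B.submodule_iff i0 using module_homsD(1)[OF i] by (auto simp: ia ism)
  have "(f \<circ> ?j) \<in> module_homs R (B\<lparr>carrier := ?N\<rparr>) F"
    unfolding module_homs_def using module_homsD[OF f] by (auto simp: ia ism j)
  note fj = this
  have "(\<lambda>x. x) \<in> module_homs R (B\<lparr>carrier := ?N\<rparr>) B"
    unfolding module_homs_def using module_homsD(1)[OF i] by auto
  from injective_moduleD[OF injective_module_any_type[OF F] B.submodule_left_module[OF sub] lB this _ fj]
  obtain g where "g \<in> module_homs R B F" "\<And>x. x \<in> ?N \<Longrightarrow> g x = (f \<circ> ?j) x"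
    by auto
  then show ?thesis using j by (intro bexI[of _ g]) auto
qed

lemma module_homs_inj_onI:
  assumes lE: "left_module R E" and lF: "left_module R F" and g: "g \<in> module_homs R E F"
    and k: "\<And>x. x \<in> carrier E \<Longrightarrow> g x = \<zero>\<^bsub>F\<^esub> \<Longrightarrow> x = \<zero>\<^bsub>E\<^esub>"
  shows "inj_on g (carrier E)"
proof (rule inj_onI)
  interpret E: left_module R E by fact
  interpret F: left_module R F by fact
  fix x y assume xy: "x \<in> carrier E" "y \<in> carrier E" "g x = g y"
  have "g (x \<oplus>\<^bsub>E\<^esub> (\<ominus>\<^bsub>R\<^esub> \<one>\<^bsub>R\<^esub>) \<odot>\<^bsub>E\<^esub> y) = g y \<oplus>\<^bsub>F\<^esub> (\<ominus>\<^bsub>R\<^esub> \<one>\<^bsub>R\<^esub>) \<odot>\<^bsub>F\<^esub> g y"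
    using xy by (simp add: module_homsD[OF g])
  also have "\<dots> = \<zero>\<^bsub>F\<^esub>"
    using module_homsD(1)[OF g xy(2)] by (simp add: F.smult_minus_one F.M.r_neg)
  finally have "x \<oplus>\<^bsub>E\<^esub> \<ominus>\<^bsub>E\<^esub> y = \<zero>\<^bsub>E\<^esub>"
    using k xy by (simp add: E.smult_minus_one)
  then show "x = y"
    using xy E.M.minus_equality[of x "\<ominus>\<^bsub>E\<^esub> y"] by simp
qed

lemma essential_inj_on:
  assumes lE: "left_module R E" and lF: "left_module R F" and g: "g \<in> module_homs R E F"
    and es: "essential_submodule R N E" and gN: "inj_on g N"
  shows "inj_on g (carrier E)"
proof (rule module_homs_inj_onI[OF lE lF g])
  interpret E: left_module R E by fact
  interpret F: left_module R F by fact
  have g0: "g \<zero>\<^bsub>E\<^esub> = \<zero>\<^bsub>F\<^esub>" by (rule module_homs_zero[OF g lE lF])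
  let ?K = "{x \<in> carrier E. g x = \<zero>\<^bsub>F\<^esub>}"
  have K: "submodule ?K R E"
    unfolding E.submodule_iff using g0 by (auto simp: module_homsD[OF g] F.smult_r_null)
  have N: "\<zero>\<^bsub>E\<^esub> \<in> N" "N \<subseteq> carrier E"
    using es unfolding essential_submodule_def E.submodule_iff by auto
  have "N \<inter> ?K = {\<zero>\<^bsub>E\<^esub>}"
  proof (intro equalityI subsetI)
    fix x assume "x \<in> N \<inter> ?K"
    then have "x \<in> N" "g x = g \<zero>\<^bsub>E\<^esub>" using g0 by auto
    from inj_onD[OF gN this(2,1) N(1)] show "x \<in> {\<zero>\<^bsub>E\<^esub>}" by simp
  qed (use N g0 in auto)
  with es K have K0: "?K = {\<zero>\<^bsub>E\<^esub>}"
    unfolding essential_submodule_def by metis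
  fix x assume "x \<in> carrier E" "g x = \<zero>\<^bsub>F\<^esub>"
  then have "x \<in> ?K" by simp
  then show "x = \<zero>\<^bsub>E\<^esub>" unfolding K0 by simp
qed

theorem automorphism_invariant_any_envelope:
  fixes M :: "('a, 'b) module" and E' :: "('a, 'f) module"
  assumes inv: "automorphism_invariant TYPE('e) R M"
    and env': "injective_envelope R M E' \<kappa>" and \<phi>: "\<phi> \<in> module_auts R E'"
  shows "\<phi> ` (\<kappa> ` carrier M) \<subseteq> \<kappa> ` carrier M"
proof -
  obtain E :: "('a, 'e) module" and \<iota> where env: "injective_envelope R M E \<iota>"
    and st: "\<And>\<psi>. \<psi> \<in> module_auts R E \<Longrightarrow> \<psi> ` (\<iota> ` carrier M) \<subseteq> \<iota> ` carrier M"
    using inv unfolding automorphism_invariant_def by (elim exE conjE) (rule that, assumption, erule (1) bspec)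
  have lM: "left_module R M" and E: "injective_module TYPE('a) R E" and \<iota>: "\<iota> \<in> module_homs R M E"
    "inj_on \<iota> (carrier M)" and es: "essential_submodule R (\<iota> ` carrier M) E"
    using env[unfolded injective_envelope_def] by simp_all
  have E': "injective_module TYPE('a) R E'" and \<kappa>: "\<kappa> \<in> module_homs R M E'"
    "inj_on \<kappa> (carrier M)" and es': "essential_submodule R (\<kappa> ` carrier M) E'"
    using env'[unfolded injective_envelope_def] by simp_all
  have lE: "left_module R E" and lE': "left_module R E'"
    by (rule injective_module_imp_left_module[OF E], rule injective_module_imp_left_module[OF E'])
  obtain g where g: "g \<in> module_homs R E' E" "\<And>m. m \<in> carrier M \<Longrightarrow> g (\<kappa> m) = \<iota> m"
    using injective_module_extend[OF E lM lE' \<kappa> \<iota>(1)] by blast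
  have gi: "inj_on g (carrier E')"
    by (rule essential_inj_on[OF lE' lE g(1) es'])
       (use \<iota>(2) g(2) in \<open>auto simp: inj_on_def\<close>)
  have "(\<lambda>x. x) \<in> module_homs R E' E'" unfolding module_homs_def by auto
  then obtain h where h: "h \<in> module_homs R E E'" "\<And>x. x \<in> carrier E' \<Longrightarrow> h (g x) = x"
    using injective_module_extend[OF E' lE' lE g(1) gi] by blast
  have h\<iota>: "h (\<iota> m) = \<kappa> m" if "m \<in> carrier M" for m
    using h(2)[OF module_homsD(1)[OF \<kappa>(1) that]] g(2)[OF that] by simp
  have hi: "inj_on h (carrier E)"
    by (rule essential_inj_on[OF lE lE' h(1) es])
       (use \<kappa>(2) h\<iota> in \<open>auto simp: inj_on_def\<close>)
  have gh: "g (h y) = y" if "y \<in> carrier E" for y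
  proof (rule inj_onD[OF hi])
    have "h y \<in> carrier E'" by (rule module_homsD(1)[OF h(1) that])
    then show "h (g (h y)) = h y" "g (h y) \<in> carrier E"
      by (rule h(2), rule module_homsD(1)[OF g(1)])
  qed (rule that)
  have \<phi>h: "\<phi> \<in> module_homs R E' E'" and \<phi>b: "bij_betw \<phi> (carrier E') (carrier E')"
    using \<phi> unfolding module_auts_def by auto
  have maps: "h \<in> carrier E \<rightarrow> carrier E'" "g \<in> carrier E' \<rightarrow> carrier E"
    using module_homsD(1)[OF h(1)] module_homsD(1)[OF g(1)] by auto
  have "bij_betw h (carrier E) (carrier E')" "bij_betw g (carrier E') (carrier E)"
    by (rule bij_betwI[OF maps gh h(2)], assumption+, rule bij_betwI[OF maps(2,1) h(2) gh], assumption+)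
  then have "bij_betw (g \<circ> (\<phi> \<circ> h)) (carrier E) (carrier E)"
    using \<phi>b by (blast intro: bij_betw_trans)
  moreover have "g \<circ> (\<phi> \<circ> h) \<in> module_homs R E E"
    unfolding module_homs_def
    by (auto simp: module_homsD[OF g(1)] module_homsD[OF \<phi>h] module_homsD[OF h(1)])
  ultimately have "g \<circ> (\<phi> \<circ> h) \<in> module_auts R E" unfolding module_auts_def by blast
  from st[OF this] have *: "g (\<phi> (h (\<iota> m))) \<in> \<iota> ` carrier M" if "m \<in> carrier M" for m
    using that by auto
  show ?thesis
  proof clarify
    fix m assume m: "m \<in> carrier M"
    obtain m' where m': "m' \<in> carrier M" "g (\<phi> (\<kappa> m)) = \<iota> m'" using *[OF m] h\<iota>[OF m] by auto
    have "\<phi> (\<kappa> m) = h (g (\<phi> (\<kappa> m)))"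
      using h(2) module_homsD(1)[OF \<phi>h] module_homsD(1)[OF \<kappa>(1) m] by simp
    then show "\<phi> (\<kappa> m) \<in> \<kappa> ` carrier M" using m' h\<iota> by auto
  qed
qed

end

theory Submission
  imports Defs "HOL-Algebra.Ideal_Product" "HOL-Algebra.QuotRing" "HOL-Algebra.Subrings"
begin

text \<open>
  Let \<open>E\<close> be the injective envelope of \<open>R = Ru\<close>, and let \<open>T\<close> be the endomorphism ring of \<open>E\<close> modulo
  the ideal of endomorphisms with essential kernel. \<open>T\<close> is von Neumann regular, and every unit of \<open>T\<close>
  lifts to an automorphism of \<open>E\<close>. Hence, with \<open>J\<close> the left singular ideal of \<open>R\<close>, automorphism-invariance
  embeds \<open>R/J\<close> into \<open>T\<close> as a subring \<open>B\<close> that contains all units of \<open>T\<close>. Such a \<open>B\<close> contains all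
  square-zero elements, and therefore a large ideal of \<open>T\<close>. If \<open>B\<close> is noetherian on one side, this ideal is
  generated by a central idempotent whose complement is abelian regular; so \<open>B\<close> is semisimple, and
  \<open>B = T\<close> as soon as \<open>B\<close> contains the central idempotents of \<open>T\<close>.

  Also \<open>JE = Ju\<close>, which makes \<open>J\<close> nilpotent. Thus \<open>E\<close> has an essential socle, and a central
  idempotent of \<open>T\<close> is determined by the annihilator in \<open>R/J\<close> of the part of the socle that it cuts out.
  These annihilators are generated by central idempotents of \<open>B\<close>, of which there are finitely many, so
  counting shows that \<open>T\<close> and \<open>B\<close> have the same central idempotents. Consequently \<open>B = T\<close>, that is,
  \<open>E = Ru\<close>, and the socle is faithful over \<open>R/J\<close>. It follows that left and right annihilators are mutually
  inverse between left and right ideals, which transfers the chain conditions to both sides and yields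
  right self-injectivity by Baer's criterion.
\<close>

section \<open>Regular rings with few idempotents\<close>

text \<open>Automorphism-invariance speaks of the units of \<open>T\<close> only, and units can be
  scarce: \<open>1\<close> is the only unit of \<open>F_2 x F_2\<close>, so the diagonal copy of
  \<open>F_2\<close> contains all units without being the whole ring. By \<open>eq_carrier\<close>
  central idempotents are the only thing that can be missing from \<open>B\<close>, but nothing
  inside \<open>T\<close> decides whether they are. The missing information comes from the two
  actions on the socle: \<open>T\<close> acts by endomorphisms, \<open>R/J\<close> by scalars, and a
  central idempotent on one side leaves an ideal as its trace on the other. The resulting map
  between finite sets is used twice: its injectivity gives equality of the sets, its surjectivity
  gives faithfulness of the socle, without which left ideals could not be recovered from their
  annihilators.

  To treat both noetherian hypotheses at once, they are weakened to \<open>idem_acc\<close>, a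
  condition on idempotents that is left-right symmetric. They are separated again only for the
  nilpotency of \<open>J\<close> and for the final transfer of chain conditions.\<close>

definition idem_acc :: "('a, 'm) ring_scheme \<Rightarrow> 'a set \<Rightarrow> bool"
  where "idem_acc R X \<longleftrightarrow> (\<forall>g :: nat \<Rightarrow> 'a.
    (\<forall>n. g n \<in> X \<and> g n \<otimes>\<^bsub>R\<^esub> g n = g n \<and> g n \<otimes>\<^bsub>R\<^esub> g (Suc n) = g n \<and> g (Suc n) \<otimes>\<^bsub>R\<^esub> g n = g n) \<longrightarrow>
    (\<exists>n. g (Suc n) = g n))"

definition von_neumann_regular :: "('a, 'm) ring_scheme \<Rightarrow> bool"
  where "von_neumann_regular R \<longleftrightarrow>
    (\<forall>a\<in>carrier R. \<exists>x\<in>carrier R. a \<otimes>\<^bsub>R\<^esub> x \<otimes>\<^bsub>R\<^esub> a = a)"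

definition left_ideal :: "('a, 'm) ring_scheme \<Rightarrow> 'a set \<Rightarrow> bool"
  where "left_ideal R L \<longleftrightarrow> L \<subseteq> carrier R \<and> \<zero>\<^bsub>R\<^esub> \<in> L \<and>
    (\<forall>x\<in>L. \<forall>y\<in>L. x \<oplus>\<^bsub>R\<^esub> y \<in> L) \<and> (\<forall>r\<in>carrier R. \<forall>x\<in>L. r \<otimes>\<^bsub>R\<^esub> x \<in> L)"

definition right_ideal :: "('a, 'm) ring_scheme \<Rightarrow> 'a set \<Rightarrow> bool"
  where "right_ideal R I \<longleftrightarrow> I \<subseteq> carrier R \<and> \<zero>\<^bsub>R\<^esub> \<in> I \<and>
    (\<forall>x\<in>I. \<forall>y\<in>I. x \<oplus>\<^bsub>R\<^esub> y \<in> I) \<and> (\<forall>r\<in>carrier R. \<forall>x\<in>I. x \<otimes>\<^bsub>R\<^esub> r \<in> I)"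

definition central_idempotents :: "('a, 'm) ring_scheme \<Rightarrow> 'a set"
  where "central_idempotents R = {e \<in> carrier R. e \<otimes>\<^bsub>R\<^esub> e = e \<and>
    (\<forall>x\<in>carrier R. e \<otimes>\<^bsub>R\<^esub> x = x \<otimes>\<^bsub>R\<^esub> e)}"

lemma opposite_ring_simps [simp]:
  "carrier (opposite_ring R) = carrier R" "zero (opposite_ring R) = zero R"
  "one (opposite_ring R) = one R" "add (opposite_ring R) = add R"
  "x \<otimes>\<^bsub>opposite_ring R\<^esub> y = y \<otimes>\<^bsub>R\<^esub> x"
  by (simp_all add: opposite_ring_def)

lemma (in ring) opposite_ring_ring: "ring (opposite_ring R)"
proof (rule ringI)
  show "abelian_group (opposite_ring R)"
  proof (rule abelian_groupI)
    fix x assume "x \<in> carrier (opposite_ring R)"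
    then show "\<exists>y\<in>carrier (opposite_ring R). y \<oplus>\<^bsub>opposite_ring R\<^esub> x = \<zero>\<^bsub>opposite_ring R\<^esub>"
      by (intro bexI[of _ "\<ominus> x"]) (simp_all add: l_neg)
  qed (simp_all add: a_ac)
  show "monoid (opposite_ring R)"
    by (rule monoidI) (auto simp: m_assoc)
qed (auto simp: l_distr r_distr)

lemma left_ideal_opposite [simp]: "left_ideal (opposite_ring R) = right_ideal R"
  unfolding left_ideal_def right_ideal_def by (intro ext) simp

lemma idem_acc_subset: "idem_acc R X \<Longrightarrow> Y \<subseteq> X \<Longrightarrow> idem_acc R Y"
  unfolding idem_acc_def by blast

text \<open>Without a maximal element, the choice of a strictly larger idempotent could be iterated
  forever. A single repetition in every chain rules this out, which is why \<open>idem_acc\<close>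
  asks for no more.\<close>

lemma idem_acc_maximal:
  assumes acc: "idem_acc R X" and Y: "Y \<subseteq> X" "e0 \<in> Y" and idem: "\<And>e. e \<in> Y \<Longrightarrow> e \<otimes>\<^bsub>R\<^esub> e = e"
  shows "\<exists>e\<in>Y. \<forall>f\<in>Y. e \<otimes>\<^bsub>R\<^esub> f = e \<and> f \<otimes>\<^bsub>R\<^esub> e = e \<longrightarrow> f = e"
proof (rule ccontr)
  assume "\<not> ?thesis"
  then have *: "\<forall>e. e \<in> Y \<longrightarrow> (\<exists>f. f \<in> Y \<and> e \<otimes>\<^bsub>R\<^esub> f = e \<and> f \<otimes>\<^bsub>R\<^esub> e = e \<and> f \<noteq> e)" by blast
  define nx where "nx e = (SOME f. f \<in> Y \<and> e \<otimes>\<^bsub>R\<^esub> f = e \<and> f \<otimes>\<^bsub>R\<^esub> e = e \<and> f \<noteq> e)" for e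
  have nx: "nx e \<in> Y \<and> e \<otimes>\<^bsub>R\<^esub> nx e = e \<and> nx e \<otimes>\<^bsub>R\<^esub> e = e \<and> nx e \<noteq> e" if "e \<in> Y" for e
    unfolding nx_def by (rule someI_ex) (use * that in blast)
  define g where "g n = (nx ^^ n) e0" for n
  have g: "g n \<in> Y" for n by (induction n) (use Y nx in \<open>auto simp: g_def\<close>)
  have gS: "g (Suc n) = nx (g n)" for n by (simp add: g_def)
  have "\<exists>n. g (Suc n) = g n"
    using acc[unfolded idem_acc_def, rule_format, of g] g nx idem Y(1) by (auto simp: gS)
  then show False using nx g by (auto simp: gS)
qed

context ring
begin

lemmas expand_simps = minus_eq l_distr r_distr l_minus r_minus minus_add

lemma compl_compl: "e \<in> carrier R \<Longrightarrow> \<one> \<ominus> (\<one> \<ominus> e) = e"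
  using r_neg2[of "\<one>" e] by (simp add: expand_simps)

lemma add_compl: "e \<in> carrier R \<Longrightarrow> e \<oplus> (\<one> \<ominus> e) = \<one>"
  using a_lcomm[of e "\<one>" "\<ominus> e"] by (simp add: minus_eq r_neg)

lemma idempotent_complement:
  assumes "e \<in> carrier R" "e \<otimes> e = e"
  shows "\<one> \<ominus> e \<in> carrier R" "e \<otimes> (\<one> \<ominus> e) = \<zero>" "(\<one> \<ominus> e) \<otimes> e = \<zero>"
    "(\<one> \<ominus> e) \<otimes> (\<one> \<ominus> e) = \<one> \<ominus> e"
proof -
  show c: "\<one> \<ominus> e \<in> carrier R" using assms by simp
  have "e \<otimes> (\<one> \<ominus> e) = e \<ominus> e \<otimes> e" using assms(1) by (simp add: expand_simps)
  then show 1: "e \<otimes> (\<one> \<ominus> e) = \<zero>" using assms by (simp add: r_right_minus_eq)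
  have "(\<one> \<ominus> e) \<otimes> e = e \<ominus> e \<otimes> e" using assms(1) by (simp add: expand_simps)
  then show "(\<one> \<ominus> e) \<otimes> e = \<zero>" using assms by (simp add: r_right_minus_eq)
  have "(\<one> \<ominus> e) \<otimes> (\<one> \<ominus> e) = (\<one> \<ominus> e) \<ominus> e \<otimes> (\<one> \<ominus> e)"
    using assms(1) c by (subst (1) minus_eq) (simp add: l_distr l_minus minus_eq)
  then show "(\<one> \<ominus> e) \<otimes> (\<one> \<ominus> e) = \<one> \<ominus> e" using 1 c by (simp add: minus_eq[of _ \<zero>])
qed

text \<open>A maximal idempotent \<open>e\<close> of \<open>L\<close> is a right identity:
  regularity turns a nonzero \<open>x (1 - e)\<close> into a nonzero idempotent of \<open>L\<close>
  orthogonal to \<open>e\<close>, and adding it to \<open>e\<close> contradicts maximality.\<close>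

lemma left_ideal_idempotent:
  assumes reg: "von_neumann_regular R" and L: "left_ideal R L" and acc: "idem_acc R L"
  shows "\<exists>e\<in>L. e \<otimes> e = e \<and> (\<forall>x\<in>L. x \<otimes> e = x)"
proof -
  let ?Y = "{e \<in> L. e \<otimes> e = e}"
  have L': "L \<subseteq> carrier R" "\<zero> \<in> L" "\<And>x y. x \<in> L \<Longrightarrow> y \<in> L \<Longrightarrow> x \<oplus> y \<in> L"
    "\<And>r x. r \<in> carrier R \<Longrightarrow> x \<in> L \<Longrightarrow> r \<otimes> x \<in> L"
    using L unfolding left_ideal_def by auto
  have "?Y \<subseteq> L" "\<zero> \<in> ?Y" using L' by auto
  from idem_acc_maximal[OF acc this] obtain e where e: "e \<in> L" "e \<otimes> e = e"
    and max: "\<And>f. f \<in> L \<Longrightarrow> f \<otimes> f = f \<Longrightarrow> e \<otimes> f = e \<Longrightarrow> f \<otimes> e = e \<Longrightarrow> f = e"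
    by auto
  have ec: "e \<in> carrier R" using e L' by auto
  define d where "d = \<one> \<ominus> e"
  note d = idempotent_complement[OF ec e(2), folded d_def]
  have "x \<otimes> e = x" if x: "x \<in> L" for x
  proof -
    have xc: "x \<in> carrier R" using x L' by auto
    define k where "k = x \<otimes> d"
    have kc: "k \<in> carrier R" using xc d by (simp add: k_def)
    have ke: "k \<otimes> e = \<zero>" using xc d ec by (simp add: k_def m_assoc)
    have kd: "k \<otimes> d = k" using xc d by (simp add: k_def m_assoc)
    have k: "k = x \<oplus> (\<ominus> x) \<otimes> e" using xc ec unfolding k_def d_def by (simp add: expand_simps)
    then have kL: "k \<in> L"
      using L'(3)[OF x L'(4)[OF _ e(1)], of "\<ominus> x"] xc by simp
    obtain y where y: "y \<in> carrier R" "k \<otimes> y \<otimes> k = k"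
      using reg kc unfolding von_neumann_regular_def by blast
    \<comment> \<open>The factor \<open>d\<close> in front is harmless because
      \<open>k d = k\<close>; it makes \<open>e f\<close> vanish, whereas \<open>f e\<close>
      vanishes already by \<open>k e = 0\<close>.\<close>
    define f where "f = d \<otimes> y \<otimes> k"
    have fc: "f \<in> carrier R" using d y kc by (simp add: f_def)
    have fL: "f \<in> L" using d y L'(4)[OF _ kL, of "d \<otimes> y"] by (simp add: f_def)
    have kf: "k \<otimes> f = k" using d y kc kd by (simp add: f_def m_assoc[symmetric])
    have ff: "f \<otimes> f = f" using d y kc kf fc by (simp add: f_def m_assoc)
    have fe: "f \<otimes> e = \<zero>" using d y kc ke ec by (simp add: f_def m_assoc)
    have ef: "e \<otimes> f = \<zero>" using d y kc ec by (simp add: f_def m_assoc[symmetric])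
    have "e \<oplus> f = e"
      by (rule max) (use e(2) ec fc ff fe ef L'(3)[OF e(1) fL] in \<open>simp_all add: l_distr r_distr\<close>)
    then have "f = \<zero>" using r_neg1[OF ec fc] ec by (simp add: l_neg)
    then have "k = \<zero>" using kf kc by simp
    then have "x \<ominus> x \<otimes> e = \<zero>" unfolding k using xc ec by (simp add: minus_eq l_minus)
    then show ?thesis using xc ec by (simp add: r_right_minus_eq)
  qed
  then show ?thesis using e by blast
qed

lemma right_ideal_idempotent:
  assumes reg: "von_neumann_regular R" and I: "right_ideal R I" and acc: "idem_acc R I"
  shows "\<exists>e\<in>I. e \<otimes> e = e \<and> (\<forall>x\<in>I. e \<otimes> x = x)"
proof -
  have "von_neumann_regular (opposite_ring R)"
    using reg unfolding von_neumann_regular_def by (simp add: m_assoc)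
  moreover have "idem_acc (opposite_ring R) I"
    using acc unfolding idem_acc_def by (simp add: conj_commute)
  ultimately show ?thesis
    using ring.left_ideal_idempotent[OF opposite_ring_ring, of I] I by simp
qed

lemma ideal_imp_left_ideal: "ideal I R \<Longrightarrow> left_ideal R I"
  unfolding left_ideal_def
  by (meson additive_subgroup.a_closed additive_subgroup.a_subset additive_subgroup.zero_closed
      ideal.I_l_closed ideal.axioms(1))

lemma ideal_imp_right_ideal: "ideal I R \<Longrightarrow> right_ideal R I"
  unfolding right_ideal_def
  by (meson additive_subgroup.a_closed additive_subgroup.a_subset additive_subgroup.zero_closed
      ideal.I_r_closed ideal.axioms(1))

lemma left_ideal_a_inv: "left_ideal R L \<Longrightarrow> x \<in> L \<Longrightarrow> \<ominus> x \<in> L"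
  using l_minus[of \<one> x] unfolding left_ideal_def
  by (auto simp: subset_iff dest!: bspec[of "carrier R" _ "\<ominus> \<one>"])

lemma ideal_iff: "ideal I R \<longleftrightarrow> left_ideal R I \<and> right_ideal R I"
proof
  assume *: "left_ideal R I \<and> right_ideal R I"
  have "subgroup I (add_monoid R)"
    using * left_ideal_a_inv unfolding left_ideal_def
    by (intro subgroup.intro) (auto simp: a_inv_def[symmetric])
  then show "ideal I R"
    using * unfolding left_ideal_def right_ideal_def by (intro idealI ring_axioms) auto
qed (simp add: ideal_imp_left_ideal ideal_imp_right_ideal)

lemma ideal_opposite: "ideal I R \<Longrightarrow> ideal I (opposite_ring R)"
  using ring.ideal_iff[OF opposite_ring_ring, of I] ideal_iff[of I]
  by (simp add: left_ideal_def right_ideal_def)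

lemma left_ideal_sum:
  assumes L: "left_ideal R L" and K: "left_ideal R K"
  shows "left_ideal R {a \<oplus> b |a b. a \<in> L \<and> b \<in> K}" (is "left_ideal R ?X")
    and "L \<subseteq> {a \<oplus> b |a b. a \<in> L \<and> b \<in> K}" and "K \<subseteq> {a \<oplus> b |a b. a \<in> L \<and> b \<in> K}"
proof -
  have L': "\<And>x. x \<in> L \<Longrightarrow> x \<in> carrier R" "\<zero> \<in> L" "\<And>x y. x \<in> L \<Longrightarrow> y \<in> L \<Longrightarrow> x \<oplus> y \<in> L"
    "\<And>r x. r \<in> carrier R \<Longrightarrow> x \<in> L \<Longrightarrow> r \<otimes> x \<in> L"
    using L unfolding left_ideal_def by auto
  have K': "\<And>x. x \<in> K \<Longrightarrow> x \<in> carrier R" "\<zero> \<in> K" "\<And>x y. x \<in> K \<Longrightarrow> y \<in> K \<Longrightarrow> x \<oplus> y \<in> K"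
    "\<And>r x. r \<in> carrier R \<Longrightarrow> x \<in> K \<Longrightarrow> r \<otimes> x \<in> K"
    using K unfolding left_ideal_def by auto
  have l: "x = x \<oplus> \<zero>" if "x \<in> L" for x using that L'(1) by simp
  have k: "x = \<zero> \<oplus> x" if "x \<in> K" for x using that K'(1) by simp
  show "L \<subseteq> ?X" using l K'(2) by blast
  show "K \<subseteq> ?X" using k L'(2) by blast
  show "left_ideal R ?X"
    unfolding left_ideal_def
  proof (intro conjI ballI)
    show "?X \<subseteq> carrier R" using L'(1) K'(1) by auto
    show "\<zero> \<in> ?X" using \<open>L \<subseteq> ?X\<close> L'(2) by blast
    show "x \<oplus> y \<in> ?X" if xy: "x \<in> ?X" "y \<in> ?X" for x y
    proof -
      obtain a b a' b' where *: "a \<in> L" "b \<in> K" "x = a \<oplus> b" "a' \<in> L" "b' \<in> K" "y = a' \<oplus> b'"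
        using xy by blast
      have "x \<oplus> y = (a \<oplus> a') \<oplus> (b \<oplus> b')" using * L'(1) K'(1) by (simp add: a_ac)
      then show ?thesis using L'(3)[OF *(1,4)] K'(3)[OF *(2,5)] by blast
    qed
    show "r \<otimes> x \<in> ?X" if r: "r \<in> carrier R" and x: "x \<in> ?X" for r x
    proof -
      obtain a b where *: "a \<in> L" "b \<in> K" "x = a \<oplus> b" using x by blast
      have "r \<otimes> x = r \<otimes> a \<oplus> r \<otimes> b" using * L'(1) K'(1) r by (simp add: r_distr)
      then show ?thesis using L'(4)[OF r *(1)] K'(4)[OF r *(2)] by blast
    qed
  qed
qed

lemma left_ideal_principal:
  assumes y: "y \<in> carrier R"
  shows "left_ideal R {r \<otimes> y |r. r \<in> carrier R}" (is "left_ideal R ?X")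
    and "y \<in> {r \<otimes> y |r. r \<in> carrier R}"
proof -
  have "y = \<one> \<otimes> y" using y by simp
  then show "y \<in> ?X" by blast
  show "left_ideal R ?X"
    unfolding left_ideal_def
  proof (intro conjI ballI)
    show "?X \<subseteq> carrier R" using y by auto
    have "\<zero> = \<zero> \<otimes> y" using y by simp
    then show "\<zero> \<in> ?X" by blast
    show "x \<oplus> z \<in> ?X" if xz: "x \<in> ?X" "z \<in> ?X" for x z
    proof -
      obtain r s where "r \<in> carrier R" "s \<in> carrier R" "x = r \<otimes> y" "z = s \<otimes> y" using xz by blast
      then show ?thesis using y by (intro CollectI exI[of _ "r \<oplus> s"]) (simp add: l_distr)
    qed
    show "s \<otimes> x \<in> ?X" if s: "s \<in> carrier R" and x: "x \<in> ?X" for s x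
    proof -
      obtain r where "r \<in> carrier R" "x = r \<otimes> y" using x by blast
      then show ?thesis using y s by (intro CollectI exI[of _ "s \<otimes> r"]) (simp add: m_assoc)
    qed
  qed
qed

text \<open>A right identity and a left identity of \<open>I\<close> coincide in one element
  \<open>e\<close>. For any \<open>t\<close>, both \<open>e t\<close> and \<open>t e\<close> lie in
  \<open>I\<close>, hence both equal \<open>e t e\<close>.\<close>

lemma ideal_central_idempotent:
  assumes reg: "von_neumann_regular R" and I: "ideal I R" and acc: "idem_acc R I"
  shows "\<exists>e\<in>I. e \<in> central_idempotents R \<and> (\<forall>x\<in>I. x \<otimes> e = x)"
proof -
  have Ic: "I \<subseteq> carrier R" using ideal.Icarr[OF I] by auto
  obtain e where e: "e \<in> I" "e \<otimes> e = e" "\<And>x. x \<in> I \<Longrightarrow> x \<otimes> e = x"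
    using left_ideal_idempotent[OF reg ideal_imp_left_ideal[OF I] acc] by blast
  obtain f where f: "f \<in> I" "f \<otimes> f = f" "\<And>x. x \<in> I \<Longrightarrow> f \<otimes> x = x"
    using right_ideal_idempotent[OF reg ideal_imp_right_ideal[OF I] acc] by blast
  have fe: "f = e" using e(3)[OF f(1)] f(3)[OF e(1)] by simp
  have "e \<otimes> t = t \<otimes> e" if t: "t \<in> carrier R" for t
  proof -
    have "e \<otimes> t \<in> I" "t \<otimes> e \<in> I"
      using ideal.I_r_closed[OF I e(1) t] ideal.I_l_closed[OF I e(1) t] .
    then have "e \<otimes> t \<otimes> e = e \<otimes> t" "e \<otimes> (t \<otimes> e) = t \<otimes> e" using e(3) f(3)[unfolded fe] by auto
    then show ?thesis using m_assoc[of e t e] Ic e(1) t by auto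
  qed
  then show ?thesis using e Ic unfolding central_idempotents_def by blast
qed

section \<open>Central idempotents and their finiteness\<close>

lemma central_idempotentsD:
  assumes "e \<in> central_idempotents R"
  shows "e \<in> carrier R" "e \<otimes> e = e" "x \<in> carrier R \<Longrightarrow> e \<otimes> x = x \<otimes> e"
  using assms unfolding central_idempotents_def by auto

lemma central_idempotents_mult:
  assumes "e \<in> central_idempotents R" "f \<in> central_idempotents R"
  shows "e \<otimes> f \<in> central_idempotents R"
proof -
  note E = central_idempotentsD[OF assms(1)] and F = central_idempotentsD[OF assms(2)]
  have "e \<otimes> f \<otimes> (e \<otimes> f) = e \<otimes> (f \<otimes> e) \<otimes> f" using E(1) F(1) by (simp add: m_assoc)
  also have "\<dots> = (e \<otimes> e) \<otimes> (f \<otimes> f)" using E(1) F(1) unfolding F(3)[OF E(1)] by (simp add: m_assoc)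
  finally have "e \<otimes> f \<otimes> (e \<otimes> f) = e \<otimes> f" using E(2) F(2) by simp
  moreover have "e \<otimes> f \<otimes> x = x \<otimes> (e \<otimes> f)" if x: "x \<in> carrier R" for x
  proof -
    have "e \<otimes> f \<otimes> x = e \<otimes> (x \<otimes> f)" using x E(1) F(1) F(3)[OF x] by (simp add: m_assoc)
    also have "\<dots> = (x \<otimes> e) \<otimes> f" using x E(1) F(1) E(3)[OF x] m_assoc[of e x f] by simp
    finally show ?thesis using x E(1) F(1) by (simp add: m_assoc)
  qed
  ultimately show ?thesis using E F unfolding central_idempotents_def by blast
qed

lemma central_idempotents_compl:
  assumes "e \<in> central_idempotents R"
  shows "\<one> \<ominus> e \<in> central_idempotents R"
proof -
  note E = central_idempotentsD[OF assms]
  have "(\<one> \<ominus> e) \<otimes> x = x \<otimes> (\<one> \<ominus> e)" if "x \<in> carrier R" for x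
  proof -
    have "(\<one> \<ominus> e) \<otimes> x = x \<ominus> e \<otimes> x" "x \<otimes> (\<one> \<ominus> e) = x \<ominus> x \<otimes> e"
      using that E(1) by (simp_all add: expand_simps)
    then show ?thesis using E(3)[OF that] by simp
  qed
  then show ?thesis
    using idempotent_complement[OF E(1,2)] unfolding central_idempotents_def by blast
qed

lemma zero_central_idempotent: "\<zero> \<in> central_idempotents R"
  unfolding central_idempotents_def by auto

text \<open>Take \<open>c\<close> maximal among the central idempotents with only finitely many
  central idempotents below them. If \<open>c\<close> is not \<open>1\<close>, an atom
  \<open>d\<close> under its complement can be added: everything below \<open>c + d\<close> splits
  as \<open>x c + x d\<close> with \<open>x d\<close> equal to \<open>0\<close> or \<open>d\<close>,
  so finiteness persists and maximality fails.\<close>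

lemma finite_central_idempotents:
  assumes acc: "idem_acc R (carrier R)"
  shows "finite (central_idempotents R)"
proof -
  let ?C = "central_idempotents R"
  let ?dn = "\<lambda>c. {x \<in> ?C. x \<otimes> c = x}"
  let ?F = "{c \<in> ?C. finite (?dn c)}"
  have "?dn \<zero> \<subseteq> {\<zero>}" proof
    fix x assume "x \<in> ?dn \<zero>"
    then show "x \<in> {\<zero>}" using central_idempotentsD(1)[of x] by simp
  qed
  then have "\<zero> \<in> ?F" using zero_central_idempotent finite_subset by auto
  have "?F \<subseteq> carrier R" using central_idempotentsD(1) by auto
  obtain c where c: "c \<in> ?C" "finite (?dn c)"
    and max: "\<And>f. f \<in> ?C \<Longrightarrow> finite (?dn f) \<Longrightarrow> c \<otimes> f = c \<Longrightarrow> f \<otimes> c = c \<Longrightarrow> f = c"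
  proof -
    have "\<exists>e\<in>?F. \<forall>f\<in>?F. e \<otimes> f = e \<and> f \<otimes> e = e \<longrightarrow> f = e"
      by (rule idem_acc_maximal[OF acc, of ?F \<zero>]) (use \<open>?F \<subseteq> carrier R\<close> \<open>\<zero> \<in> ?F\<close> central_idempotentsD(2) in blast)+
    with that show thesis by blast
  qed
  note C = central_idempotentsD[OF c(1)]
  have "c = \<one>"
  proof (rule ccontr)
    assume ne: "c \<noteq> \<one>"
    \<comment> \<open>An atom \<open>d\<close> below the complement of \<open>c\<close> is the complement of a maximal \<open>h\<close>.\<close>
    let ?G = "{h \<in> ?C. h \<noteq> \<one> \<and> c \<otimes> h = c}"
    have "c \<in> ?G" "?G \<subseteq> carrier R" using c(1) ne C(2) central_idempotentsD(1) by auto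
    obtain h where h: "h \<in> ?C" "h \<noteq> \<one>" "c \<otimes> h = c"
      and hmax: "\<And>f. f \<in> ?C \<Longrightarrow> f \<noteq> \<one> \<Longrightarrow> c \<otimes> f = c \<Longrightarrow> h \<otimes> f = h \<Longrightarrow> f \<otimes> h = h \<Longrightarrow> f = h"
    proof -
      have "\<exists>e\<in>?G. \<forall>f\<in>?G. e \<otimes> f = e \<and> f \<otimes> e = e \<longrightarrow> f = e"
        by (rule idem_acc_maximal[OF acc, of ?G c]) (use \<open>?G \<subseteq> carrier R\<close> \<open>c \<in> ?G\<close> central_idempotentsD(2) in blast)+
      with that show thesis by blast
    qed
    note H = central_idempotentsD[OF h(1)]
    define d where "d = \<one> \<ominus> h"
    have d: "d \<in> ?C" using central_idempotents_compl[OF h(1)] by (simp add: d_def)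
    note D = central_idempotentsD[OF d]
    have hd: "h \<otimes> d = \<zero>" "d \<otimes> h = \<zero>" using idempotent_complement[OF H(1,2)] by (simp_all add: d_def)
    have d0: "d \<noteq> \<zero>" using h(2) H(1) unfolding d_def by (auto simp: r_right_minus_eq)
    have cd: "c \<otimes> d = \<zero>" using h(3) hd C(1) D(1) H(1) m_assoc[of c h d] by simp
    have dc: "d \<otimes> c = \<zero>" using cd C(3)[OF D(1)] by simp
    \<comment> \<open>If \<open>x d\<close> lay strictly between \<open>0\<close> and
      \<open>d\<close>, its complement would lie strictly between \<open>h\<close> and
      \<open>1\<close>.\<close>
    have atom: "x \<otimes> d = \<zero> \<or> x \<otimes> d = d" if x: "x \<in> ?C" for x
    proof (rule ccontr)
      assume a: "\<not> ?thesis"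
      note X = central_idempotentsD[OF x]
      define y where "y = x \<otimes> d"
      have y: "y \<in> ?C" using central_idempotents_mult[OF x d] by (simp add: y_def)
      note Y = central_idempotentsD[OF y]
      have yd: "y = d \<otimes> x" using D(3)[OF X(1)] by (simp add: y_def)
      have hy: "h \<otimes> y = \<zero>" using hd X(1) H(1) D(1) unfolding yd by (simp add: m_assoc[symmetric])
      have cy: "c \<otimes> y = \<zero>" using cd X(1) C(1) D(1) unfolding yd by (simp add: m_assoc[symmetric])
      define f where "f = \<one> \<ominus> y"
      have fC: "f \<in> ?C" using central_idempotents_compl[OF y] by (simp add: f_def)
      have f1: "f \<noteq> \<one>"
      proof
        assume "f = \<one>"
        then have "y = \<zero>" using compl_compl[OF Y(1)] unfolding f_def by (simp add: minus_eq r_neg)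
        then show False using a unfolding y_def by (simp add: r_right_minus_eq)
      qed
      have "c \<otimes> f = c \<ominus> c \<otimes> y" using C(1) Y(1) unfolding f_def by (simp add: expand_simps)
      then have cf: "c \<otimes> f = c" using cy C(1) by (simp add: minus_eq)
      have "h \<otimes> f = h \<ominus> h \<otimes> y" using H(1) Y(1) unfolding f_def by (simp add: expand_simps)
      then have hf: "h \<otimes> f = h" using hy H(1) by (simp add: minus_eq)
      have "f = h"
        by (rule hmax[OF fC f1 cf hf trans[OF H(3)[OF central_idempotentsD(1)[OF fC], symmetric] hf]])
      then have "y = d" using compl_compl[OF Y(1)] by (simp add: f_def d_def)
      then show False using a unfolding y_def by simp
    qed
    define e where "e = c \<oplus> d"
    have "e \<otimes> e = e" using C(1,2) D(1,2) cd dc by (simp add: e_def l_distr r_distr)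
    moreover have "e \<otimes> x = x \<otimes> e" if x: "x \<in> carrier R" for x
      unfolding e_def using C(1) D(1) x by (simp add: l_distr r_distr C(3)[OF x] D(3)[OF x])
    moreover have "e \<in> carrier R" using C(1) D(1) by (simp add: e_def)
    ultimately have e: "e \<in> ?C" unfolding central_idempotents_def by blast
    have ec: "c \<otimes> e = c" "e \<otimes> c = c" using C(1,2) D(1,2) cd dc by (auto simp: e_def l_distr r_distr)
    have "?dn e \<subseteq> (\<lambda>(x, y). x \<oplus> y) ` (?dn c \<times> {\<zero>, d})"
    proof
      fix x assume x: "x \<in> ?dn e"
      then have X: "x \<in> ?C" "x \<in> carrier R" and xe: "x \<otimes> c \<oplus> x \<otimes> d = x"
        using central_idempotentsD(1) C(1) D(1) by (auto simp: e_def r_distr)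
      have "x \<otimes> c \<in> ?dn c" using central_idempotents_mult[OF X(1) c(1)] X(2) C(1,2) by (simp add: m_assoc)
      then show "x \<in> (\<lambda>(x, y). x \<oplus> y) ` (?dn c \<times> {\<zero>, d})"
        using atom[OF X(1)] by (intro image_eqI[of _ _ "(x \<otimes> c, x \<otimes> d)"]) (simp_all add: xe)
    qed
    then have "finite (?dn e)" by (rule finite_subset) (use c(2) in simp)
    from max[OF e this ec] have "e = c" .
    then show False using d0 C(1) D(1) r_neg1[OF C(1) D(1)] unfolding e_def by (simp add: l_neg)
  qed
  then have "?C = ?dn c" using central_idempotentsD(1) by auto
  then show ?thesis using c(2) by simp
qed

end

section \<open>Subrings containing all units of a regular ring\<close>

text \<open>Later instantiated with \<open>T\<close> as the ring and the image of the base ring as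
  \<open>B\<close>. The chain condition is imposed on \<open>B\<close> alone, since the noetherian
  hypothesis says nothing about \<open>T\<close> directly.\<close>

locale unit_subring = ring +
  fixes B
  assumes regular: "von_neumann_regular R"
    and subring: "subring B R"
    and Units_subset: "Units R \<subseteq> B"
    and acc: "idem_acc R B"
begin

lemma B_carrier: "x \<in> B \<Longrightarrow> x \<in> carrier R"
  and B_zero: "\<zero> \<in> B" and B_one: "\<one> \<in> B"
  and B_add: "x \<in> B \<Longrightarrow> y \<in> B \<Longrightarrow> x \<oplus> y \<in> B"
  and B_mult: "x \<in> B \<Longrightarrow> y \<in> B \<Longrightarrow> x \<otimes> y \<in> B"
  and B_minus: "x \<in> B \<Longrightarrow> y \<in> B \<Longrightarrow> x \<ominus> y \<in> B"
  using subringE[OF subring] by (auto simp: minus_eq)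

text \<open>The element \<open>1 + x\<close> is a unit, with inverse \<open>1 - x\<close>.\<close>

lemma square_zero_mem:
  assumes x: "x \<in> carrier R" "x \<otimes> x = \<zero>"
  shows "x \<in> B"
proof -
  have "(\<one> \<oplus> x) \<otimes> (\<one> \<ominus> x) = \<one>" "(\<one> \<ominus> x) \<otimes> (\<one> \<oplus> x) = \<one>"
    using x r_neg2[of x "\<one>"] by (simp_all add: expand_simps a_ac r_neg1 r_neg2 r_neg l_neg r_right_minus_eq)
  then have "\<one> \<oplus> x \<in> Units R" using x unfolding Units_def by (auto intro!: bexI[of _ "\<one> \<ominus> x"])
  then have "(\<one> \<oplus> x) \<ominus> \<one> \<in> B" using Units_subset B_one B_minus by blast
  moreover have "(\<one> \<oplus> x) \<ominus> \<one> = x" using x by (simp add: minus_eq a_ac r_neg r_neg1 r_neg2)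
  ultimately show ?thesis by simp
qed

text \<open>Both elements square to zero, as \<open>(1 - e) e\<close> or \<open>e (1 - e)\<close>
  appears in the middle.\<close>

lemma corner_mem:
  assumes e: "e \<in> carrier R" "e \<otimes> e = e" and t: "t \<in> carrier R"
  shows "e \<otimes> t \<otimes> (\<one> \<ominus> e) \<in> B" "(\<one> \<ominus> e) \<otimes> t \<otimes> e \<in> B"
proof -
  define d where "d = \<one> \<ominus> e"
  note d = idempotent_complement[OF e, folded d_def]
  have "e \<otimes> t \<otimes> d \<otimes> (e \<otimes> t \<otimes> d) = e \<otimes> t \<otimes> (d \<otimes> e) \<otimes> t \<otimes> d"
    "d \<otimes> t \<otimes> e \<otimes> (d \<otimes> t \<otimes> e) = d \<otimes> t \<otimes> (e \<otimes> d) \<otimes> t \<otimes> e"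
    using e(1) t d(1) by (simp_all add: m_assoc)
  then show "e \<otimes> t \<otimes> (\<one> \<ominus> e) \<in> B" "(\<one> \<ominus> e) \<otimes> t \<otimes> e \<in> B"
    unfolding d_def[symmetric] using e(1) t d(1) by (auto intro!: square_zero_mem simp: d)
qed

section \<open>The largest ideal of the ring that lies in \<open>B\<close>\<close>

definition core :: "'a set"
  where "core = {t \<in> carrier R. \<forall>x\<in>carrier R. \<forall>y\<in>carrier R. x \<otimes> t \<otimes> y \<in> B}"

lemma core_subset: "core \<subseteq> B"
proof
  fix t assume "t \<in> core"
  then have "t \<in> carrier R" "\<one> \<otimes> t \<otimes> \<one> \<in> B" unfolding core_def by blast+
  then show "t \<in> B" by simp
qed

lemma core_ideal: "ideal core R"
proof -
  have "s \<otimes> t \<in> core" "t \<otimes> s \<in> core" if "s \<in> carrier R" "t \<in> core" for s t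
  proof -
    have t: "t \<in> carrier R" "\<And>x y. x \<in> carrier R \<Longrightarrow> y \<in> carrier R \<Longrightarrow> x \<otimes> t \<otimes> y \<in> B"
      using that(2) unfolding core_def by auto
    have "x \<otimes> (s \<otimes> t) \<otimes> y = (x \<otimes> s) \<otimes> t \<otimes> y" "x \<otimes> (t \<otimes> s) \<otimes> y = x \<otimes> t \<otimes> (s \<otimes> y)"
      if "x \<in> carrier R" "y \<in> carrier R" for x y
      using that t(1) \<open>s \<in> carrier R\<close> by (simp_all add: m_assoc)
    then show "s \<otimes> t \<in> core" "t \<otimes> s \<in> core"
      unfolding core_def using t that(1) by auto
  qed
  moreover have "s \<oplus> t \<in> core" if "s \<in> core" "t \<in> core" for s t
    using that B_add unfolding core_def by (auto simp: l_distr r_distr)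
  moreover have "\<zero> \<in> core" "core \<subseteq> carrier R" unfolding core_def using B_zero by auto
  ultimately show ?thesis
    unfolding ideal_iff left_ideal_def right_ideal_def by auto
qed

text \<open>
  Splitting \<open>x\<close> and \<open>y\<close> along \<open>1 = e + (1 - e)\<close> turns \<open>x (e t (1 - e)) y\<close> into a sum of products
  of elements of \<open>eR(1 - e)\<close> and \<open>(1 - e)Re\<close>, which are square-zero and hence in \<open>B\<close>.
\<close>

lemma corner_core:
  assumes e: "e \<in> carrier R" "e \<otimes> e = e" and t: "t \<in> carrier R"
  shows "e \<otimes> t \<otimes> (\<one> \<ominus> e) \<in> core"
proof -
  define d where "d = \<one> \<ominus> e"
  note d = idempotent_complement[OF e, folded d_def]
  note cm = corner_mem[OF e, folded d_def]
  have ed: "e \<oplus> d = \<one>" using add_compl[OF e(1)] by (simp add: d_def)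
  have "x \<otimes> (e \<otimes> t \<otimes> d) \<otimes> y \<in> B" if xy: "x \<in> carrier R" "y \<in> carrier R" for x y
  proof -
    define v where "v = x \<otimes> (e \<otimes> t \<otimes> d)"
    have vc: "v \<in> carrier R" using xy e t d by (simp add: v_def)
    have vd: "v \<otimes> d = v" using xy e t d by (simp add: v_def m_assoc)
    have "e \<otimes> v = e \<otimes> (x \<otimes> e \<otimes> t) \<otimes> d" using xy e(1) t d(1) by (simp add: v_def m_assoc)
    then have ev: "e \<otimes> v \<in> B" using cm(1)[of "x \<otimes> e \<otimes> t"] xy e t by simp
    have "d \<otimes> v = (d \<otimes> x \<otimes> e) \<otimes> (e \<otimes> t \<otimes> d)"
      using xy e(1) t d(1) m_assoc[of e e "t \<otimes> d"] e(2) by (simp add: v_def m_assoc)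
    then have dv: "d \<otimes> v \<in> B" using cm(2)[OF xy(1)] cm(1)[OF t] B_mult by simp
    have "v = e \<otimes> v \<oplus> d \<otimes> v" using vc e(1) d(1) ed l_distr[of e d v] by simp
    then have vB: "v \<in> B" using ev dv B_add by metis
    have dye: "d \<otimes> y \<otimes> e \<in> B" using cm(2)[OF xy(2)] .
    have 1: "v \<otimes> (y \<otimes> e) \<in> B"
    proof -
      have "v \<otimes> (y \<otimes> e) = v \<otimes> (d \<otimes> y \<otimes> e)" 
        using vc xy e(1) d(1) m_assoc[of v d "y \<otimes> e"] vd by (simp add: m_assoc)
      then show ?thesis using vB dye B_mult by simp
    qed
    have 2: "e \<otimes> v \<otimes> y \<otimes> d \<in> B"
    proof -
      have "e \<otimes> v \<otimes> y \<otimes> d = e \<otimes> (v \<otimes> y) \<otimes> d" using vc xy e(1) d(1) by (simp add: m_assoc)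
      then show ?thesis using cm(1)[of "v \<otimes> y"] vc xy by simp
    qed
    have 3: "d \<otimes> v \<otimes> y \<otimes> d \<in> B"
    proof -
      have "d \<otimes> v \<otimes> y \<otimes> d = (d \<otimes> x \<otimes> e) \<otimes> (e \<otimes> (t \<otimes> d \<otimes> y) \<otimes> d)"
        using xy e(1) t d(1) m_assoc[of e e "t \<otimes> (d \<otimes> (y \<otimes> d))"] e(2)
        by (simp add: v_def m_assoc)
      then show ?thesis using cm(2)[OF xy(1)] cm(1)[of "t \<otimes> d \<otimes> y"] xy t d B_mult by simp
    qed
    have "v \<otimes> y = v \<otimes> (y \<otimes> e) \<oplus> v \<otimes> (y \<otimes> d)"
      using vc xy e(1) d(1) ed by (simp add: r_distr[symmetric])
    also have "v \<otimes> (y \<otimes> d) = e \<otimes> v \<otimes> y \<otimes> d \<oplus> d \<otimes> v \<otimes> y \<otimes> d"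
      using vc xy e(1) d(1) ed by (simp add: l_distr[symmetric] m_assoc)
    finally show ?thesis using 1 2 3 B_add unfolding v_def by simp
  qed
  then show ?thesis unfolding core_def d_def[symmetric] using e t d by auto
qed

lemma core_central_idempotent:
  "\<exists>g\<in>core. g \<in> central_idempotents R \<and> (\<forall>x\<in>core. x \<otimes> g = x)"
  by (rule ideal_central_idempotent[OF regular core_ideal idem_acc_subset[OF acc core_subset]])

text \<open>Modulo its core, \<open>R\<close> is abelian regular, so that its elements are units up to a central idempotent.\<close>

lemma unit_decomposition:
  assumes b: "b \<in> carrier R" and t: "t \<in> carrier R" "b \<otimes> t \<otimes> b = b"
    and g: "g \<in> core" "g \<in> central_idempotents R" "\<And>x. x \<in> core \<Longrightarrow> x \<otimes> g = x"
  shows "\<exists>p\<in>central_idempotents R. \<exists>v\<in>B. \<exists>v'\<in>B. 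
    (\<one> \<ominus> g) \<otimes> b = p \<otimes> v \<and> p \<otimes> (v' \<otimes> b) = p \<and> p \<otimes> b = (\<one> \<ominus> g) \<otimes> b"
proof -
  define w where "w = \<one> \<ominus> g"
  have w: "w \<in> central_idempotents R" unfolding w_def by (rule central_idempotents_compl[OF g(2)])
  note W = central_idempotentsD[OF w]
  note G = central_idempotentsD[OF g(2)]
  have kill: "w \<otimes> h = \<zero>" if "h \<in> core" for h
  proof -
    have hc: "h \<in> carrier R" using that core_subset B_carrier by auto
    have "w \<otimes> h = h \<otimes> w" by (rule W(3)[OF hc])
    also have "\<dots> = h \<otimes> g \<otimes> w" using g(3)[OF that] by simp
    also have "\<dots> = \<zero>"
      using hc G(1) W(1) idempotent_complement(2)[OF G(1,2)] by (simp add: m_assoc w_def)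
    finally show ?thesis .
  qed
  \<comment> \<open>The off-diagonal corners of \<open>x\<close> with respect to \<open>e\<close>
    lie in the core and are killed by \<open>w\<close>; this is the sense in which all idempotents
    are central modulo the core.\<close>
  have central: "w \<otimes> e \<in> central_idempotents R" if e: "e \<in> carrier R" "e \<otimes> e = e" for e
  proof -
    define d where "d = \<one> \<ominus> e"
    note d = idempotent_complement[OF e, folded d_def]
    have ed: "e \<oplus> d = \<one>" using add_compl[OF e(1)] by (simp add: d_def)
    have 1: "w \<otimes> e \<otimes> x = x \<otimes> (w \<otimes> e)" if x: "x \<in> carrier R" for x
    proof -
      have "d \<otimes> x \<otimes> (\<one> \<ominus> d) \<in> core" by (rule corner_core[OF d(1,4) x])
      then have "d \<otimes> x \<otimes> e \<in> core" unfolding d_def compl_compl[OF e(1)] .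
      then have k: "w \<otimes> (e \<otimes> x \<otimes> d) = \<zero>" "w \<otimes> (d \<otimes> x \<otimes> e) = \<zero>"
        using corner_core[OF e x] kill unfolding d_def by auto
      have "e \<otimes> x \<otimes> e \<oplus> e \<otimes> x \<otimes> d = e \<otimes> x" using e(1) x d(1) ed by (simp add: r_distr[symmetric])
      then have "w \<otimes> (e \<otimes> x) = w \<otimes> (e \<otimes> x \<otimes> e)"
        using e(1) x d(1) W(1) k(1) r_distr[of "e \<otimes> x \<otimes> e" "e \<otimes> x \<otimes> d" w] by simp
      moreover have "e \<otimes> x \<otimes> e \<oplus> d \<otimes> x \<otimes> e = x \<otimes> e"
        using e(1) x d(1) ed by (simp add: l_distr[symmetric] m_assoc)
      then have "w \<otimes> (x \<otimes> e) = w \<otimes> (e \<otimes> x \<otimes> e)"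
        using e(1) x d(1) W(1) k(2) r_distr[of "e \<otimes> x \<otimes> e" "d \<otimes> x \<otimes> e" w] by simp
      ultimately have "w \<otimes> (e \<otimes> x) = w \<otimes> x \<otimes> e" using e(1) x W(1) by (simp add: m_assoc)
      then show ?thesis using e(1) x W(1) unfolding W(3)[OF x] by (simp add: m_assoc)
    qed
    have "w \<otimes> e \<otimes> (w \<otimes> e) = w \<otimes> (e \<otimes> w) \<otimes> e" using e(1) W(1) by (simp add: m_assoc)
    also have "\<dots> = (w \<otimes> w) \<otimes> (e \<otimes> e)" using e(1) W(1) unfolding W(3)[OF e(1), symmetric] by (simp add: m_assoc)
    finally have "w \<otimes> e \<otimes> (w \<otimes> e) = w \<otimes> e" using e W(2) by simp
    moreover have "w \<otimes> e \<in> carrier R" using e W(1) by simp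
    ultimately show ?thesis unfolding central_idempotents_def using 1 by blast
  qed
  define p where "p = w \<otimes> (b \<otimes> t)"
  define q where "q = w \<otimes> (t \<otimes> b)"
  have bt: "b \<otimes> t \<otimes> (b \<otimes> t) = b \<otimes> t" "t \<otimes> b \<otimes> (t \<otimes> b) = t \<otimes> b"
    using b t(1) m_assoc[of "b \<otimes> t" b t] m_assoc[of t "b \<otimes> t" b] t(2) m_assoc[of b t b]
    by (simp_all add: m_assoc)
  have p: "p \<in> central_idempotents R" and q: "q \<in> central_idempotents R"
    unfolding p_def q_def using central bt b t(1) by auto
  note P = central_idempotentsD[OF p] and Q = central_idempotentsD[OF q]
  have pb: "p \<otimes> b = w \<otimes> b" using b t W(1) by (simp add: p_def m_assoc)
  have bq: "b \<otimes> q = w \<otimes> b"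
  proof -
    have "b \<otimes> q = (b \<otimes> w) \<otimes> (t \<otimes> b)" using b t W(1) by (simp add: q_def m_assoc)
    also have "\<dots> = w \<otimes> (b \<otimes> t \<otimes> b)" using b t(1) W(1) unfolding W(3)[OF b, symmetric] by (simp add: m_assoc)
    finally show ?thesis using t(2) by simp
  qed
  have wp: "w \<otimes> p = p" "w \<otimes> q = q"
    using b t(1) W(1,2) m_assoc[of w w, symmetric] by (simp_all add: p_def q_def)
  \<comment> \<open>Modulo the core, \<open>b t\<close> and \<open>t b\<close> are one and the same
    central idempotent: shifting central factors shows \<open>q p = p\<close> and
    \<open>q p = q\<close>.\<close>
  have pq1: "q \<otimes> p = p"
  proof -
    have "q \<otimes> p = p \<otimes> q" by (rule Q(3)[OF P(1)])
    also have "\<dots> = w \<otimes> (b \<otimes> (t \<otimes> q))" using b t(1) W(1) Q(1) by (simp add: p_def m_assoc)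
    also have "\<dots> = w \<otimes> ((b \<otimes> q) \<otimes> t)" using b t(1) W(1) Q(1) unfolding Q(3)[OF t(1), symmetric] by (simp add: m_assoc)
    also have "\<dots> = (w \<otimes> w) \<otimes> (b \<otimes> t)" using b t(1) W(1) unfolding bq by (simp add: m_assoc)
    finally show ?thesis using W(2) by (simp add: p_def)
  qed
  have pq2: "q \<otimes> p = q"
  proof -
    have "q \<otimes> p = w \<otimes> (t \<otimes> (b \<otimes> p))" using b t(1) W(1) P(1) by (simp add: q_def m_assoc)
    also have "\<dots> = w \<otimes> (t \<otimes> (w \<otimes> b))" unfolding P(3)[OF b, symmetric] pb ..
    also have "\<dots> = w \<otimes> ((t \<otimes> w) \<otimes> b)" using b t(1) W(1) by (simp add: m_assoc)
    also have "\<dots> = (w \<otimes> w) \<otimes> (t \<otimes> b)" using b t(1) W(1) unfolding W(3)[OF t(1), symmetric] by (simp add: m_assoc)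
    finally show ?thesis using W(2) by (simp add: q_def)
  qed
  define c where "c = \<one> \<ominus> p"
  have c: "c \<in> central_idempotents R" unfolding c_def by (rule central_idempotents_compl[OF p])
  note Cc = central_idempotentsD[OF c]
  have pc: "p \<otimes> c = \<zero>" "c \<otimes> p = \<zero>" using idempotent_complement[OF P(1,2)] by (simp_all add: c_def)
  have pc1: "p \<oplus> c = \<one>" using add_compl[OF P(1)] by (simp add: c_def)
  have pbt: "p \<otimes> (b \<otimes> t) = p"
  proof -
    have "p \<otimes> (b \<otimes> t) = w \<otimes> (b \<otimes> t \<otimes> (b \<otimes> t))" using b t(1) W(1) by (simp add: p_def m_assoc)
    then show ?thesis unfolding bt p_def .
  qed
  have ptb: "p \<otimes> (t \<otimes> b) = p"
  proof -
    have "q \<otimes> (t \<otimes> b) = w \<otimes> (t \<otimes> b \<otimes> (t \<otimes> b))" using b t(1) W(1) by (simp add: q_def m_assoc)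
    then show ?thesis using pq1 pq2 unfolding bt q_def by simp
  qed
  \<comment> \<open>Elements \<open>p x + (1 - p)\<close> multiply inside the factor cut out by
    \<open>p\<close>. Applied to the pair \<open>b\<close>, \<open>t\<close> in both orders, this
    shows that \<open>v\<close> and \<open>v'\<close> below are inverse units.\<close>
  have un: "(p \<otimes> x \<oplus> c) \<otimes> (p \<otimes> y \<oplus> c) = \<one>"
    if xy: "x \<in> carrier R" "y \<in> carrier R" "p \<otimes> (x \<otimes> y) = p" for x y
  proof -
    have "p \<otimes> x \<otimes> (p \<otimes> y) = p \<otimes> (x \<otimes> p) \<otimes> y" using xy(1,2) P(1) by (simp add: m_assoc)
    also have "\<dots> = p \<otimes> p \<otimes> (x \<otimes> y)"
      using xy(1,2) P(1) unfolding P(3)[OF xy(1), symmetric] by (simp add: m_assoc)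
    finally have "p \<otimes> x \<otimes> (p \<otimes> y) = p \<otimes> p \<otimes> (x \<otimes> y)" .
    moreover have "p \<otimes> x \<otimes> c = \<zero>"
    proof -
      have "p \<otimes> x \<otimes> c = p \<otimes> (c \<otimes> x)" using xy P(1) Cc(1) unfolding Cc(3)[OF xy(1)] by (simp add: m_assoc)
      then show ?thesis using pc xy P(1) Cc(1) by (simp add: m_assoc[symmetric])
    qed
    moreover have "c \<otimes> (p \<otimes> y) = \<zero>" using pc xy P(1) Cc(1) by (simp add: m_assoc[symmetric])
    ultimately show ?thesis using xy P(1,2) Cc(1,2) pc1 by (simp add: l_distr r_distr)
  qed
  define v where "v = p \<otimes> b \<oplus> c"
  define v' where "v' = p \<otimes> t \<oplus> c"
  have "v \<otimes> v' = \<one>" "v' \<otimes> v = \<one>" unfolding v_def v'_def using un b t(1) pbt ptb by auto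
  moreover have vc: "v \<in> carrier R" "v' \<in> carrier R" unfolding v_def v'_def using b t(1) P(1) Cc(1) by auto
  ultimately have "v \<in> Units R" "v' \<in> Units R" unfolding Units_def by auto
  then have "v \<in> B" "v' \<in> B" using Units_subset by auto
  moreover have "p \<otimes> v = p \<otimes> b"
    unfolding v_def using b P(1,2) Cc(1) pc by (simp add: r_distr m_assoc[symmetric])
  moreover have "p \<otimes> (v' \<otimes> b) = p"
  proof -
    have "p \<otimes> v' = p \<otimes> t" unfolding v'_def using t(1) P(1,2) Cc(1) pc by (simp add: r_distr m_assoc[symmetric])
    then show ?thesis using ptb b t(1) P(1) vc by (simp add: m_assoc[symmetric])
  qed
  ultimately show ?thesis using p pb unfolding w_def by metis
qed

text \<open>A quasi-inverse of \<open>b\<close> in the whole ring is corrected to one in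
  \<open>B\<close> separately on the two factors of \<open>1 = g + (1 - g)\<close>:
  \<open>g t\<close> lies in \<open>B\<close> because \<open>g\<close> is in the core, and on the
  other factor the unit \<open>v'\<close> inverts \<open>b\<close> up to a central
  idempotent.\<close>

lemma B_regular: "von_neumann_regular (R\<lparr>carrier := B\<rparr>)"
proof -
  obtain g where g: "g \<in> core" "g \<in> central_idempotents R" "\<And>x. x \<in> core \<Longrightarrow> x \<otimes> g = x"
    using core_central_idempotent by blast
  note G = central_idempotentsD[OF g(2)]
  have "\<exists>x\<in>B. b \<otimes> x \<otimes> b = b" if bB: "b \<in> B" for b
  proof -
    have b: "b \<in> carrier R" using bB B_carrier by auto
    obtain t where t: "t \<in> carrier R" "b \<otimes> t \<otimes> b = b"
      using regular b unfolding von_neumann_regular_def by blast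
    obtain p v v' where p: "p \<in> central_idempotents R" and v: "v \<in> B" "v' \<in> B"
      and eq: "p \<otimes> (v' \<otimes> b) = p" "p \<otimes> b = (\<one> \<ominus> g) \<otimes> b"
      using unit_decomposition[OF b t g] by blast
    note P = central_idempotentsD[OF p]
    have vc: "v' \<in> carrier R" using v B_carrier by auto
    define w where "w = \<one> \<ominus> g"
    have w: "w \<in> central_idempotents R" unfolding w_def by (rule central_idempotents_compl[OF g(2)])
    note W = central_idempotentsD[OF w]
    have gt: "g \<otimes> t \<in> B" using ideal.I_r_closed[OF core_ideal g(1) t(1)] core_subset by auto
    have gB: "g \<in> B" using g(1) core_subset by auto
    have x: "g \<otimes> t \<oplus> w \<otimes> v' \<in> B"
      unfolding w_def using gt gB B_add B_mult B_minus B_one v by auto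
    have "b \<otimes> (g \<otimes> t) \<otimes> b = g \<otimes> b"
    proof -
      have "b \<otimes> (g \<otimes> t) \<otimes> b = (b \<otimes> g) \<otimes> (t \<otimes> b)" using b t(1) G(1) by (simp add: m_assoc)
      also have "\<dots> = g \<otimes> (b \<otimes> t \<otimes> b)" using b t(1) G(1) unfolding G(3)[OF b, symmetric] by (simp add: m_assoc)
      finally show ?thesis using t(2) by simp
    qed
    moreover have "b \<otimes> (w \<otimes> v') \<otimes> b = w \<otimes> b"
    proof -
      have "b \<otimes> (w \<otimes> v') \<otimes> b = (b \<otimes> w) \<otimes> (v' \<otimes> b)" using b vc W(1) by (simp add: m_assoc)
      also have "\<dots> = (p \<otimes> b) \<otimes> (v' \<otimes> b)" unfolding eq(2) w_def[symmetric] W(3)[OF b] ..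
      also have "\<dots> = b \<otimes> (p \<otimes> (v' \<otimes> b))" using b vc P(1) unfolding P(3)[OF b] by (simp add: m_assoc)
      also have "\<dots> = w \<otimes> b" unfolding eq(1) P(3)[OF b, symmetric] eq(2) w_def ..
      finally show ?thesis .
    qed
    ultimately have "b \<otimes> (g \<otimes> t \<oplus> w \<otimes> v') \<otimes> b = (g \<oplus> w) \<otimes> b"
      using b t(1) vc G(1) W(1) by (simp add: l_distr r_distr)
    moreover have "g \<oplus> w = \<one>" unfolding w_def by (rule add_compl[OF G(1)])
    ultimately show ?thesis using x b by (intro bexI[of _ "g \<otimes> t \<oplus> w \<otimes> v'"]) auto
  qed
  then show ?thesis unfolding von_neumann_regular_def by simp
qed

text \<open>For arbitrary \<open>t\<close>, the corners \<open>e t (1 - e)\<close> and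
  \<open>(1 - e) t e\<close> lie in \<open>B\<close>, so \<open>e\<close> commutes with them, and
  this forces both to vanish.\<close>

lemma central_in_B_imp_central:
  assumes e: "e \<in> B" "e \<otimes> e = e" "\<And>x. x \<in> B \<Longrightarrow> e \<otimes> x = x \<otimes> e"
  shows "e \<in> central_idempotents R"
proof -
  have ec: "e \<in> carrier R" using e(1) B_carrier by auto
  define d where "d = \<one> \<ominus> e"
  note d = idempotent_complement[OF ec e(2), folded d_def]
  have ed: "e \<oplus> d = \<one>" using add_compl[OF ec] by (simp add: d_def)
  have "e \<otimes> t = t \<otimes> e" if t: "t \<in> carrier R" for t
  proof -
    note cm = corner_mem[OF ec e(2) t, folded d_def]
    have "e \<otimes> t \<otimes> d = e \<otimes> (e \<otimes> t \<otimes> d)" using ec t d(1) m_assoc[of e e "t \<otimes> d"] e(2) by (simp add: m_assoc)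
    also have "\<dots> = e \<otimes> t \<otimes> d \<otimes> e" by (rule e(3)[OF cm(1)])
    also have "\<dots> = \<zero>" using ec t d by (simp add: m_assoc)
    finally have 1: "e \<otimes> t \<otimes> d = \<zero>" .
    have "d \<otimes> t \<otimes> e = d \<otimes> t \<otimes> e \<otimes> e" using ec t d e(2) by (simp add: m_assoc)
    also have "\<dots> = e \<otimes> (d \<otimes> t \<otimes> e)" by (rule e(3)[OF cm(2), symmetric])
    also have "\<dots> = \<zero>" using ec t d by (simp add: m_assoc[symmetric])
    finally have 2: "d \<otimes> t \<otimes> e = \<zero>" .
    have "e \<otimes> t = e \<otimes> t \<otimes> e \<oplus> e \<otimes> t \<otimes> d" using ec t d(1) ed by (simp add: r_distr[symmetric])
    moreover have "t \<otimes> e = e \<otimes> t \<otimes> e \<oplus> d \<otimes> t \<otimes> e"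
      using ec t d(1) ed by (simp add: l_distr[symmetric] m_assoc)
    ultimately show ?thesis using 1 2 ec t by simp
  qed
  then show ?thesis unfolding central_idempotents_def using e(2) ec by blast
qed

text \<open>In \<open>t = g t + p v\<close> the element \<open>g t\<close> lies in the core and
  \<open>v\<close> in \<open>B\<close>; the central idempotent \<open>p\<close> is the only factor
  whose membership has to be assumed.\<close>

lemma eq_carrier:
  assumes C: "central_idempotents R \<subseteq> B"
  shows "B = carrier R"
proof -
  obtain g where g: "g \<in> core" "g \<in> central_idempotents R" "\<And>x. x \<in> core \<Longrightarrow> x \<otimes> g = x"
    using core_central_idempotent by blast
  note G = central_idempotentsD[OF g(2)]
  have "t \<in> B" if t: "t \<in> carrier R" for t
  proof -
    obtain s where s: "s \<in> carrier R" "t \<otimes> s \<otimes> t = t"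
      using regular t unfolding von_neumann_regular_def by blast
    obtain p v where p: "p \<in> central_idempotents R" and v: "v \<in> B" and eq: "(\<one> \<ominus> g) \<otimes> t = p \<otimes> v"
      using unit_decomposition[OF t s g] by blast
    have "g \<otimes> t \<in> B" using ideal.I_r_closed[OF core_ideal g(1) t] core_subset by auto
    moreover have "(\<one> \<ominus> g) \<otimes> t \<in> B" unfolding eq using C p v B_mult by auto
    moreover have "t = g \<otimes> t \<oplus> (\<one> \<ominus> g) \<otimes> t"
      using t G(1) l_distr[of g "\<one> \<ominus> g" t] by (simp add: add_compl)
    ultimately show ?thesis using B_add by metis
  qed
  then show ?thesis using B_carrier by auto
qed

end

section \<open>Endomorphisms of an injective module modulo those with essential kernel\<close>

text \<open>
  Endomorphisms act on the right: the product of \<open>f\<close> and \<open>g\<close> is \<open>g \<circ> f\<close>. Thereby right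
  multiplications of a ring become endomorphisms without passing to the opposite ring.
\<close>

definition endo_ring :: "('a, 'm) ring_scheme \<Rightarrow> ('a, 'b, 'n) module_scheme \<Rightarrow> ('b \<Rightarrow> 'b) ring"
  where "endo_ring R M =
    \<lparr>carrier = module_homs R M M \<inter> extensional (carrier M),
     mult = (\<lambda>f g. compose (carrier M) g f), one = (\<lambda>x\<in>carrier M. x),
     zero = (\<lambda>x\<in>carrier M. \<zero>\<^bsub>M\<^esub>), add = (\<lambda>f g. \<lambda>x\<in>carrier M. f x \<oplus>\<^bsub>M\<^esub> g x)\<rparr>"

context left_module
begin

section \<open>The endomorphism ring of a module\<close>

abbreviation S where "S \<equiv> endo_ring R M"

lemma endo_hom: "f \<in> carrier S \<Longrightarrow> f \<in> module_homs R M M"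
  by (simp add: endo_ring_def)

lemma endo_closed: "f \<in> carrier S \<Longrightarrow> x \<in> carrier M \<Longrightarrow> f x \<in> carrier M"
  by (rule module_homsD(1)[OF endo_hom])

lemma endo_add: "f \<in> carrier S \<Longrightarrow> x \<in> carrier M \<Longrightarrow> y \<in> carrier M \<Longrightarrow> f (x \<oplus>\<^bsub>M\<^esub> y) = f x \<oplus>\<^bsub>M\<^esub> f y"
  by (rule module_homsD(2)[OF endo_hom])

lemma endo_smult: "f \<in> carrier S \<Longrightarrow> r \<in> carrier R \<Longrightarrow> x \<in> carrier M \<Longrightarrow> f (r \<odot>\<^bsub>M\<^esub> x) = r \<odot>\<^bsub>M\<^esub> f x"
  by (rule module_homsD(3)[OF endo_hom])

lemma endo_zero: "f \<in> carrier S \<Longrightarrow> f \<zero>\<^bsub>M\<^esub> = \<zero>\<^bsub>M\<^esub>"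
  by (rule module_homs_zero[OF endo_hom left_module_axioms left_module_axioms])

lemma M_minus_zero: "\<ominus>\<^bsub>M\<^esub> \<zero>\<^bsub>M\<^esub> = \<zero>\<^bsub>M\<^esub>"
  by (rule M.minus_equality) auto

lemma smult_r_minus: "r \<in> carrier R \<Longrightarrow> x \<in> carrier M \<Longrightarrow> r \<odot>\<^bsub>M\<^esub> (\<ominus>\<^bsub>M\<^esub> x) = \<ominus>\<^bsub>M\<^esub> (r \<odot>\<^bsub>M\<^esub> x)"
  using smult_assoc1[of r "\<ominus> \<one>" x] smult_assoc1[of "\<ominus> \<one>" r x]
  by (simp add: smult_minus_one l_minus r_minus)

lemma endo_minus: "f \<in> carrier S \<Longrightarrow> x \<in> carrier M \<Longrightarrow> f (\<ominus>\<^bsub>M\<^esub> x) = \<ominus>\<^bsub>M\<^esub> f x"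
  using endo_smult[of f "\<ominus> \<one>" x] endo_closed[of f x] by (simp add: smult_minus_one)

lemmas endoD = endo_closed endo_add endo_smult endo_zero endo_minus

lemma endo_eqI: "f \<in> carrier S \<Longrightarrow> g \<in> carrier S \<Longrightarrow> (\<And>x. x \<in> carrier M \<Longrightarrow> f x = g x) \<Longrightarrow> f = g"
  by (auto simp: endo_ring_def intro: extensionalityI)

lemma restrict_endo: "f \<in> module_homs R M M \<Longrightarrow> restrict f (carrier M) \<in> carrier S"
  by (auto simp: endo_ring_def module_homs_def)

lemma endo_ring_apply [simp]:
  assumes "x \<in> carrier M"
  shows "(f \<otimes>\<^bsub>S\<^esub> g) x = g (f x)" "\<one>\<^bsub>S\<^esub> x = x" "\<zero>\<^bsub>S\<^esub> x = \<zero>\<^bsub>M\<^esub>" "(f \<oplus>\<^bsub>S\<^esub> g) x = f x \<oplus>\<^bsub>M\<^esub> g x"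
  using assms by (simp_all add: endo_ring_def compose_def)

lemma endo_ring_ring: "ring S"
proof -
  have add: "f \<oplus>\<^bsub>S\<^esub> g \<in> carrier S" if "f \<in> carrier S" "g \<in> carrier S" for f g
  proof -
    have "(\<lambda>x. f x \<oplus>\<^bsub>M\<^esub> g x) \<in> module_homs R M M"
      unfolding module_homs_def
      by (auto simp: endoD[OF that(1)] endoD[OF that(2)] smult_r_distr M.a_ac)
    from restrict_endo[OF this] show ?thesis by (simp add: endo_ring_def)
  qed
  have mult: "f \<otimes>\<^bsub>S\<^esub> g \<in> carrier S" if "f \<in> carrier S" "g \<in> carrier S" for f g
  proof -
    have "(\<lambda>x. g (f x)) \<in> module_homs R M M"
      unfolding module_homs_def by (auto simp: endoD[OF that(1)] endoD[OF that(2)])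
    from restrict_endo[OF this] show ?thesis by (simp add: endo_ring_def compose_def)
  qed
  have "(\<lambda>x. x) \<in> module_homs R M M" "(\<lambda>x. \<zero>\<^bsub>M\<^esub>) \<in> module_homs R M M"
    unfolding module_homs_def by (auto simp: smult_r_null)
  from this[THEN restrict_endo] have zo: "\<one>\<^bsub>S\<^esub> \<in> carrier S" "\<zero>\<^bsub>S\<^esub> \<in> carrier S"
    by (simp_all add: endo_ring_def)
  have inv: "\<exists>g\<in>carrier S. g \<oplus>\<^bsub>S\<^esub> f = \<zero>\<^bsub>S\<^esub>" if "f \<in> carrier S" for f
  proof -
    have "(\<lambda>x. \<ominus>\<^bsub>M\<^esub> f x) \<in> module_homs R M M"
      unfolding module_homs_def
      by (auto simp: endoD[OF that] M.minus_add M.a_ac smult_r_minus)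
    then have "restrict (\<lambda>x. \<ominus>\<^bsub>M\<^esub> f x) (carrier M) \<in> carrier S" by (rule restrict_endo)
    moreover from this have "restrict (\<lambda>x. \<ominus>\<^bsub>M\<^esub> f x) (carrier M) \<oplus>\<^bsub>S\<^esub> f = \<zero>\<^bsub>S\<^esub>"
      using that zo add by (intro endo_eqI) (auto simp: endoD[OF that] M.l_neg)
    ultimately show ?thesis by blast
  qed
  note closed = add mult zo
  show ?thesis
  proof (rule ringI)
    show "abelian_group S"
    proof (rule abelian_groupI)
      fix f g h assume *: "f \<in> carrier S" "g \<in> carrier S" "h \<in> carrier S"
      then show "f \<oplus>\<^bsub>S\<^esub> g \<oplus>\<^bsub>S\<^esub> h = f \<oplus>\<^bsub>S\<^esub> (g \<oplus>\<^bsub>S\<^esub> h)"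
        using closed by (intro endo_eqI) (auto simp: M.a_assoc *[THEN endo_closed])
    next
      fix f g assume *: "f \<in> carrier S" "g \<in> carrier S"
      then show "f \<oplus>\<^bsub>S\<^esub> g = g \<oplus>\<^bsub>S\<^esub> f" using closed by (intro endo_eqI) (auto simp: M.a_comm *[THEN endo_closed])
    next
      fix f assume *: "f \<in> carrier S"
      then show "\<zero>\<^bsub>S\<^esub> \<oplus>\<^bsub>S\<^esub> f = f" using closed by (intro endo_eqI) (auto simp: *[THEN endo_closed])
    qed (use closed inv in auto)
    show "monoid S"
    proof (rule monoidI)
      fix f g h assume *: "f \<in> carrier S" "g \<in> carrier S" "h \<in> carrier S"
      then show "f \<otimes>\<^bsub>S\<^esub> g \<otimes>\<^bsub>S\<^esub> h = f \<otimes>\<^bsub>S\<^esub> (g \<otimes>\<^bsub>S\<^esub> h)"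
        using closed by (intro endo_eqI) (auto simp: *[THEN endo_closed])
    next
      fix f assume *: "f \<in> carrier S"
      then show "\<one>\<^bsub>S\<^esub> \<otimes>\<^bsub>S\<^esub> f = f" "f \<otimes>\<^bsub>S\<^esub> \<one>\<^bsub>S\<^esub> = f" using closed by (auto intro: endo_eqI simp: *[THEN endo_closed])
    qed (use closed in auto)
  next
    fix f g h assume *: "f \<in> carrier S" "g \<in> carrier S" "h \<in> carrier S"
    then show "(f \<oplus>\<^bsub>S\<^esub> g) \<otimes>\<^bsub>S\<^esub> h = f \<otimes>\<^bsub>S\<^esub> h \<oplus>\<^bsub>S\<^esub> g \<otimes>\<^bsub>S\<^esub> h"
      using closed by (intro endo_eqI) (auto simp: endo_add[OF *(3)] *[THEN endo_closed])
    show "h \<otimes>\<^bsub>S\<^esub> (f \<oplus>\<^bsub>S\<^esub> g) = h \<otimes>\<^bsub>S\<^esub> f \<oplus>\<^bsub>S\<^esub> h \<otimes>\<^bsub>S\<^esub> g"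
      using * closed by (intro endo_eqI) (auto simp: *[THEN endo_closed])
  qed
qed

sublocale S: ring S by (rule endo_ring_ring)

lemma endo_a_inv_apply:
  assumes f: "f \<in> carrier S" and x: "x \<in> carrier M"
  shows "(\<ominus>\<^bsub>S\<^esub> f) x = \<ominus>\<^bsub>M\<^esub> f x"
proof -
  have "(\<ominus>\<^bsub>S\<^esub> f \<oplus>\<^bsub>S\<^esub> f) x = \<zero>\<^bsub>M\<^esub>" using f x by (simp add: S.l_neg)
  then show ?thesis
    using f x endo_closed[OF f x] endo_closed[OF S.a_inv_closed[OF f] x] M.minus_equality[of "(\<ominus>\<^bsub>S\<^esub> f) x" "f x"] by simp
qed

lemma endo_minus_apply:
  assumes "f \<in> carrier S" "g \<in> carrier S" "x \<in> carrier M"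
  shows "(f \<ominus>\<^bsub>S\<^esub> g) x = f x \<ominus>\<^bsub>M\<^esub> g x"
  using assms by (simp add: a_minus_def endo_a_inv_apply)

text \<open>Essentiality of the kernel in elementwise form: it is enough to test cyclic
  submodules.\<close>

definition ess_ker
  where "ess_ker = {f \<in> carrier S. \<forall>x\<in>carrier M. x \<noteq> \<zero>\<^bsub>M\<^esub> \<longrightarrow>
    (\<exists>r\<in>carrier R. r \<odot>\<^bsub>M\<^esub> x \<noteq> \<zero>\<^bsub>M\<^esub> \<and> f (r \<odot>\<^bsub>M\<^esub> x) = \<zero>\<^bsub>M\<^esub>)}"

lemma ess_kerD:
  "f \<in> ess_ker \<Longrightarrow> f \<in> carrier S"
  "f \<in> ess_ker \<Longrightarrow> x \<in> carrier M \<Longrightarrow> x \<noteq> \<zero>\<^bsub>M\<^esub> \<Longrightarrow>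
    \<exists>r\<in>carrier R. r \<odot>\<^bsub>M\<^esub> x \<noteq> \<zero>\<^bsub>M\<^esub> \<and> f (r \<odot>\<^bsub>M\<^esub> x) = \<zero>\<^bsub>M\<^esub>"
  by (auto simp: ess_ker_def)

text \<open>For a sum, a nonzero multiple in the first kernel is multiplied further into the second.
  For \<open>g\<close> followed by \<open>f\<close>, either \<open>g x = 0\<close> already, or a
  multiple of \<open>g x\<close> is found in the kernel of \<open>f\<close>.\<close>

lemma ess_ker_ideal: "ideal ess_ker S"
proof -
  have "f \<oplus>\<^bsub>S\<^esub> g \<in> ess_ker" if fg: "f \<in> ess_ker" "g \<in> ess_ker" for f g
  proof -
    have "\<exists>r\<in>carrier R. r \<odot>\<^bsub>M\<^esub> x \<noteq> \<zero>\<^bsub>M\<^esub> \<and> (f \<oplus>\<^bsub>S\<^esub> g) (r \<odot>\<^bsub>M\<^esub> x) = \<zero>\<^bsub>M\<^esub>"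
      if x: "x \<in> carrier M" "x \<noteq> \<zero>\<^bsub>M\<^esub>" for x
    proof -
      obtain r where r: "r \<in> carrier R" "r \<odot>\<^bsub>M\<^esub> x \<noteq> \<zero>\<^bsub>M\<^esub>" "f (r \<odot>\<^bsub>M\<^esub> x) = \<zero>\<^bsub>M\<^esub>"
        using ess_kerD(2)[OF fg(1) x] by blast
      obtain s where s: "s \<in> carrier R" "s \<odot>\<^bsub>M\<^esub> (r \<odot>\<^bsub>M\<^esub> x) \<noteq> \<zero>\<^bsub>M\<^esub>" "g (s \<odot>\<^bsub>M\<^esub> (r \<odot>\<^bsub>M\<^esub> x)) = \<zero>\<^bsub>M\<^esub>"
        using ess_kerD(2)[OF fg(2) _ r(2)] r(1) x(1) by blast
      have "f (s \<odot>\<^bsub>M\<^esub> (r \<odot>\<^bsub>M\<^esub> x)) = \<zero>\<^bsub>M\<^esub>"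
        using r s(1) x endo_smult[OF ess_kerD(1)[OF fg(1)] s(1)] by (simp add: smult_r_null)
      then show ?thesis using r(1) s x(1)
        by (intro bexI[of _ "s \<otimes> r"]) (auto simp: smult_assoc1)
    qed
    then show ?thesis using ess_kerD(1)[OF fg(1)] ess_kerD(1)[OF fg(2)] unfolding ess_ker_def by simp
  qed
  moreover have "f \<otimes>\<^bsub>S\<^esub> g \<in> ess_ker" if f: "f \<in> ess_ker" and g: "g \<in> carrier S" for f g
  proof -
    have "\<exists>r\<in>carrier R. r \<odot>\<^bsub>M\<^esub> x \<noteq> \<zero>\<^bsub>M\<^esub> \<and> (f \<otimes>\<^bsub>S\<^esub> g) (r \<odot>\<^bsub>M\<^esub> x) = \<zero>\<^bsub>M\<^esub>"
      if x: "x \<in> carrier M" "x \<noteq> \<zero>\<^bsub>M\<^esub>" for x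
      using ess_kerD(2)[OF f x] x(1) endo_zero[OF g] by (auto simp del: S.m_closed)
    then show ?thesis using ess_kerD(1)[OF f] g unfolding ess_ker_def by simp
  qed
  moreover have "g \<otimes>\<^bsub>S\<^esub> f \<in> ess_ker" if f: "f \<in> ess_ker" and g: "g \<in> carrier S" for f g
  proof -
    have "\<exists>r\<in>carrier R. r \<odot>\<^bsub>M\<^esub> x \<noteq> \<zero>\<^bsub>M\<^esub> \<and> (g \<otimes>\<^bsub>S\<^esub> f) (r \<odot>\<^bsub>M\<^esub> x) = \<zero>\<^bsub>M\<^esub>"
      if x: "x \<in> carrier M" "x \<noteq> \<zero>\<^bsub>M\<^esub>" for x
    proof (cases "g x = \<zero>\<^bsub>M\<^esub>")
      case True
      then show ?thesis using x endo_zero[OF ess_kerD(1)[OF f]] by (intro bexI[of _ \<one>]) auto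
    next
      case False
      obtain r where r: "r \<in> carrier R" "r \<odot>\<^bsub>M\<^esub> g x \<noteq> \<zero>\<^bsub>M\<^esub>" "f (r \<odot>\<^bsub>M\<^esub> g x) = \<zero>\<^bsub>M\<^esub>"
        using ess_kerD(2)[OF f _ False] endo_closed[OF g x(1)] by auto
      moreover have "r \<odot>\<^bsub>M\<^esub> x \<noteq> \<zero>\<^bsub>M\<^esub>"
        using r(2) endo_zero[OF g] endo_smult[OF g r(1) x(1)] by auto
      ultimately show ?thesis using g x endo_smult[OF g r(1) x(1)] by auto
    qed
    then show ?thesis using ess_kerD(1)[OF f] g unfolding ess_ker_def by simp
  qed
  moreover have "\<zero>\<^bsub>S\<^esub> \<in> ess_ker" unfolding ess_ker_def by (auto intro!: bexI[of _ \<one>])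
  moreover have "ess_ker \<subseteq> carrier S" using ess_kerD(1) by auto
  ultimately show ?thesis
    unfolding S.ideal_iff left_ideal_def right_ideal_def by auto
qed

sublocale N: ideal ess_ker S by (rule ess_ker_ideal)

text \<open>A nonzero kernel of \<open>f\<close> would meet the essential kernel of \<open>g\<close>
  nontrivially.\<close>

lemma endo_kernel_zero:
  assumes f: "f \<in> carrier S" and g: "g \<in> ess_ker"
    and k: "\<And>x. x \<in> carrier M \<Longrightarrow> f x = \<zero>\<^bsub>M\<^esub> \<Longrightarrow> g x = \<zero>\<^bsub>M\<^esub> \<Longrightarrow> x = \<zero>\<^bsub>M\<^esub>"
  shows "inj_on f (carrier M)"
proof (rule module_homs_inj_onI[OF left_module_axioms left_module_axioms endo_hom[OF f]])
  fix x assume x: "x \<in> carrier M" "f x = \<zero>\<^bsub>M\<^esub>"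
  show "x = \<zero>\<^bsub>M\<^esub>"
  proof (rule ccontr)
    assume "x \<noteq> \<zero>\<^bsub>M\<^esub>"
    from ess_kerD(2)[OF g x(1) this] obtain r where
      r: "r \<in> carrier R" "r \<odot>\<^bsub>M\<^esub> x \<noteq> \<zero>\<^bsub>M\<^esub>" "g (r \<odot>\<^bsub>M\<^esub> x) = \<zero>\<^bsub>M\<^esub>" by blast
    have "f (r \<odot>\<^bsub>M\<^esub> x) = \<zero>\<^bsub>M\<^esub>" using r x by (simp add: endo_smult[OF f] smult_r_null)
    then show False using k r x by auto
  qed
qed

end

section \<open>Extension of homomorphisms, regularity and lifting of units for an injective
  module\<close>

locale injective_left_module = left_module R E
  for R :: "('a, 'm) ring_scheme" (structure) and E :: "('a, 'e) module" +
  assumes injective: "injective_module TYPE('a) R E"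
begin

lemma extend_hom:
  assumes X: "submodule X R E" and f: "f \<in> module_homs R (E\<lparr>carrier := X\<rparr>) E"
  shows "\<exists>g\<in>carrier S. \<forall>x\<in>X. g x = f x"
proof -
  have Xc: "X \<subseteq> carrier E" using X unfolding submodule_iff by auto
  then have "(\<lambda>x. x) \<in> module_homs R (E\<lparr>carrier := X\<rparr>) E" unfolding module_homs_def by auto
  from injective_moduleD[OF injective_module_any_type[OF injective] submodule_left_module[OF X]
      left_module_axioms this _ f]
  obtain g where "g \<in> module_homs R E E" "\<forall>x\<in>X. g x = f x" by auto
  then show ?thesis using Xc by (intro bexI[OF _ restrict_endo]) auto
qed

text \<open>By \<open>ann\<close> the map \<open>k\<close> factors through the submodule
  \<open>L q\<close>, and injectivity extends it from there to \<open>E\<close>. A general left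
  ideal \<open>L\<close> in place of \<open>R\<close> is needed for annihilators of finite lists and
  for Baer's test on \<open>R\<close>.\<close>

lemma extend_hom_cyclic:
  assumes L: "left_ideal R L" and q: "q \<in> carrier E" and k: "\<And>x. x \<in> L \<Longrightarrow> k x \<in> carrier E"
    and k_add: "\<And>x y. x \<in> L \<Longrightarrow> y \<in> L \<Longrightarrow> k (x \<oplus> y) = k x \<oplus>\<^bsub>E\<^esub> k y"
    and k_smult: "\<And>r x. r \<in> carrier R \<Longrightarrow> x \<in> L \<Longrightarrow> k (r \<otimes> x) = r \<odot>\<^bsub>E\<^esub> k x"
    and ann: "\<And>x. x \<in> L \<Longrightarrow> x \<odot>\<^bsub>E\<^esub> q = \<zero>\<^bsub>E\<^esub> \<Longrightarrow> k x = \<zero>\<^bsub>E\<^esub>"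
  shows "\<exists>g\<in>carrier S. \<forall>x\<in>L. g (x \<odot>\<^bsub>E\<^esub> q) = k x"
proof -
  have L': "\<And>x. x \<in> L \<Longrightarrow> x \<in> carrier R" "\<zero> \<in> L" "\<And>x y. x \<in> L \<Longrightarrow> y \<in> L \<Longrightarrow> x \<oplus> y \<in> L"
    "\<And>r x. r \<in> carrier R \<Longrightarrow> x \<in> L \<Longrightarrow> r \<otimes> x \<in> L"
    using L unfolding left_ideal_def by auto
  have eq: "k x = k y" if "x \<in> L" "y \<in> L" "x \<odot>\<^bsub>E\<^esub> q = y \<odot>\<^bsub>E\<^esub> q" for x y
  proof -
    have ym: "\<ominus> \<one> \<otimes> y \<in> L" using L'(4) that(2) by simp
    have "(x \<oplus> \<ominus> \<one> \<otimes> y) \<odot>\<^bsub>E\<^esub> q = x \<odot>\<^bsub>E\<^esub> q \<oplus>\<^bsub>E\<^esub> \<ominus>\<^bsub>E\<^esub> (y \<odot>\<^bsub>E\<^esub> q)"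
      using q L'(1)[OF that(1)] L'(1)[OF that(2)] smult_minus_one[of "y \<odot>\<^bsub>E\<^esub> q"]
        smult_assoc1[of "\<ominus> \<one>" y q] by (simp add: smult_l_distr l_minus)
    then have "(x \<oplus> \<ominus> \<one> \<otimes> y) \<odot>\<^bsub>E\<^esub> q = \<zero>\<^bsub>E\<^esub>" using that q L'(1) by (simp add: M.r_neg)
    then have "k (x \<oplus> \<ominus> \<one> \<otimes> y) = \<zero>\<^bsub>E\<^esub>" using ann[OF L'(3)[OF that(1) ym]] by simp
    then have "k x \<oplus>\<^bsub>E\<^esub> \<ominus>\<^bsub>E\<^esub> k y = \<zero>\<^bsub>E\<^esub>"
      using k_add[OF that(1) ym] k_smult[of "\<ominus> \<one>" y] that(2) k smult_minus_one by simp
    then show ?thesis using k that(1,2) M.minus_equality[of "k x" "\<ominus>\<^bsub>E\<^esub> k y"] by simp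
  qed
  define X where "X = (\<lambda>x. x \<odot>\<^bsub>E\<^esub> q) ` L"
  define f where "f z = k (SOME x. x \<in> L \<and> z = x \<odot>\<^bsub>E\<^esub> q)" for z
  have f: "f (x \<odot>\<^bsub>E\<^esub> q) = k x" if "x \<in> L" for x
  proof -
    have "\<exists>y. y \<in> L \<and> x \<odot>\<^bsub>E\<^esub> q = y \<odot>\<^bsub>E\<^esub> q" using that by blast
    note w = someI_ex[OF this]
    show ?thesis unfolding f_def by (rule eq[OF that conjunct1[OF w] conjunct2[OF w], symmetric])
  qed
  have add: "x \<odot>\<^bsub>E\<^esub> q \<oplus>\<^bsub>E\<^esub> y \<odot>\<^bsub>E\<^esub> q = (x \<oplus> y) \<odot>\<^bsub>E\<^esub> q" if "x \<in> L" "y \<in> L" for x y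
    using that L'(1) q by (simp add: smult_l_distr)
  have sm: "r \<odot>\<^bsub>E\<^esub> (x \<odot>\<^bsub>E\<^esub> q) = (r \<otimes> x) \<odot>\<^bsub>E\<^esub> q" if "x \<in> L" "r \<in> carrier R" for x r
    using that L'(1) q by (simp add: smult_assoc1)
  have "submodule X R E"
    unfolding submodule_iff
  proof (intro conjI ballI)
    show "X \<subseteq> carrier E" using L'(1) q by (auto simp: X_def)
    show "\<zero>\<^bsub>E\<^esub> \<in> X" unfolding X_def using smult_l_null[OF q] L'(2) by force
  qed (use L'(3,4) add sm in \<open>auto simp: X_def\<close>)
  moreover have "f \<in> module_homs R (E\<lparr>carrier := X\<rparr>) E"
    unfolding module_homs_def X_def
    using L'(3,4) k by (auto simp: f add sm k_add k_smult)
  ultimately obtain g where "g \<in> carrier S" "\<forall>z\<in>X. g z = f z" using extend_hom by blast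
  then show ?thesis using f by (auto simp: X_def)
qed

lemma extend_cyclic:
  assumes L: "left_ideal R L" and q: "q \<in> carrier E" and m: "m \<in> carrier E"
    and ann: "\<And>x. x \<in> L \<Longrightarrow> x \<odot>\<^bsub>E\<^esub> q = \<zero>\<^bsub>E\<^esub> \<Longrightarrow> x \<odot>\<^bsub>E\<^esub> m = \<zero>\<^bsub>E\<^esub>"
  shows "\<exists>g\<in>carrier S. \<forall>x\<in>L. g (x \<odot>\<^bsub>E\<^esub> q) = x \<odot>\<^bsub>E\<^esub> m"
proof -
  have "x \<in> carrier R" if "x \<in> L" for x using L that unfolding left_ideal_def by auto
  then show ?thesis
    using m ann by (intro extend_hom_cyclic[OF L q]) (simp_all add: smult_l_distr smult_assoc1)
qed

text \<open>The map \<open>1 - f\<close> is the identity on the essential kernel of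
  \<open>f\<close>, hence injective, and injectivity of \<open>E\<close> gives a retraction
  \<open>h\<close>. The equation \<open>h = 1 + f h\<close> in \<open>S\<close> shows that
  \<open>h\<close> is again \<open>1\<close> minus an endomorphism with essential kernel; so
  \<open>h\<close> is injective too, and an injective retraction is a two-sided inverse.\<close>

lemma ess_ker_bij:
  assumes f: "f \<in> ess_ker"
  shows "bij_betw (\<one>\<^bsub>S\<^esub> \<ominus>\<^bsub>S\<^esub> f) (carrier E) (carrier E)"
proof -
  have inj: "inj_on (\<one>\<^bsub>S\<^esub> \<ominus>\<^bsub>S\<^esub> h) (carrier E)" if h: "h \<in> ess_ker" for h
    by (rule endo_kernel_zero[OF _ h])
       (use ess_kerD(1)[OF h] in \<open>simp_all add: endo_minus_apply M.minus_eq M_minus_zero\<close>)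
  define v where "v = \<one>\<^bsub>S\<^esub> \<ominus>\<^bsub>S\<^esub> f"
  have v: "v \<in> carrier S" using ess_kerD(1)[OF f] by (simp add: v_def)
  have iv: "inj_on v (carrier E)" unfolding v_def by (rule inj[OF f])
  obtain g where g: "g \<in> module_homs R E E" "\<forall>x\<in>carrier E. g (v x) = x"
    using injective_moduleD[OF injective_module_any_type[OF injective] left_module_axioms
        left_module_axioms endo_hom[OF v] iv, of "\<lambda>x. x"] by (auto simp: module_homs_def)
  define h where "h = restrict g (carrier E)"
  have h: "h \<in> carrier S" unfolding h_def by (rule restrict_endo[OF g(1)])
  have hv: "v \<otimes>\<^bsub>S\<^esub> h = \<one>\<^bsub>S\<^esub>"
    by (rule endo_eqI) (use v h g(2) endo_closed[OF v] in \<open>auto simp: h_def\<close>)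
  have fc: "f \<in> carrier S" by (rule ess_kerD(1)[OF f])
  have "h \<ominus>\<^bsub>S\<^esub> f \<otimes>\<^bsub>S\<^esub> h = \<one>\<^bsub>S\<^esub>"
    using hv h fc unfolding v_def by (simp add: S.expand_simps)
  have hh: "h = \<one>\<^bsub>S\<^esub> \<ominus>\<^bsub>S\<^esub> (\<ominus>\<^bsub>S\<^esub> (f \<otimes>\<^bsub>S\<^esub> h))"
  proof (rule endo_eqI)
    fix x assume x: "x \<in> carrier E"
    note c = endo_closed[OF h x] endo_closed[OF fc x] endo_closed[OF h endo_closed[OF fc x]]
    have "(h \<ominus>\<^bsub>S\<^esub> f \<otimes>\<^bsub>S\<^esub> h) x = x" using \<open>h \<ominus>\<^bsub>S\<^esub> f \<otimes>\<^bsub>S\<^esub> h = \<one>\<^bsub>S\<^esub>\<close> x by simp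
    then have *: "h x \<ominus>\<^bsub>E\<^esub> h (f x) = x" using h fc x by (simp add: endo_minus_apply)
    have "(h x \<ominus>\<^bsub>E\<^esub> h (f x)) \<oplus>\<^bsub>E\<^esub> h (f x) = h x"
      using c by (simp add: M.minus_eq M.a_assoc M.l_neg)
    then have "x \<oplus>\<^bsub>E\<^esub> h (f x) = h x" unfolding * .
    then show "h x = (\<one>\<^bsub>S\<^esub> \<ominus>\<^bsub>S\<^esub> (\<ominus>\<^bsub>S\<^esub> (f \<otimes>\<^bsub>S\<^esub> h))) x"
      using h fc x c by (simp add: S.minus_eq)
  qed (use h fc in auto)
  have "\<ominus>\<^bsub>S\<^esub> (f \<otimes>\<^bsub>S\<^esub> h) \<in> ess_ker" using N.I_r_closed[OF f h] by simp
  from inj[OF this] have ih: "inj_on h (carrier E)" unfolding hh[symmetric] .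
  have "v (h x) = x" if x: "x \<in> carrier E" for x
    by (rule inj_onD[OF ih])
       (use x endo_closed[OF v] endo_closed[OF h] g(2) in \<open>simp_all add: h_def\<close>)
  then have "y \<in> v ` carrier E" if "y \<in> carrier E" for y
    by (rule image_eqI[OF sym]) (use that endo_closed[OF h] in auto)
  then have "v ` carrier E = carrier E" using endo_closed[OF v] by blast
  then show ?thesis using iv unfolding v_def[symmetric] bij_betw_def by blast
qed

text \<open>Let \<open>C\<close> be maximal among the submodules that meet the kernel of
  \<open>f\<close> trivially. On \<open>C\<close> the map \<open>f\<close> can be inverted, and
  \<open>g\<close> extends the inverse from \<open>f C\<close> to \<open>E\<close>. Then
  \<open>f g f - f\<close> vanishes on \<open>C\<close> plus the kernel of \<open>f\<close>, which
  is essential by maximality of \<open>C\<close>.\<close>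

lemma regular_mod_ess_ker:
  assumes f: "f \<in> carrier S"
  shows "\<exists>g\<in>carrier S. f \<otimes>\<^bsub>S\<^esub> g \<otimes>\<^bsub>S\<^esub> f \<ominus>\<^bsub>S\<^esub> f \<in> ess_ker"
proof -
  define P where "P C \<longleftrightarrow> submodule C R E \<and> (\<forall>x\<in>C. f x = \<zero>\<^bsub>E\<^esub> \<longrightarrow> x = \<zero>\<^bsub>E\<^esub>)" for C
  have "\<exists>C\<in>Collect P. \<forall>D\<in>Collect P. C \<subseteq> D \<longrightarrow> D = C"
  proof (rule subset_Zorn_nonempty)
    have "submodule {\<zero>\<^bsub>E\<^esub>} R E" unfolding submodule_iff by (auto simp: smult_r_null)
    then show "Collect P \<noteq> {}" unfolding P_def by blast
    fix \<C> assume ne: "\<C> \<noteq> {}" and ch: "subset.chain (Collect P) \<C>"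
    have sub: "\<And>C. C \<in> \<C> \<Longrightarrow> P C" using ch unfolding subset.chain_def by auto
    have tot: "\<exists>C\<in>\<C>. x \<in> C \<and> y \<in> C" if "x \<in> \<Union>\<C>" "y \<in> \<Union>\<C>" for x y
      using that ch unfolding subset.chain_def by blast
    have "submodule (\<Union>\<C>) R E"
      unfolding submodule_iff
    proof (intro conjI ballI)
      show "\<Union>\<C> \<subseteq> carrier E" "\<zero>\<^bsub>E\<^esub> \<in> \<Union>\<C>" using sub ne unfolding P_def submodule_iff by blast+
      show "x \<oplus>\<^bsub>E\<^esub> y \<in> \<Union>\<C>" if xy: "x \<in> \<Union>\<C>" "y \<in> \<Union>\<C>" for x y
        using tot[OF xy] sub unfolding P_def submodule_iff by blast
      show "r \<odot>\<^bsub>E\<^esub> x \<in> \<Union>\<C>" if "r \<in> carrier R" "x \<in> \<Union>\<C>" for r x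
        using that sub unfolding P_def submodule_iff by blast
    qed
    then show "\<Union>\<C> \<in> Collect P" using sub unfolding P_def by auto
  qed
  then obtain C where PC: "P C" and max: "\<And>D. P D \<Longrightarrow> C \<subseteq> D \<Longrightarrow> D = C" by auto
  have C: "submodule C R E" and Ck: "\<And>x. x \<in> C \<Longrightarrow> f x = \<zero>\<^bsub>E\<^esub> \<Longrightarrow> x = \<zero>\<^bsub>E\<^esub>"
    using PC unfolding P_def by auto
  have C': "\<And>x. x \<in> C \<Longrightarrow> x \<in> carrier E" "\<zero>\<^bsub>E\<^esub> \<in> C" "\<And>x y. x \<in> C \<Longrightarrow> y \<in> C \<Longrightarrow> x \<oplus>\<^bsub>E\<^esub> y \<in> C"
    "\<And>r x. r \<in> carrier R \<Longrightarrow> x \<in> C \<Longrightarrow> r \<odot>\<^bsub>E\<^esub> x \<in> C"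
    using C unfolding submodule_iff by auto
  have CN: "\<ominus>\<^bsub>E\<^esub> x \<in> C" if "x \<in> C" for x using C'(4)[of "\<ominus> \<one>" x] C'(1) that by (simp add: smult_minus_one)
  \<comment> \<open>A multiple of \<open>x\<close> has the same image as some \<open>c\<close> in
    \<open>C\<close> exactly if it lies in \<open>C\<close> plus the kernel. If no nonzero multiple
    did, \<open>C + R x\<close> would still meet the kernel trivially.\<close>
  have ess: "\<exists>r\<in>carrier R. r \<odot>\<^bsub>E\<^esub> x \<noteq> \<zero>\<^bsub>E\<^esub> \<and> (\<exists>c\<in>C. f (r \<odot>\<^bsub>E\<^esub> x) = f c)"
    if x: "x \<in> carrier E" "x \<noteq> \<zero>\<^bsub>E\<^esub>" for x
  proof (rule ccontr)
    assume no: "\<not> ?thesis"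
    let ?D = "{c \<oplus>\<^bsub>E\<^esub> r \<odot>\<^bsub>E\<^esub> x |c r. c \<in> C \<and> r \<in> carrier R}"
    have "submodule ?D R E"
      unfolding submodule_iff
    proof (intro conjI ballI)
      show "?D \<subseteq> carrier E" using C'(1) x by auto
      show "\<zero>\<^bsub>E\<^esub> \<in> ?D" using C'(2) smult_l_null[OF x(1)] by force
      show "y \<oplus>\<^bsub>E\<^esub> z \<in> ?D" if "y \<in> ?D" "z \<in> ?D" for y z
      proof -
        from that obtain c r d s where *: "c \<in> C" "r \<in> carrier R" "d \<in> C" "s \<in> carrier R"
          "y = c \<oplus>\<^bsub>E\<^esub> r \<odot>\<^bsub>E\<^esub> x" "z = d \<oplus>\<^bsub>E\<^esub> s \<odot>\<^bsub>E\<^esub> x" by blast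
        have "y \<oplus>\<^bsub>E\<^esub> z = (c \<oplus>\<^bsub>E\<^esub> d) \<oplus>\<^bsub>E\<^esub> (r \<oplus> s) \<odot>\<^bsub>E\<^esub> x"
          using * C'(1) x by (simp add: smult_l_distr M.a_ac)
        then show ?thesis using C'(3)[OF *(1,3)] *(2,4) by blast
      qed
      show "s \<odot>\<^bsub>E\<^esub> y \<in> ?D" if "s \<in> carrier R" "y \<in> ?D" for s y
      proof -
        from that obtain c r where *: "c \<in> C" "r \<in> carrier R" "y = c \<oplus>\<^bsub>E\<^esub> r \<odot>\<^bsub>E\<^esub> x" by blast
        have "s \<odot>\<^bsub>E\<^esub> y = s \<odot>\<^bsub>E\<^esub> c \<oplus>\<^bsub>E\<^esub> (s \<otimes> r) \<odot>\<^bsub>E\<^esub> x"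
          using * C'(1) x that(1) by (simp add: smult_r_distr smult_assoc1)
        then show ?thesis using C'(4)[OF that(1) *(1)] *(2) that(1) by blast
      qed
    qed
    moreover have "z = \<zero>\<^bsub>E\<^esub>" if "z \<in> ?D" "f z = \<zero>\<^bsub>E\<^esub>" for z
    proof -
      from that obtain c r where *: "c \<in> C" "r \<in> carrier R" "z = c \<oplus>\<^bsub>E\<^esub> r \<odot>\<^bsub>E\<^esub> x" by blast
      have "f c \<oplus>\<^bsub>E\<^esub> f (r \<odot>\<^bsub>E\<^esub> x) = \<zero>\<^bsub>E\<^esub>" using * that(2) C'(1) x by (simp add: endo_add[OF f])
      then have "f (r \<odot>\<^bsub>E\<^esub> x) = f (\<ominus>\<^bsub>E\<^esub> c)"
        using *(1,2) C'(1) x M.minus_equality[of "f (r \<odot>\<^bsub>E\<^esub> x)" "f c"]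
        by (simp add: endoD[OF f] M.a_comm)
      then have "r \<odot>\<^bsub>E\<^esub> x = \<zero>\<^bsub>E\<^esub>" using no *(2) CN[OF *(1)] by blast
      then show ?thesis using * that(2) C'(1) Ck by simp
    qed
    ultimately have "P ?D" unfolding P_def by blast
    moreover have "C \<subseteq> ?D"
    proof
      fix c assume c: "c \<in> C"
      have "c = c \<oplus>\<^bsub>E\<^esub> \<zero> \<odot>\<^bsub>E\<^esub> x" using C'(1)[OF c] smult_l_null[OF x(1)] by simp
      then show "c \<in> ?D" using c by blast
    qed
    ultimately have "?D = C" using max by blast
    moreover have "\<zero>\<^bsub>E\<^esub> \<oplus>\<^bsub>E\<^esub> \<one> \<odot>\<^bsub>E\<^esub> x \<in> ?D" using C'(2) by blast
    ultimately have "x \<in> C" using x by simp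
    then show False using no x by (auto dest!: bspec[of "carrier R" _ \<one>])
  qed
  define X where "X = f ` C"
  define h where "h z = (SOME c. c \<in> C \<and> z = f c)" for z
  have fi: "c = d" if "c \<in> C" "d \<in> C" "f c = f d" for c d
  proof -
    have "f (c \<oplus>\<^bsub>E\<^esub> \<ominus>\<^bsub>E\<^esub> d) = \<zero>\<^bsub>E\<^esub>" using that C'(1) by (simp add: endoD[OF f] M.r_neg)
    then have "c \<oplus>\<^bsub>E\<^esub> \<ominus>\<^bsub>E\<^esub> d = \<zero>\<^bsub>E\<^esub>" using Ck C'(3) CN that by blast
    then show ?thesis using that C'(1) M.minus_equality[of c "\<ominus>\<^bsub>E\<^esub> d"] by simp
  qed
  have h: "h (f c) = c" if "c \<in> C" for c
  proof -
    have "\<exists>d. d \<in> C \<and> f c = f d" using that by blast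
    note w = someI_ex[OF this]
    show ?thesis unfolding h_def by (rule fi[OF that conjunct1[OF w] conjunct2[OF w], symmetric])
  qed
  have add: "f c \<oplus>\<^bsub>E\<^esub> f d = f (c \<oplus>\<^bsub>E\<^esub> d)" if "c \<in> C" "d \<in> C" for c d
    using that C'(1) by (simp add: endo_add[OF f])
  have sm: "r \<odot>\<^bsub>E\<^esub> f c = f (r \<odot>\<^bsub>E\<^esub> c)" if "c \<in> C" "r \<in> carrier R" for c r
    using that C'(1) by (simp add: endo_smult[OF f])
  have "submodule X R E"
    unfolding submodule_iff X_def
  proof (intro conjI ballI)
    show "f ` C \<subseteq> carrier E" using C'(1) endo_closed[OF f] by auto
    show "\<zero>\<^bsub>E\<^esub> \<in> f ` C" using endo_zero[OF f] C'(2) by force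
  qed (use C'(3,4) add sm in auto)
  moreover have "h \<in> module_homs R (E\<lparr>carrier := X\<rparr>) E"
    unfolding module_homs_def X_def using C' by (auto simp: h add sm)
  ultimately obtain g where gX: "g \<in> carrier S" "\<forall>z\<in>X. g z = h z" using extend_hom by blast
  have g: "g \<in> carrier S" "\<And>c. c \<in> C \<Longrightarrow> g (f c) = c" using gX by (simp_all add: X_def h)
  have "f \<otimes>\<^bsub>S\<^esub> g \<otimes>\<^bsub>S\<^esub> f \<ominus>\<^bsub>S\<^esub> f \<in> ess_ker"
    unfolding ess_ker_def
  proof (intro CollectI conjI ballI impI)
    fix x assume x: "x \<in> carrier E" "x \<noteq> \<zero>\<^bsub>E\<^esub>"
    obtain r c where r: "r \<in> carrier R" "r \<odot>\<^bsub>E\<^esub> x \<noteq> \<zero>\<^bsub>E\<^esub>" "c \<in> C" "f (r \<odot>\<^bsub>E\<^esub> x) = f c"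
      using ess[OF x] by blast
    have "(f \<otimes>\<^bsub>S\<^esub> g \<otimes>\<^bsub>S\<^esub> f \<ominus>\<^bsub>S\<^esub> f) (r \<odot>\<^bsub>E\<^esub> x) = f (g (f (r \<odot>\<^bsub>E\<^esub> x))) \<ominus>\<^bsub>E\<^esub> f (r \<odot>\<^bsub>E\<^esub> x)"
      using x r(1) f g(1) by (simp add: endo_minus_apply)
    also have "\<dots> = \<zero>\<^bsub>E\<^esub>" unfolding r(4) g(2)[OF r(3)] using endo_closed[OF f C'(1)[OF r(3)]] by (simp add: M.minus_eq M.r_neg)
    finally show "\<exists>r\<in>carrier R. r \<odot>\<^bsub>E\<^esub> x \<noteq> \<zero>\<^bsub>E\<^esub> \<and> (f \<otimes>\<^bsub>S\<^esub> g \<otimes>\<^bsub>S\<^esub> f \<ominus>\<^bsub>S\<^esub> f) (r \<odot>\<^bsub>E\<^esub> x) = \<zero>\<^bsub>E\<^esub>"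
      using r by blast
  qed (use f g(1) in auto)
  then show ?thesis using g(1) by blast
qed

text \<open>Both products differ from \<open>1\<close> by an endomorphism with essential kernel and
  are therefore bijective; one of them makes \<open>f\<close> injective, the other
  surjective.\<close>

lemma unit_mod_ess_ker:
  assumes f: "f \<in> carrier S" and g: "g \<in> carrier S"
    and fg: "\<one>\<^bsub>S\<^esub> \<ominus>\<^bsub>S\<^esub> f \<otimes>\<^bsub>S\<^esub> g \<in> ess_ker" and gf: "\<one>\<^bsub>S\<^esub> \<ominus>\<^bsub>S\<^esub> g \<otimes>\<^bsub>S\<^esub> f \<in> ess_ker"
  shows "f \<in> module_auts R E"
proof -
  have 1: "bij_betw (f \<otimes>\<^bsub>S\<^esub> g) (carrier E) (carrier E)"
    using ess_ker_bij[OF fg] S.compl_compl[of "f \<otimes>\<^bsub>S\<^esub> g"] f g by simp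
  have 2: "bij_betw (g \<otimes>\<^bsub>S\<^esub> f) (carrier E) (carrier E)"
    using ess_ker_bij[OF gf] S.compl_compl[of "g \<otimes>\<^bsub>S\<^esub> f"] f g by simp
  have "inj_on f (carrier E)"
  proof (rule inj_onI)
    fix x y assume "x \<in> carrier E" "y \<in> carrier E" "f x = f y"
    then show "x = y" using inj_onD[OF bij_betw_imp_inj_on[OF 1], of x y] by simp
  qed
  moreover have "carrier E \<subseteq> f ` carrier E"
  proof
    fix y assume "y \<in> carrier E"
    then obtain x where "x \<in> carrier E" "(g \<otimes>\<^bsub>S\<^esub> f) x = y"
      using bij_betw_imp_surj_on[OF 2] by (metis imageE)
    then show "y \<in> f ` carrier E" using endo_closed[OF g] by auto
  qed
  ultimately show ?thesis
    unfolding module_auts_def bij_betw_def using endo_hom[OF f] endo_closed[OF f] by auto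
qed

end

section \<open>Chain conditions and powers of ideals\<close>

definition left_acc :: "('a, 'm) ring_scheme \<Rightarrow> bool"
  where "left_acc R \<longleftrightarrow> (\<forall>C :: nat \<Rightarrow> 'a set. (\<forall>n. left_ideal R (C n) \<and> C n \<subseteq> C (Suc n)) \<longrightarrow>
    (\<exists>k. \<forall>n\<ge>k. C n = C k))"

definition right_acc :: "('a, 'm) ring_scheme \<Rightarrow> bool"
  where "right_acc R \<longleftrightarrow> (\<forall>C :: nat \<Rightarrow> 'a set. (\<forall>n. right_ideal R (C n) \<and> C n \<subseteq> C (Suc n)) \<longrightarrow>
    (\<exists>k. \<forall>n\<ge>k. C n = C k))"

definition lann :: "('a, 'm) ring_scheme \<Rightarrow> 'a set \<Rightarrow> 'a set"
  where "lann R X = {r \<in> carrier R. \<forall>x\<in>X. r \<otimes>\<^bsub>R\<^esub> x = \<zero>\<^bsub>R\<^esub>}"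

definition rann :: "('a, 'm) ring_scheme \<Rightarrow> 'a set \<Rightarrow> 'a set"
  where "rann R X = {r \<in> carrier R. \<forall>x\<in>X. x \<otimes>\<^bsub>R\<^esub> r = \<zero>\<^bsub>R\<^esub>}"

primrec ideal_pow :: "('a, 'm) ring_scheme \<Rightarrow> 'a set \<Rightarrow> nat \<Rightarrow> 'a set"
  where "ideal_pow R I 0 = carrier R"
  | "ideal_pow R I (Suc n) = ideal_prod R I (ideal_pow R I n)"

text \<open>An arbitrary family of sets is allowed so that complements of left ideals are covered as
  well; see \<open>left_dcc_minimal\<close>.\<close>

lemma acc_maximal:
  fixes F :: "'a set set"
  assumes acc: "\<And>C :: nat \<Rightarrow> 'a set. (\<And>n. C n \<in> F \<and> C n \<subseteq> C (Suc n)) \<Longrightarrow> \<exists>k. \<forall>n\<ge>k. C n = C k"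
    and ne: "X0 \<in> F"
  shows "\<exists>M\<in>F. \<forall>X\<in>F. M \<subseteq> X \<longrightarrow> X = M"
proof (rule ccontr)
  assume "\<not> ?thesis"
  then have *: "\<exists>Y. Y \<in> F \<and> X \<subseteq> Y \<and> Y \<noteq> X" if "X \<in> F" for X using that by blast
  define nx where "nx X = (SOME Y. Y \<in> F \<and> X \<subseteq> Y \<and> Y \<noteq> X)" for X
  have nx: "nx X \<in> F \<and> X \<subseteq> nx X \<and> nx X \<noteq> X" if "X \<in> F" for X
    unfolding nx_def by (rule someI_ex[OF *[OF that]])
  define C where "C n = (nx ^^ n) X0" for n
  have CS: "C (Suc n) = nx (C n)" for n by (simp add: C_def)
  have CF: "C n \<in> F" for n
  proof (induction n)
    case (Suc n)
    then show ?case using nx unfolding CS by blast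
  qed (simp add: C_def ne)
  obtain k where "\<forall>n\<ge>k. C n = C k" using acc[of C] CF nx CS by metis
  then have "nx (C k) = C k" using CS[of k] by (metis le_SucI order_refl)
  then show False using nx[OF CF] by blast
qed

lemma left_acc_maximal:
  assumes "left_acc R" "X0 \<in> F" "\<And>X. X \<in> F \<Longrightarrow> left_ideal R X"
  shows "\<exists>M\<in>F. \<forall>X\<in>F. M \<subseteq> X \<longrightarrow> X = M"
  by (rule acc_maximal[OF _ assms(2)]) (use assms(1,3) in \<open>simp add: left_acc_def\<close>)

lemma right_acc_maximal:
  assumes "right_acc R" "X0 \<in> F" "\<And>X. X \<in> F \<Longrightarrow> right_ideal R X"
  shows "\<exists>M\<in>F. \<forall>X\<in>F. M \<subseteq> X \<longrightarrow> X = M"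
  by (rule acc_maximal[OF _ assms(2)]) (use assms(1,3) in \<open>simp add: right_acc_def\<close>)

text \<open>Generation is expressed by minimality among right ideals, which spares explicit linear
  combinations.\<close>

definition right_generated :: "('a, 'm) ring_scheme \<Rightarrow> 'a set \<Rightarrow> 'a list \<Rightarrow> bool"
  where "right_generated R I as \<longleftrightarrow> set as \<subseteq> I \<and> (\<forall>K. right_ideal R K \<longrightarrow> set as \<subseteq> K \<longrightarrow> I \<subseteq> K)"

context ring
begin

section \<open>Annihilators, products and powers of ideals\<close>

lemma left_ideal_lann: "X \<subseteq> carrier R \<Longrightarrow> left_ideal R (lann R X)"
  unfolding left_ideal_def lann_def by (auto simp: l_distr m_assoc subset_iff)

lemma right_ideal_rann: "X \<subseteq> carrier R \<Longrightarrow> right_ideal R (rann R X)"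
  unfolding right_ideal_def rann_def by (auto simp: r_distr m_assoc[symmetric] subset_iff)

lemma right_ideal_lann:
  assumes "left_ideal R X"
  shows "right_ideal R (lann R X)"
  using assms unfolding right_ideal_def left_ideal_def lann_def
  by (auto simp: l_distr m_assoc subset_iff)

lemma lann_antimono: "X \<subseteq> Y \<Longrightarrow> lann R Y \<subseteq> lann R X"
  by (auto simp: lann_def)

lemma rann_antimono: "X \<subseteq> Y \<Longrightarrow> rann R Y \<subseteq> rann R X"
  by (auto simp: rann_def)

lemma ideal_pow_ideal: "ideal I R \<Longrightarrow> ideal (ideal_pow R I n) R"
  by (induction n) (simp_all add: oneideal ideal_prod_is_ideal)

lemma ideal_pow_antimono: "ideal I R \<Longrightarrow> ideal_pow R I (Suc n) \<subseteq> ideal_pow R I n"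
  using ideal_prod_inter[OF _ ideal_pow_ideal] by auto

text \<open>Powers are built by multiplication on the left; Nakayama's lemma and the passage to the
  opposite ring need the new factor on the right.\<close>

lemma ideal_pow_Suc_right:
  assumes I: "ideal I R"
  shows "ideal_pow R I (Suc n) = ideal_pow R I n \<cdot> I"
proof (induction n)
  case 0
  have "carrier R \<cdot> I = I"
  proof
    show "carrier R \<cdot> I \<subseteq> I" using ideal_prod_inter[OF oneideal I] by blast
    show "I \<subseteq> carrier R \<cdot> I"
    proof
      fix i assume "i \<in> I"
      then show "i \<in> carrier R \<cdot> I"
        using ideal_prod.prod[OF one_closed, of i I R] ideal.Icarr[OF I] by simp
    qed
  qed
  then show ?case using ideal_prod_one[OF I] by simp
next
  case (Suc n)
  have "ideal_pow R I (Suc (Suc n)) = I \<cdot> (ideal_pow R I n \<cdot> I)" by (simp only: Suc[symmetric] ideal_pow.simps)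
  also have "\<dots> = ideal_pow R I (Suc n) \<cdot> I"
    using ideal_prod_assoc[OF I ideal_pow_ideal[OF I] I] by simp
  finally show ?case .
qed

lemma ideal_prod_induct:
  assumes "x \<in> I \<cdot> K" "right_ideal R A \<or> left_ideal R A"
    and "\<And>i j. i \<in> I \<Longrightarrow> j \<in> K \<Longrightarrow> i \<otimes> j \<in> A"
  shows "x \<in> A"
  using assms(1)
proof (induction rule: ideal_prod.induct)
  case (sum x y)
  then show ?case using assms(2) unfolding left_ideal_def right_ideal_def by auto
qed (use assms(3) in auto)

lemma right_acc_finitely_generated:
  assumes acc: "right_acc R" and I: "right_ideal R I"
  shows "\<exists>as. right_generated R I as"
proof -
  define gen where "gen as = \<Inter>{K. right_ideal R K \<and> set as \<subseteq> K}" for as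
  let ?F = "{gen as |as. set as \<subseteq> I}"
  have gI: "gen as \<subseteq> I" if "set as \<subseteq> I" for as using that I unfolding gen_def by auto
  have gr: "right_ideal R (gen as)" if "set as \<subseteq> I" for as
    using gI[OF that] I unfolding right_ideal_def gen_def by auto
  have "gen [] \<in> ?F" by force
  from right_acc_maximal[OF acc this] gr
  obtain as where as: "set as \<subseteq> I" and max: "\<And>bs. set bs \<subseteq> I \<Longrightarrow> gen as \<subseteq> gen bs \<Longrightarrow> gen bs = gen as"
    by (smt (verit, ccfv_threshold) mem_Collect_eq)
  have "I \<subseteq> gen as"
  proof
    fix x assume x: "x \<in> I"
    then have "gen (x # as) = gen as" using as by (intro max) (auto simp: gen_def)
    moreover have "x \<in> gen (x # as)" by (auto simp: gen_def)
    ultimately show "x \<in> gen as" by simp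
  qed
  then show ?thesis using as unfolding right_generated_def gen_def by blast
qed

text \<open>Choose \<open>K\<close> maximal among the right ideals strictly inside \<open>I\<close>.
  For \<open>x\<close> in \<open>I\<close> outside \<open>K\<close>, the right ideal
  \<open>K + x J\<close> is not \<open>I\<close>: an equation \<open>x = k + x i\<close> gives
  \<open>x (1 - i) = k\<close>, and a right inverse of \<open>1 - i\<close> would put
  \<open>x\<close> into \<open>K\<close>. So \<open>K + x J = K\<close>, and altogether
  \<open>I J\<close> is contained in \<open>K\<close>.\<close>

lemma nakayama:
  assumes acc: "right_acc R" and J: "ideal J R"
    and unit: "\<And>a. a \<in> J \<Longrightarrow> \<exists>b\<in>carrier R. (\<one> \<ominus> a) \<otimes> b = \<one>"
    and I: "right_ideal R I" and IJ: "I \<subseteq> I \<cdot> J"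
  shows "I = {\<zero>}"
proof (rule ccontr)
  assume ne: "I \<noteq> {\<zero>}"
  have I': "I \<subseteq> carrier R" "\<zero> \<in> I" "\<And>x y. x \<in> I \<Longrightarrow> y \<in> I \<Longrightarrow> x \<oplus> y \<in> I"
    "\<And>r x. r \<in> carrier R \<Longrightarrow> x \<in> I \<Longrightarrow> x \<otimes> r \<in> I"
    using I unfolding right_ideal_def by auto
  have Jc: "\<And>x. x \<in> J \<Longrightarrow> x \<in> carrier R" using ideal.Icarr[OF J] .
  let ?F = "{K. right_ideal R K \<and> K \<subseteq> I \<and> K \<noteq> I}"
  have "{\<zero>} \<in> ?F" using ne I' unfolding right_ideal_def by auto
  from right_acc_maximal[OF acc this] obtain K where KF: "K \<in> ?F" "\<forall>X\<in>?F. K \<subseteq> X \<longrightarrow> X = K" by auto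
  have K: "right_ideal R K" "K \<subseteq> I" "K \<noteq> I" using KF(1) by auto
  have max: "X = K" if "right_ideal R X" "X \<subseteq> I" "X \<noteq> I" "K \<subseteq> X" for X
    using KF(2) that by simp
  have K': "\<And>x. x \<in> K \<Longrightarrow> x \<in> carrier R" "\<zero> \<in> K" "\<And>x y. x \<in> K \<Longrightarrow> y \<in> K \<Longrightarrow> x \<oplus> y \<in> K"
    "\<And>r x. r \<in> carrier R \<Longrightarrow> x \<in> K \<Longrightarrow> x \<otimes> r \<in> K"
    using K(1) unfolding right_ideal_def by auto
  have xj: "x \<otimes> j \<in> K" if x: "x \<in> I" and j: "j \<in> J" for x j
  proof (cases "x \<in> K")
    case True
    then show ?thesis using K'(4) Jc[OF j] by blast
  next
    case False
    have xc: "x \<in> carrier R" using x I' by auto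
    let ?X = "{k \<oplus> x \<otimes> i |k i. k \<in> K \<and> i \<in> J}"
    have J0: "\<zero> \<in> J" using additive_subgroup.zero_closed[OF ideal.axioms(1)[OF J]] .
    have "?X \<noteq> I"
    proof
      assume "?X = I"
      then obtain k i where ki: "k \<in> K" "i \<in> J" "x = k \<oplus> x \<otimes> i" using x by blast
      have "x \<ominus> x \<otimes> i = k \<oplus> (x \<otimes> i \<ominus> x \<otimes> i)"
        using arg_cong[OF ki(3), of "\<lambda>y. y \<ominus> x \<otimes> i"] K'(1)[OF ki(1)] Jc[OF ki(2)] xc
        by (simp add: minus_eq a_assoc)
      then have "x \<otimes> (\<one> \<ominus> i) = k"
        using K'(1)[OF ki(1)] Jc[OF ki(2)] xc by (simp add: expand_simps r_neg)
      moreover obtain b where b: "b \<in> carrier R" "(\<one> \<ominus> i) \<otimes> b = \<one>" using unit[OF ki(2)] by blast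
      ultimately have "k \<otimes> b = x" using xc Jc[OF ki(2)] m_assoc[of x "\<one> \<ominus> i" b] by simp
      then show False using K'(4)[OF b(1) ki(1)] False by simp
    qed
    moreover have "right_ideal R ?X"
      unfolding right_ideal_def
    proof (intro conjI ballI)
      show "?X \<subseteq> carrier R" using K'(1) xc Jc by auto
      show "\<zero> \<in> ?X" using K'(2) J0 xc by force
      show "y \<oplus> z \<in> ?X" if yz: "y \<in> ?X" "z \<in> ?X" for y z
      proof -
        obtain k i l j where *: "k \<in> K" "i \<in> J" "l \<in> K" "j \<in> J" "y = k \<oplus> x \<otimes> i" "z = l \<oplus> x \<otimes> j"
          using yz by blast
        have "y \<oplus> z = (k \<oplus> l) \<oplus> x \<otimes> (i \<oplus> j)"
          using *(5,6) K'(1)[OF *(1)] K'(1)[OF *(3)] Jc[OF *(2)] Jc[OF *(4)] xc by (simp add: r_distr a_ac)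
        then show ?thesis
          using K'(3)[OF *(1,3)] additive_subgroup.a_closed[OF ideal.axioms(1)[OF J] *(2,4)] by blast
      qed
      show "y \<otimes> r \<in> ?X" if r: "r \<in> carrier R" and y: "y \<in> ?X" for r y
      proof -
        obtain k i where *: "k \<in> K" "i \<in> J" "y = k \<oplus> x \<otimes> i" using y by blast
        have "y \<otimes> r = k \<otimes> r \<oplus> x \<otimes> (i \<otimes> r)"
          using *(3) K'(1)[OF *(1)] Jc[OF *(2)] xc r by (simp add: l_distr m_assoc)
        then show ?thesis using K'(4)[OF r *(1)] ideal.I_r_closed[OF J *(2) r] by blast
      qed
    qed
    moreover have "?X \<subseteq> I" using K(2) I'(3,4) x Jc by blast
    moreover have "K \<subseteq> ?X"
    proof
      fix k assume k: "k \<in> K"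
      then have "k = k \<oplus> x \<otimes> \<zero>" using K'(1) xc by simp
      then show "k \<in> ?X" using k J0 by blast
    qed
    ultimately have "?X = K" using max by blast
    moreover have "\<zero> \<oplus> x \<otimes> j \<in> ?X" using K'(2) j by blast
    ultimately show ?thesis using xc Jc[OF j] by simp
  qed
  have "I \<cdot> J \<subseteq> K" using ideal_prod_induct[of _ I J K] K(1) xj by blast
  then show False using IJ K by blast
qed

text \<open>By \<open>ess\<close> the elements of \<open>J\<close> have essential left annihilators.
  Suppose that the left annihilators of the powers stop at some proper \<open>L\<close>, and take
  \<open>a\<close> outside \<open>L\<close> with maximal left annihilator. For \<open>b\<close> in
  \<open>J\<close>, essentiality makes the left annihilator of \<open>a b\<close> strictly larger
  than that of \<open>a\<close>, so \<open>a b\<close> is in \<open>L\<close>. Hence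
  \<open>a\<close> kills the next power, which means that \<open>a\<close> is in \<open>L\<close>
  after all.\<close>

lemma nilpotent_left_acc:
  assumes acc: "left_acc R" and J: "ideal J R"
    and ess: "\<And>a x. a \<in> J \<Longrightarrow> x \<in> carrier R \<Longrightarrow> x \<noteq> \<zero> \<Longrightarrow>
      \<exists>r\<in>carrier R. r \<otimes> x \<noteq> \<zero> \<and> r \<otimes> x \<otimes> a = \<zero>"
  shows "\<exists>n. ideal_pow R J n = {\<zero>}"
proof -
  note Pi = ideal_pow_ideal[OF J]
  have Pc: "ideal_pow R J n \<subseteq> carrier R" for n using ideal.Icarr[OF Pi] by auto
  have P0: "\<zero> \<in> ideal_pow R J n" for n
    using additive_subgroup.zero_closed[OF ideal.axioms(1)[OF Pi]] .
  have Jc: "\<And>x. x \<in> J \<Longrightarrow> x \<in> carrier R" using ideal.Icarr[OF J] .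
  have "\<forall>n. left_ideal R (lann R (ideal_pow R J n)) \<and>
      lann R (ideal_pow R J n) \<subseteq> lann R (ideal_pow R J (Suc n))"
    using left_ideal_lann[OF Pc] lann_antimono[OF ideal_pow_antimono[OF J]] by blast
  then obtain k where "\<forall>n\<ge>k. lann R (ideal_pow R J n) = lann R (ideal_pow R J k)"
    using acc[unfolded left_acc_def, rule_format, of "\<lambda>n. lann R (ideal_pow R J n)"] by auto
  then have k: "lann R (ideal_pow R J (Suc k)) = lann R (ideal_pow R J k)" by (meson le_SucI order_refl)
  define L where "L = lann R (ideal_pow R J k)"
  have "\<one> \<in> L"
  proof (rule ccontr)
    assume one: "\<one> \<notin> L"
    let ?F = "{lann R {a} |a. a \<in> carrier R \<and> a \<notin> L}"
    have F: "left_ideal R X" if "X \<in> ?F" for X using that left_ideal_lann by force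
    have "lann R {\<one>} \<in> ?F" using one by blast
    from left_acc_maximal[OF acc this F]
    obtain a where a: "a \<in> carrier R" "a \<notin> L"
      and max: "\<And>b. b \<in> carrier R \<Longrightarrow> b \<notin> L \<Longrightarrow> lann R {a} \<subseteq> lann R {b} \<Longrightarrow> lann R {b} = lann R {a}"
      by blast
    have a0: "a \<noteq> \<zero>" using a(2) Pc unfolding L_def lann_def by (auto simp: subset_iff)
    have ab: "a \<otimes> b \<in> L" if b: "b \<in> J" for b
    proof (rule ccontr)
      assume "a \<otimes> b \<notin> L"
      moreover have "lann R {a} \<subseteq> lann R {a \<otimes> b}"
        using a(1) Jc[OF b] by (auto simp: lann_def m_assoc[symmetric])
      ultimately have eq: "lann R {a \<otimes> b} = lann R {a}" using max a(1) Jc[OF b] by simp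
      obtain r where r: "r \<in> carrier R" "r \<otimes> a \<noteq> \<zero>" "r \<otimes> a \<otimes> b = \<zero>"
        using ess[OF b a(1) a0] by blast
      then have "r \<in> lann R {a \<otimes> b}" using a(1) Jc[OF b] by (simp add: lann_def m_assoc)
      then show False using r unfolding eq by (simp add: lann_def)
    qed
    have "a \<otimes> y = \<zero>" if "y \<in> J \<cdot> ideal_pow R J k" for y
    proof -
      have "y \<in> rann R {a}"
      proof (rule ideal_prod_induct[OF that])
        show "right_ideal R (rann R {a}) \<or> left_ideal R (rann R {a})" using right_ideal_rann a by simp
        fix i j assume ij: "i \<in> J" "j \<in> ideal_pow R J k"
        have "a \<otimes> i \<otimes> j = \<zero>" using ab[OF ij(1)] ij(2) unfolding L_def lann_def by blast
        then show "i \<otimes> j \<in> rann R {a}" using a(1) Jc[OF ij(1)] subsetD[OF Pc ij(2)] by (simp add: rann_def m_assoc)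
      qed
      then show ?thesis by (simp add: rann_def)
    qed
    then have "a \<in> lann R (ideal_pow R J (Suc k))" using a(1) by (simp add: lann_def)
    then show False using a(2) unfolding k L_def by simp
  qed
  then have "x = \<zero>" if "x \<in> ideal_pow R J k" for x
    using that Pc unfolding L_def lann_def by force
  then show ?thesis using P0 by blast
qed

text \<open>The elements \<open>r\<close> with \<open>h r = h r (g n)\<close> form an ascending
  chain of left ideals. Once it stops, \<open>g k\<close> fixes \<open>g (Suc k)\<close> on the
  right, and in an ascending chain of idempotents this means equality.\<close>

lemma idem_acc_left_hom:
  assumes T: "ring T" and h: "h \<in> ring_hom R T" and acc: "left_acc R"
  shows "idem_acc T (h ` carrier R)"
  unfolding idem_acc_def
proof (intro allI impI)
  interpret h: ring_hom_ring R T h by (rule ring_hom_ringI2[OF ring_axioms T h])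
  fix g :: "nat \<Rightarrow> 'c" assume g: "\<forall>n. g n \<in> h ` carrier R \<and> g n \<otimes>\<^bsub>T\<^esub> g n = g n \<and>
      g n \<otimes>\<^bsub>T\<^esub> g (Suc n) = g n \<and> g (Suc n) \<otimes>\<^bsub>T\<^esub> g n = g n"
  have gc: "g n \<in> carrier T" for n using g[rule_format, of n] by auto
  let ?C = "\<lambda>n. {r \<in> carrier R. h r \<otimes>\<^bsub>T\<^esub> g n = h r}"
  have 1: "left_ideal R (?C n)" for n
    unfolding left_ideal_def using gc by (auto simp: h.S.l_distr h.S.m_assoc)
  have 2: "?C n \<subseteq> ?C (Suc n)" for n
  proof clarify
    fix r assume r: "r \<in> carrier R" "h r \<otimes>\<^bsub>T\<^esub> g n = h r"
    have "h r \<otimes>\<^bsub>T\<^esub> g n \<otimes>\<^bsub>T\<^esub> g (Suc n) = h r \<otimes>\<^bsub>T\<^esub> g n"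
      using g r(1) gc by (simp add: h.S.m_assoc)
    then show "h r \<otimes>\<^bsub>T\<^esub> g (Suc n) = h r" unfolding r(2) .
  qed
  obtain k where "\<forall>n\<ge>k. ?C n = ?C k"
    using acc[unfolded left_acc_def, rule_format, of ?C] 1 2 by blast
  then have k: "?C (Suc k) = ?C k" by (meson le_SucI order_refl)
  obtain r where r: "r \<in> carrier R" "h r = g (Suc k)" using g by (metis imageE)
  have "r \<in> ?C (Suc k)" using r g by simp
  then have "r \<in> ?C k" unfolding k .
  then have "g (Suc k) \<otimes>\<^bsub>T\<^esub> g k = g (Suc k)" using r by simp
  then show "\<exists>n. g (Suc n) = g n" using g by metis
qed

lemma idem_acc_right_hom:
  assumes T: "ring T" and h: "h \<in> ring_hom R T" and acc: "right_acc R"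
  shows "idem_acc T (h ` carrier R)"
proof -
  have "h \<in> ring_hom (opposite_ring R) (opposite_ring T)"
    using h unfolding ring_hom_def by simp
  moreover have "left_acc (opposite_ring R)"
    using acc unfolding left_acc_def right_acc_def by simp
  ultimately have "idem_acc (opposite_ring T) (h ` carrier R)"
    using ring.idem_acc_left_hom[OF opposite_ring_ring ring.opposite_ring_ring[OF T], of h] by simp
  then show ?thesis unfolding idem_acc_def by (simp add: conj_commute)
qed

end

section \<open>Automorphism-invariant rings\<close>

text \<open>The embedding of \<open>R\<close> is encoded by the image \<open>u\<close> of
  \<open>1\<close>: the assumptions say that \<open>R u\<close> is a copy of \<open>R\<close> that
  is essential in \<open>E\<close> and stable under automorphisms.\<close>

locale automorphism_invariant_ring = injective_left_module +
  fixes u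
  assumes u: "u \<in> carrier E"
    and free: "\<And>r. r \<in> carrier R \<Longrightarrow> r \<odot>\<^bsub>E\<^esub> u = \<zero>\<^bsub>E\<^esub> \<Longrightarrow> r = \<zero>"
    and essential: "\<And>x. x \<in> carrier E \<Longrightarrow> x \<noteq> \<zero>\<^bsub>E\<^esub> \<Longrightarrow>
      \<exists>r\<in>carrier R. r \<odot>\<^bsub>E\<^esub> x \<noteq> \<zero>\<^bsub>E\<^esub> \<and> (\<exists>s\<in>carrier R. r \<odot>\<^bsub>E\<^esub> x = s \<odot>\<^bsub>E\<^esub> u)"
    and invariant: "\<And>\<phi>. \<phi> \<in> module_auts R E \<Longrightarrow> \<exists>s\<in>carrier R. \<phi> u = s \<odot>\<^bsub>E\<^esub> u"
begin

lemma left_ideal_carrier: "left_ideal R (carrier R)"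
  unfolding left_ideal_def by auto

lemma extend_element:
  assumes "q \<in> carrier E" "m \<in> carrier E"
    and "\<And>x. x \<in> carrier R \<Longrightarrow> x \<odot>\<^bsub>E\<^esub> q = \<zero>\<^bsub>E\<^esub> \<Longrightarrow> x \<odot>\<^bsub>E\<^esub> m = \<zero>\<^bsub>E\<^esub>"
  shows "\<exists>f\<in>carrier S. f q = m"
proof -
  obtain f where "f \<in> carrier S" "\<forall>x\<in>carrier R. f (x \<odot>\<^bsub>E\<^esub> q) = x \<odot>\<^bsub>E\<^esub> m"
    using extend_cyclic[OF left_ideal_carrier assms] by blast
  then show ?thesis using assms(1,2) by (auto dest!: bspec[of "carrier R" _ \<one>])
qed

lemma extend_u: "m \<in> carrier E \<Longrightarrow> \<exists>f\<in>carrier S. f u = m"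
  using extend_element[OF u] free smult_l_null by blast

lemma u_cancel:
  assumes "a \<in> carrier R" "b \<in> carrier R" "a \<odot>\<^bsub>E\<^esub> u = b \<odot>\<^bsub>E\<^esub> u"
  shows "a = b"
proof -
  have "(a \<oplus> \<ominus> b) \<odot>\<^bsub>E\<^esub> u = a \<odot>\<^bsub>E\<^esub> u \<oplus>\<^bsub>E\<^esub> \<ominus>\<^bsub>E\<^esub> (b \<odot>\<^bsub>E\<^esub> u)"
    using assms(1,2) u smult_minus_one[of "b \<odot>\<^bsub>E\<^esub> u"] smult_assoc1[of "\<ominus> \<one>" b u]
    by (simp add: smult_l_distr l_minus)
  then have "(a \<oplus> \<ominus> b) \<odot>\<^bsub>E\<^esub> u = \<zero>\<^bsub>E\<^esub>" using assms u by (simp add: M.r_neg)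
  then show ?thesis using free[of "a \<oplus> \<ominus> b"] assms(1,2) R.r_right_minus_eq[of a b] by (simp add: R.minus_eq)
qed

text \<open>Such an \<open>f\<close> vanishes on the essential submodule \<open>R u\<close>.\<close>

lemma kill_u_ess_ker:
  assumes f: "f \<in> carrier S" and fu: "f u = \<zero>\<^bsub>E\<^esub>"
  shows "f \<in> ess_ker"
  unfolding ess_ker_def
proof (intro CollectI conjI ballI impI)
  fix x assume "x \<in> carrier E" "x \<noteq> \<zero>\<^bsub>E\<^esub>"
  then obtain r s where *: "r \<in> carrier R" "r \<odot>\<^bsub>E\<^esub> x \<noteq> \<zero>\<^bsub>E\<^esub>" "s \<in> carrier R" "r \<odot>\<^bsub>E\<^esub> x = s \<odot>\<^bsub>E\<^esub> u"
    using essential by blast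
  then have "f (r \<odot>\<^bsub>E\<^esub> x) = \<zero>\<^bsub>E\<^esub>" using fu u by (simp add: endo_smult[OF f] smult_r_null)
  then show "\<exists>r\<in>carrier R. r \<odot>\<^bsub>E\<^esub> x \<noteq> \<zero>\<^bsub>E\<^esub> \<and> f (r \<odot>\<^bsub>E\<^esub> x) = \<zero>\<^bsub>E\<^esub>" using * by blast
qed (rule f)

text \<open>Only automorphisms are known to map \<open>u\<close> into \<open>R u\<close>. But
  \<open>1 - f\<close> is one, and \<open>f u = u - (1 - f) u\<close>.\<close>

lemma ess_ker_u:
  assumes f: "f \<in> ess_ker"
  shows "\<exists>s\<in>carrier R. f u = s \<odot>\<^bsub>E\<^esub> u"
proof -
  have fc: "f \<in> carrier S" by (rule ess_kerD(1)[OF f])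
  have "\<one>\<^bsub>S\<^esub> \<ominus>\<^bsub>S\<^esub> f \<in> module_auts R E"
    unfolding module_auts_def using ess_ker_bij[OF f] endo_hom[of "\<one>\<^bsub>S\<^esub> \<ominus>\<^bsub>S\<^esub> f"] fc by auto
  from invariant[OF this] obtain s where s: "s \<in> carrier R" "u \<ominus>\<^bsub>E\<^esub> f u = s \<odot>\<^bsub>E\<^esub> u"
    using fc u by (auto simp: endo_minus_apply)
  have c: "f u \<in> carrier E" using endo_closed[OF fc u] .
  have "f u = u \<ominus>\<^bsub>E\<^esub> (u \<ominus>\<^bsub>E\<^esub> f u)"
    using c u M.r_neg2[of u "f u"] by (simp add: M.minus_eq M.minus_add)
  also have "\<dots> = (\<one> \<ominus> s) \<odot>\<^bsub>E\<^esub> u"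
    unfolding s(2) using s(1) u smult_minus_one[of "s \<odot>\<^bsub>E\<^esub> u"] smult_assoc1[of "\<ominus> \<one>" s u]
    by (simp add: R.minus_eq M.minus_eq smult_l_distr l_minus)
  finally show ?thesis using s(1) by blast
qed

section \<open>The homomorphism from \<open>R\<close> to \<open>T\<close> and its kernel
  \<open>J\<close>\<close>

abbreviation T where "T \<equiv> S Quot ess_ker"

abbreviation cls where "cls f \<equiv> ess_ker +>\<^bsub>S\<^esub> f"

sublocale T: ring_hom_ring S T "(+>\<^bsub>S\<^esub>) ess_ker"
  by (rule N.rcos_ring_hom_ring)

lemma cls_surj:
  assumes "c \<in> carrier T"
  obtains f where "f \<in> carrier S" "c = cls f"
proof -
  have "c \<in> (\<Union>f\<in>carrier S. {cls f})"
    using assms unfolding FactRing_def A_RCOSETS_def' partial_object.simps .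
  with that show thesis by blast
qed

lemma cls_eq_iff: "f \<in> carrier S \<Longrightarrow> g \<in> carrier S \<Longrightarrow> cls f = cls g \<longleftrightarrow> f \<ominus>\<^bsub>S\<^esub> g \<in> ess_ker"
  using S.quotient_eq_iff_same_a_r_cos[OF ess_ker_ideal] by blast

lemma T_regular: "von_neumann_regular T"
  unfolding von_neumann_regular_def
proof
  fix c assume "c \<in> carrier T"
  then obtain f where f: "f \<in> carrier S" "c = cls f" by (rule cls_surj)
  obtain g where g: "g \<in> carrier S" "f \<otimes>\<^bsub>S\<^esub> g \<otimes>\<^bsub>S\<^esub> f \<ominus>\<^bsub>S\<^esub> f \<in> ess_ker"
    using regular_mod_ess_ker[OF f(1)] by blast
  then have "cls (f \<otimes>\<^bsub>S\<^esub> g \<otimes>\<^bsub>S\<^esub> f) = cls f" by (subst cls_eq_iff) (use f(1) in auto)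
  then have "c \<otimes>\<^bsub>T\<^esub> cls g \<otimes>\<^bsub>T\<^esub> c = c" using f g(1) by simp
  then show "\<exists>x\<in>carrier T. c \<otimes>\<^bsub>T\<^esub> x \<otimes>\<^bsub>T\<^esub> c = c" using g(1) by (intro bexI[of _ "cls g"]) auto
qed

text \<open>An extension to \<open>E\<close> of right multiplication by \<open>a\<close> on
  \<open>R u\<close>. Two choices differ by an endomorphism that kills \<open>u\<close>, so the
  class in \<open>T\<close> depends on \<open>a\<close> alone.\<close>

definition rmult where "rmult a = (SOME f. f \<in> carrier S \<and> f u = a \<odot>\<^bsub>E\<^esub> u)"

lemma rmult: "a \<in> carrier R \<Longrightarrow> rmult a \<in> carrier S" "a \<in> carrier R \<Longrightarrow> rmult a u = a \<odot>\<^bsub>E\<^esub> u"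
proof -
  assume "a \<in> carrier R"
  then have "\<exists>f. f \<in> carrier S \<and> f u = a \<odot>\<^bsub>E\<^esub> u" using extend_u[of "a \<odot>\<^bsub>E\<^esub> u"] u by blast
  from someI_ex[OF this] show "rmult a \<in> carrier S" "rmult a u = a \<odot>\<^bsub>E\<^esub> u"
    unfolding rmult_def by auto
qed

definition \<pi> where "\<pi> a = cls (rmult a)"

lemma pi_eq:
  assumes "f \<in> carrier S" "a \<in> carrier R" "f u = a \<odot>\<^bsub>E\<^esub> u"
  shows "\<pi> a = cls f"
proof -
  have "rmult a \<ominus>\<^bsub>S\<^esub> f \<in> ess_ker"
    by (rule kill_u_ess_ker)
       (use assms rmult u in \<open>simp_all add: endo_minus_apply M.minus_eq M.r_neg\<close>)
  then show ?thesis unfolding \<pi>_def using cls_eq_iff rmult assms by simp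
qed

lemma pi_hom: "\<pi> \<in> ring_hom R T"
proof (rule ring_hom_memI)
  fix a b assume a: "a \<in> carrier R" and b: "b \<in> carrier R"
  show "\<pi> a \<in> carrier T" unfolding \<pi>_def using rmult[OF a] by simp
  have "\<pi> (a \<otimes> b) = cls (rmult a \<otimes>\<^bsub>S\<^esub> rmult b)"
    by (rule pi_eq) (use a b u rmult endo_smult[OF rmult(1)[OF b]] in \<open>simp_all add: smult_assoc1\<close>)
  then show "\<pi> (a \<otimes> b) = \<pi> a \<otimes>\<^bsub>T\<^esub> \<pi> b" unfolding \<pi>_def using rmult a b by simp
  have "\<pi> (a \<oplus> b) = cls (rmult a \<oplus>\<^bsub>S\<^esub> rmult b)"
    by (rule pi_eq) (use a b u rmult in \<open>simp_all add: smult_l_distr\<close>)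
  then show "\<pi> (a \<oplus> b) = \<pi> a \<oplus>\<^bsub>T\<^esub> \<pi> b" unfolding \<pi>_def using rmult a b by simp
next
  have "\<pi> \<one> = cls \<one>\<^bsub>S\<^esub>" by (rule pi_eq) (use u in simp_all)
  then show "\<pi> \<one> = \<one>\<^bsub>T\<^esub>" by simp
qed

sublocale pi: ring_hom_ring R T \<pi>
  by (rule ring_hom_ringI2[OF R.ring_axioms T.S.ring_axioms pi_hom])

text \<open>By \<open>J_ess_ker\<close> this kernel consists of the \<open>a\<close> whose right
  multiplication has essential kernel; it is the left singular ideal.\<close>

definition J where "J = a_kernel R T \<pi>"

lemma J_ideal: "ideal J R"
  unfolding J_def by (rule pi.kernel_is_ideal)

lemma J_carrier: "a \<in> J \<Longrightarrow> a \<in> carrier R"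
  by (rule ideal.Icarr[OF J_ideal])

lemma J_iff: "a \<in> J \<longleftrightarrow> a \<in> carrier R \<and> \<pi> a = \<zero>\<^bsub>T\<^esub>"
  unfolding J_def a_kernel_def' by blast

lemma J_ess_ker:
  assumes "f \<in> carrier S" "a \<in> carrier R" "f u = a \<odot>\<^bsub>E\<^esub> u"
  shows "f \<in> ess_ker \<longleftrightarrow> a \<in> J"
proof -
  have "a \<in> J \<longleftrightarrow> cls f = cls \<zero>\<^bsub>S\<^esub>" using assms(2) by (simp add: J_iff pi_eq[OF assms])
  also have "\<dots> \<longleftrightarrow> f \<in> ess_ker"
    using cls_eq_iff[OF assms(1) S.zero_closed] assms(1) by (simp add: S.minus_eq)
  finally show ?thesis by simp
qed

lemma pi_eq_iff: "a \<in> carrier R \<Longrightarrow> b \<in> carrier R \<Longrightarrow> \<pi> a = \<pi> b \<longleftrightarrow> a \<ominus> b \<in> J"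
  using T.S.r_right_minus_eq[of "\<pi> a" "\<pi> b"] by (simp add: J_iff R.minus_eq T.S.minus_eq)

text \<open>With \<open>m = h u\<close>, the element \<open>a m\<close> is the value at
  \<open>u\<close> of \<open>rmult a\<close> followed by \<open>h\<close>. This composite still has
  essential kernel, so \<open>ess_ker_u\<close> places its value in \<open>R u\<close>, wherever
  \<open>m\<close> itself may be.\<close>

lemma J_smult:
  assumes a: "a \<in> J" and m: "m \<in> carrier E"
  shows "\<exists>y\<in>J. a \<odot>\<^bsub>E\<^esub> m = y \<odot>\<^bsub>E\<^esub> u"
proof -
  have ac: "a \<in> carrier R" using J_carrier a .
  obtain h where h: "h \<in> carrier S" "h u = m" using extend_u[OF m] by blast
  have f: "rmult a \<in> ess_ker" using J_ess_ker rmult ac a by blast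
  then have hf: "rmult a \<otimes>\<^bsub>S\<^esub> h \<in> ess_ker" using N.I_r_closed h(1) by blast
  have eq: "(rmult a \<otimes>\<^bsub>S\<^esub> h) u = a \<odot>\<^bsub>E\<^esub> m" using u rmult(2)[OF ac] endo_smult[OF h(1) ac u] h(2) by simp
  obtain y where y: "y \<in> carrier R" "(rmult a \<otimes>\<^bsub>S\<^esub> h) u = y \<odot>\<^bsub>E\<^esub> u" using ess_ker_u[OF hf] by blast
  then have "y \<in> J" using J_ess_ker[OF ess_kerD(1)[OF hf] y] hf by simp
  then show ?thesis using y(2) eq by auto
qed

text \<open>The hypothesis \<open>ess\<close> of \<open>nilpotent_left_acc\<close>, obtained by
  testing the essential kernel of \<open>rmult a\<close> at \<open>x u\<close>.\<close>

lemma J_essential: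
  assumes a: "a \<in> J" and x: "x \<in> carrier R" "x \<noteq> \<zero>"
  shows "\<exists>r\<in>carrier R. r \<otimes> x \<noteq> \<zero> \<and> r \<otimes> x \<otimes> a = \<zero>"
proof -
  have ac: "a \<in> carrier R" using J_carrier a .
  have f: "rmult a \<in> ess_ker" using J_ess_ker rmult ac a by blast
  have "x \<odot>\<^bsub>E\<^esub> u \<noteq> \<zero>\<^bsub>E\<^esub>" using free x by blast
  from ess_kerD(2)[OF f _ this] obtain r where r: "r \<in> carrier R" "r \<odot>\<^bsub>E\<^esub> (x \<odot>\<^bsub>E\<^esub> u) \<noteq> \<zero>\<^bsub>E\<^esub>"
    "rmult a (r \<odot>\<^bsub>E\<^esub> (x \<odot>\<^bsub>E\<^esub> u)) = \<zero>\<^bsub>E\<^esub>" using u x by auto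
  have "(r \<otimes> x \<otimes> a) \<odot>\<^bsub>E\<^esub> u = rmult a (r \<odot>\<^bsub>E\<^esub> (x \<odot>\<^bsub>E\<^esub> u))"
    using endo_smult[OF rmult(1)[OF ac]] rmult(2)[OF ac] r(1) x(1) u ac by (simp add: smult_assoc1)
  then have "r \<otimes> x \<otimes> a = \<zero>" using free[of "r \<otimes> x \<otimes> a"] r x ac by simp
  moreover have "r \<otimes> x \<noteq> \<zero>" using r(1,2) x(1) u smult_l_null[OF u] smult_assoc1[of r x u] by auto
  ultimately show ?thesis using r(1) by blast
qed

text \<open>The inverse \<open>w\<close> of the automorphism \<open>1 - rmult a\<close> is an
  automorphism as well, so invariance yields \<open>w u = b u\<close>, and \<open>b\<close> is the
  right inverse.\<close>

lemma J_unit: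
  assumes a: "a \<in> J"
  shows "\<exists>b\<in>carrier R. (\<one> \<ominus> a) \<otimes> b = \<one>"
proof -
  have ac: "a \<in> carrier R" using J_carrier a .
  have f: "rmult a \<in> ess_ker" using J_ess_ker rmult ac a by blast
  define v where "v = \<one>\<^bsub>S\<^esub> \<ominus>\<^bsub>S\<^esub> rmult a"
  have v: "v \<in> carrier S" unfolding v_def using rmult(1)[OF ac] by simp
  have bij: "bij_betw v (carrier E) (carrier E)" unfolding v_def by (rule ess_ker_bij[OF f])
  have vu: "v u = (\<one> \<ominus> a) \<odot>\<^bsub>E\<^esub> u"
    unfolding v_def using u ac rmult[OF ac] smult_minus_one[of "a \<odot>\<^bsub>E\<^esub> u"] smult_assoc1[of "\<ominus> \<one>" a u]
    by (simp add: endo_minus_apply R.minus_eq M.minus_eq smult_l_distr l_minus)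
  define w where "w = the_inv_into (carrier E) v"
  have w: "w x \<in> carrier E" "v (w x) = x" if "x \<in> carrier E" for x
    using that bij unfolding w_def bij_betw_def
    by (auto intro: the_inv_into_into f_the_inv_into_f)
  have wv: "w (v x) = x" if "x \<in> carrier E" for x
    using the_inv_into_f_f[OF bij_betw_imp_inj_on[OF bij] that] by (simp add: w_def)
  have hom: "w \<in> module_homs R E E"
    unfolding module_homs_def
  proof (intro CollectI conjI ballI Pi_I)
    fix x y assume *: "x \<in> carrier E" "y \<in> carrier E"
    show "w (x \<oplus>\<^bsub>E\<^esub> y) = w x \<oplus>\<^bsub>E\<^esub> w y"
      using wv[of "w x \<oplus>\<^bsub>E\<^esub> w y"] w * by (simp add: endo_add[OF v])
  next
    fix r x assume *: "r \<in> carrier R" "x \<in> carrier E"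
    show "w (r \<odot>\<^bsub>E\<^esub> x) = r \<odot>\<^bsub>E\<^esub> w x"
      using wv[of "r \<odot>\<^bsub>E\<^esub> w x"] w * by (simp add: endo_smult[OF v])
  qed (use w in auto)
  moreover have "bij_betw w (carrier E) (carrier E)"
    unfolding w_def by (rule bij_betw_the_inv_into[OF bij])
  ultimately have "w \<in> module_auts R E" unfolding module_auts_def by blast
  from invariant[OF this] obtain b where b: "b \<in> carrier R" "w u = b \<odot>\<^bsub>E\<^esub> u" by blast
  have "((\<one> \<ominus> a) \<otimes> b) \<odot>\<^bsub>E\<^esub> u = (\<one> \<ominus> a) \<odot>\<^bsub>E\<^esub> w u" using b ac u by (simp add: smult_assoc1)
  also have "\<dots> = w ((\<one> \<ominus> a) \<odot>\<^bsub>E\<^esub> u)" using module_homsD(3)[OF hom, of "\<one> \<ominus> a" u] ac u by simp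
  also have "\<dots> = \<one> \<odot>\<^bsub>E\<^esub> u" unfolding vu[symmetric] wv[OF u] using u by simp
  finally have "(\<one> \<ominus> a) \<otimes> b = \<one>" using b ac by (intro u_cancel) auto
  then show ?thesis using b(1) by blast
qed

section \<open>The image of \<open>R\<close> in \<open>T\<close>\<close>

definition B where "B = \<pi> ` carrier R"

text \<open>A class determines \<open>f u\<close> only up to values at \<open>u\<close> of
  endomorphisms with essential kernel, and these lie in \<open>R u\<close> by
  \<open>ess_ker_u\<close>.\<close>

lemma B_iff:
  assumes f: "f \<in> carrier S"
  shows "cls f \<in> B \<longleftrightarrow> (\<exists>s\<in>carrier R. f u = s \<odot>\<^bsub>E\<^esub> u)"
proof
  assume "\<exists>s\<in>carrier R. f u = s \<odot>\<^bsub>E\<^esub> u"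
  then show "cls f \<in> B" using pi_eq[OF f] unfolding B_def by blast
next
  assume "cls f \<in> B"
  then obtain a where a: "a \<in> carrier R" "cls f = cls (rmult a)" unfolding B_def \<pi>_def by blast
  then have "f \<ominus>\<^bsub>S\<^esub> rmult a \<in> ess_ker" using cls_eq_iff f rmult(1) by simp
  from ess_ker_u[OF this] obtain s where s: "s \<in> carrier R" "f u \<ominus>\<^bsub>E\<^esub> a \<odot>\<^bsub>E\<^esub> u = s \<odot>\<^bsub>E\<^esub> u"
    using f a rmult[OF a(1)] u by (auto simp: endo_minus_apply)
  have "f u = (f u \<ominus>\<^bsub>E\<^esub> a \<odot>\<^bsub>E\<^esub> u) \<oplus>\<^bsub>E\<^esub> a \<odot>\<^bsub>E\<^esub> u"
    using endo_closed[OF f u] a(1) u by (simp add: M.minus_eq M.a_assoc M.l_neg)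
  also have "\<dots> = (s \<oplus> a) \<odot>\<^bsub>E\<^esub> u" unfolding s(2) using s(1) a(1) u by (simp add: smult_l_distr)
  finally show "\<exists>s\<in>carrier R. f u = s \<odot>\<^bsub>E\<^esub> u" using s(1) a(1) by blast
qed

text \<open>Lifts of a unit and of its inverse are inverse to each other up to endomorphisms with
  essential kernel, so the lift is an automorphism and \<open>invariant\<close> applies.\<close>

lemma B_units: "Units T \<subseteq> B"
proof
  fix c assume "c \<in> Units T"
  then obtain d where c: "c \<in> carrier T" and d: "d \<in> carrier T" "d \<otimes>\<^bsub>T\<^esub> c = \<one>\<^bsub>T\<^esub>" "c \<otimes>\<^bsub>T\<^esub> d = \<one>\<^bsub>T\<^esub>"
    unfolding Units_def by blast
  obtain f where f: "f \<in> carrier S" "c = cls f" using c by (rule cls_surj)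
  obtain g where g: "g \<in> carrier S" "d = cls g" using d(1) by (rule cls_surj)
  have "cls \<one>\<^bsub>S\<^esub> = cls (f \<otimes>\<^bsub>S\<^esub> g)" "cls \<one>\<^bsub>S\<^esub> = cls (g \<otimes>\<^bsub>S\<^esub> f)" using d f g by simp_all
  then have "\<one>\<^bsub>S\<^esub> \<ominus>\<^bsub>S\<^esub> f \<otimes>\<^bsub>S\<^esub> g \<in> ess_ker" "\<one>\<^bsub>S\<^esub> \<ominus>\<^bsub>S\<^esub> g \<otimes>\<^bsub>S\<^esub> f \<in> ess_ker"
    using cls_eq_iff[OF S.one_closed S.m_closed[OF f(1) g(1)]]
      cls_eq_iff[OF S.one_closed S.m_closed[OF g(1) f(1)]] by blast+
  from unit_mod_ess_ker[OF f(1) g(1) this] show "c \<in> B"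
    unfolding f(2) B_iff[OF f(1)] by (rule invariant)
qed

lemma B_subring: "subring B T"
  unfolding B_def by (rule pi.img_is_subring[OF carrier_is_subring])

text \<open>The set \<open>Q\<close> stands for anything additive that contains all
  \<open>a E\<close>; it will be \<open>I u\<close> for a right ideal \<open>I\<close>. For the
  induction step, \<open>x a u |-> x m\<close> is well defined on the \<open>x\<close> that kill the
  tail, because those which also kill \<open>a\<close> kill \<open>m\<close>. If \<open>g\<close>
  extends this map and \<open>e = g u\<close>, then \<open>m - a e\<close> is killed by everything
  that kills the tail.\<close>

lemma finitely_generated_annihilator:
  assumes as: "set as \<subseteq> carrier R" and Q: "\<And>a e. a \<in> set as \<Longrightarrow> e \<in> carrier E \<Longrightarrow> a \<odot>\<^bsub>E\<^esub> e \<in> Q"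
    and Q0: "\<zero>\<^bsub>E\<^esub> \<in> Q" and Qadd: "\<And>x y. x \<in> Q \<Longrightarrow> y \<in> Q \<Longrightarrow> x \<oplus>\<^bsub>E\<^esub> y \<in> Q"
    and m: "m \<in> carrier E" "\<And>r. r \<in> lann R (set as) \<Longrightarrow> r \<odot>\<^bsub>E\<^esub> m = \<zero>\<^bsub>E\<^esub>"
  shows "m \<in> Q"
  using as Q m
proof (induction as arbitrary: m)
  case Nil
  have "\<one> \<odot>\<^bsub>E\<^esub> m = \<zero>\<^bsub>E\<^esub>" by (rule Nil.prems(4)) (simp add: lann_def)
  then show ?case using Nil.prems Q0 by simp
next
  case (Cons a as)
  have a: "a \<in> carrier R" and as: "set as \<subseteq> carrier R" using Cons.prems(1) by auto
  have "\<exists>g\<in>carrier S. \<forall>x\<in>lann R (set as). g (x \<odot>\<^bsub>E\<^esub> (a \<odot>\<^bsub>E\<^esub> u)) = x \<odot>\<^bsub>E\<^esub> m"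
  proof (rule extend_cyclic[OF left_ideal_lann[OF as] _ Cons.prems(3)])
    fix x assume x: "x \<in> lann R (set as)" "x \<odot>\<^bsub>E\<^esub> (a \<odot>\<^bsub>E\<^esub> u) = \<zero>\<^bsub>E\<^esub>"
    then have xc: "x \<in> carrier R" by (simp add: lann_def)
    have "x \<otimes> a = \<zero>" using free[of "x \<otimes> a"] x(2) xc a u by (simp add: smult_assoc1)
    then have "x \<in> lann R (set (a # as))" using x(1) by (simp add: lann_def)
    then show "x \<odot>\<^bsub>E\<^esub> m = \<zero>\<^bsub>E\<^esub>" by (rule Cons.prems(4))
  qed (use a u in simp)
  then obtain g where g: "g \<in> carrier S"
    "\<And>x. x \<in> lann R (set as) \<Longrightarrow> g (x \<odot>\<^bsub>E\<^esub> (a \<odot>\<^bsub>E\<^esub> u)) = x \<odot>\<^bsub>E\<^esub> m" by blast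
  define e where "e = g u"
  have e: "e \<in> carrier E" using endo_closed[OF g(1) u] by (simp add: e_def)
  define m' where "m' = m \<ominus>\<^bsub>E\<^esub> a \<odot>\<^bsub>E\<^esub> e"
  have "m' \<in> Q"
  proof (rule Cons.IH[OF as])
    show "m' \<in> carrier E" using Cons.prems(3) a e by (simp add: m'_def)
    fix r assume r: "r \<in> lann R (set as)"
    then have rc: "r \<in> carrier R" by (simp add: lann_def)
    have "r \<odot>\<^bsub>E\<^esub> m = r \<odot>\<^bsub>E\<^esub> (a \<odot>\<^bsub>E\<^esub> e)"
      using g(2)[OF r] endo_smult[OF g(1)] rc a u by (simp add: e_def)
    then show "r \<odot>\<^bsub>E\<^esub> m' = \<zero>\<^bsub>E\<^esub>"
      unfolding m'_def using rc a e Cons.prems(3)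
      by (simp add: M.minus_eq smult_r_distr smult_r_minus M.r_neg)
  qed (use Cons.prems(2) in auto)
  moreover have "a \<odot>\<^bsub>E\<^esub> e \<in> Q" using Cons.prems(2) e by simp
  moreover have "m = m' \<oplus>\<^bsub>E\<^esub> a \<odot>\<^bsub>E\<^esub> e"
    unfolding m'_def using Cons.prems(3) a e by (simp add: M.minus_eq M.a_assoc M.l_neg)
  ultimately show ?case using Qadd by simp
qed

lemma ideal_pow_J_smult:
  "a \<in> ideal_pow R J (Suc n) \<Longrightarrow> m \<in> carrier E \<Longrightarrow> \<exists>y\<in>ideal_pow R J (Suc n). a \<odot>\<^bsub>E\<^esub> m = y \<odot>\<^bsub>E\<^esub> u"
proof (induction n arbitrary: a m)
  case 0
  then show ?case using J_smult ideal_prod_one[OF J_ideal] by simp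
next
  case (Suc n)
  let ?P = "ideal_pow R J (Suc (Suc n))"
  note Pi = ideal_pow_ideal[OF J_ideal]
  let ?A = "{a \<in> carrier R. \<exists>y\<in>?P. a \<odot>\<^bsub>E\<^esub> m = y \<odot>\<^bsub>E\<^esub> u}"
  have Pc: "\<And>y. y \<in> ?P \<Longrightarrow> y \<in> carrier R" using ideal.Icarr[OF Pi] .
  have "left_ideal R ?A"
    unfolding left_ideal_def
  proof (intro conjI ballI)
    show "\<zero> \<in> ?A"
      using Suc.prems(2) u smult_l_null additive_subgroup.zero_closed[OF ideal.axioms(1)[OF Pi]]
      by (auto intro!: bexI[of _ \<zero>] simp del: ideal_pow.simps)
    show "x \<oplus> y \<in> ?A" if xy: "x \<in> ?A" "y \<in> ?A" for x y
    proof -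
      obtain v w where *: "v \<in> ?P" "w \<in> ?P" "x \<odot>\<^bsub>E\<^esub> m = v \<odot>\<^bsub>E\<^esub> u" "y \<odot>\<^bsub>E\<^esub> m = w \<odot>\<^bsub>E\<^esub> u" using xy by blast
      have "(x \<oplus> y) \<odot>\<^bsub>E\<^esub> m = (v \<oplus> w) \<odot>\<^bsub>E\<^esub> u"
        using *(3,4) xy Pc[OF *(1)] Pc[OF *(2)] Suc.prems(2) u by (simp add: smult_l_distr)
      moreover have "v \<oplus> w \<in> ?P" using additive_subgroup.a_closed[OF ideal.axioms(1)[OF Pi] *(1,2)] .
      ultimately show ?thesis using xy by blast
    qed
    show "r \<otimes> x \<in> ?A" if r: "r \<in> carrier R" and x: "x \<in> ?A" for r x
    proof -
      obtain v where *: "v \<in> ?P" "x \<odot>\<^bsub>E\<^esub> m = v \<odot>\<^bsub>E\<^esub> u" using x by blast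
      have "(r \<otimes> x) \<odot>\<^bsub>E\<^esub> m = (r \<otimes> v) \<odot>\<^bsub>E\<^esub> u"
        using *(2) x r Pc[OF *(1)] Suc.prems(2) u by (simp add: smult_assoc1)
      then show ?thesis using ideal.I_l_closed[OF Pi *(1) r] x r by blast
    qed
  qed auto
  moreover have "i \<otimes> j \<in> ?A" if ij: "i \<in> J" "j \<in> ideal_pow R J (Suc n)" for i j
  proof -
    have c: "i \<in> carrier R" "j \<in> carrier R" by (rule J_carrier[OF ij(1)], rule ideal.Icarr[OF Pi ij(2)])
    obtain y where y: "y \<in> ideal_pow R J (Suc n)" "j \<odot>\<^bsub>E\<^esub> m = y \<odot>\<^bsub>E\<^esub> u"
      using Suc.IH[OF ij(2) Suc.prems(2)] by blast
    have "(i \<otimes> j) \<odot>\<^bsub>E\<^esub> m = (i \<otimes> y) \<odot>\<^bsub>E\<^esub> u"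
      using c y(2) Suc.prems(2) u ideal.Icarr[OF Pi y(1)] by (simp add: smult_assoc1)
    moreover have "i \<otimes> y \<in> ?P" using ideal_prod.prod[OF ij(1) y(1)] by simp
    ultimately show ?thesis using c by blast
  qed
  ultimately have "a \<in> ?A"
    using ideal_prod_induct[of a J "ideal_pow R J (Suc n)" ?A] Suc.prems(1) by simp
  then show ?case by blast
qed

text \<open>Let the left annihilators of \<open>J^n\<close> and \<open>J^(n+1)\<close> agree, and
  let \<open>as\<close> generate \<open>J^(n+1)\<close> as a right ideal. For \<open>x\<close> in
  \<open>J^n\<close>, whatever kills \<open>as\<close> kills \<open>x\<close>; so \<open>x u\<close>
  lies in \<open>J^(n+1) u\<close>, and \<open>x\<close> in \<open>J^(n+1)\<close> by freeness of
  \<open>u\<close>. Thus \<open>J^n\<close> is contained in \<open>J^n J\<close>, and Nakayama's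
  lemma applies.\<close>

lemma J_nilpotent_right_acc:
  assumes acc: "right_acc R"
  shows "\<exists>n. ideal_pow R J n = {\<zero>}"
proof -
  let ?P = "ideal_pow R J"
  note Pi = ideal_pow_ideal[OF J_ideal]
  have Pc: "\<And>y n. y \<in> ?P n \<Longrightarrow> y \<in> carrier R" using ideal.Icarr[OF Pi] .
  have "\<forall>n. right_ideal R (lann R (?P n)) \<and> lann R (?P n) \<subseteq> lann R (?P (Suc n))"
    using right_ideal_lann[OF ideal_imp_left_ideal[OF Pi]] lann_antimono[OF ideal_pow_antimono[OF J_ideal]]
    by blast
  then obtain k where k: "\<forall>n\<ge>k. lann R (?P n) = lann R (?P k)"
    using acc[unfolded right_acc_def, rule_format, of "\<lambda>n. lann R (?P n)"] by auto
  define n where "n = Suc k"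
  have n: "lann R (?P (Suc n)) = lann R (?P n)"
    using k[rule_format, of "Suc n"] k[rule_format, of n] by (simp add: n_def del: ideal_pow.simps)
  have rP: "right_ideal R (?P (Suc n))" by (rule ideal_imp_right_ideal[OF Pi])
  obtain as where as: "set as \<subseteq> ?P (Suc n)"
    "\<And>K. right_ideal R K \<Longrightarrow> set as \<subseteq> K \<Longrightarrow> ?P (Suc n) \<subseteq> K"
    using right_acc_finitely_generated[OF acc rP] unfolding right_generated_def by blast
  have asc: "set as \<subseteq> carrier R" using as(1) Pc by blast
  have la: "lann R (set as) \<subseteq> lann R (?P (Suc n))"
  proof
    fix r assume r: "r \<in> lann R (set as)"
    then have "set as \<subseteq> rann R {r}" using asc by (auto simp: lann_def rann_def)
    then have "?P (Suc n) \<subseteq> rann R {r}" using as(2) right_ideal_rann[of "{r}"] r by (simp add: lann_def)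
    then show "r \<in> lann R (?P (Suc n))" using r by (auto simp: lann_def rann_def)
  qed
  have "x \<in> ?P (Suc n)" if x: "x \<in> ?P n" for x
  proof -
    let ?Q = "{y \<odot>\<^bsub>E\<^esub> u |y. y \<in> ?P (Suc n)}"
    have "x \<odot>\<^bsub>E\<^esub> u \<in> ?Q"
    proof (rule finitely_generated_annihilator[OF asc])
      show "a \<odot>\<^bsub>E\<^esub> e \<in> ?Q" if "a \<in> set as" "e \<in> carrier E" for a e
        using ideal_pow_J_smult[of a n e] that as(1) by blast
      show "\<zero>\<^bsub>E\<^esub> \<in> ?Q"
        by (intro CollectI exI[of _ \<zero>] conjI)
           (simp add: smult_l_null[OF u], rule additive_subgroup.zero_closed[OF ideal.axioms(1)[OF Pi]])
      show "v \<oplus>\<^bsub>E\<^esub> w \<in> ?Q" if vw: "v \<in> ?Q" "w \<in> ?Q" for v w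
      proof -
        obtain a b where *: "a \<in> ?P (Suc n)" "b \<in> ?P (Suc n)" "v = a \<odot>\<^bsub>E\<^esub> u" "w = b \<odot>\<^bsub>E\<^esub> u"
          using vw by blast
        have "v \<oplus>\<^bsub>E\<^esub> w = (a \<oplus> b) \<odot>\<^bsub>E\<^esub> u"
          using *(3,4) Pc[OF *(1)] Pc[OF *(2)] u by (simp add: smult_l_distr)
        then show ?thesis using additive_subgroup.a_closed[OF ideal.axioms(1)[OF Pi] *(1,2)] by blast
      qed
      fix r assume "r \<in> lann R (set as)"
      then have "r \<in> lann R (?P n)" using la n by blast
      then have "r \<in> carrier R" "r \<otimes> x = \<zero>" using x by (auto simp: lann_def)
      then show "r \<odot>\<^bsub>E\<^esub> (x \<odot>\<^bsub>E\<^esub> u) = \<zero>\<^bsub>E\<^esub>"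
        using smult_assoc1[of r x u] Pc[OF x] u smult_l_null by simp
    qed (use Pc[OF x] u in simp)
    then obtain y where y: "y \<in> ?P (Suc n)" "x \<odot>\<^bsub>E\<^esub> u = y \<odot>\<^bsub>E\<^esub> u" by blast
    then show ?thesis using u_cancel[OF Pc[OF x] Pc[OF y(1)]] by simp
  qed
  then have "?P n \<subseteq> ?P n \<cdot> J" using ideal_pow_Suc_right[OF J_ideal] by blast
  from nakayama[OF acc J_ideal J_unit ideal_imp_right_ideal[OF Pi] this] show ?thesis by blast
qed

lemma J_nilpotent:
  assumes "left_acc R \<or> right_acc R"
  shows "\<exists>n. ideal_pow R J n = {\<zero>}"
  using assms nilpotent_left_acc[OF _ J_ideal J_essential] J_nilpotent_right_acc by blast

lemma B_unit_subring:
  assumes "left_acc R \<or> right_acc R"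
  shows "unit_subring T B"
proof -
  have "idem_acc T B"
    using assms idem_acc_left_hom[OF T.S.ring_axioms pi_hom] idem_acc_right_hom[OF T.S.ring_axioms pi_hom]
    unfolding B_def by blast
  then show ?thesis
    by (intro unit_subring.intro unit_subring_axioms.intro T.S.ring_axioms T_regular B_subring B_units)
qed

end

section \<open>Self-injectivity\<close>

locale noetherian_invariant_ring = automorphism_invariant_ring +
  assumes acc: "left_acc R \<or> right_acc R"
begin

sublocale U: unit_subring T B
  by (rule B_unit_subring[OF acc])

abbreviation Br where "Br \<equiv> T\<lparr>carrier := B\<rparr>"

sublocale Br: ring Br
  by (rule T.S.subring_is_ring[OF B_subring])

lemma Br_idem_acc: "X \<subseteq> B \<Longrightarrow> idem_acc Br X"
  using idem_acc_subset[OF U.acc] unfolding idem_acc_def by simp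

lemma pi_B: "a \<in> carrier R \<Longrightarrow> \<pi> a \<in> B"
  by (simp add: B_def)

lemma pi_mult: "a \<in> carrier R \<Longrightarrow> b \<in> carrier R \<Longrightarrow> \<pi> (a \<otimes> b) = \<pi> a \<otimes>\<^bsub>T\<^esub> \<pi> b"
  by (rule ring_hom_mult[OF pi_hom])

lemma pi_add: "a \<in> carrier R \<Longrightarrow> b \<in> carrier R \<Longrightarrow> \<pi> (a \<oplus> b) = \<pi> a \<oplus>\<^bsub>T\<^esub> \<pi> b"
  by (rule ring_hom_add[OF pi_hom])

text \<open>The image of \<open>L\<close> in \<open>B\<close> is generated by an idempotent, and
  \<open>e\<close> lifts the complementary one. It is idempotent only modulo \<open>J\<close>, so no
  lifting of idempotents is involved, and still \<open>L\<close> is determined as the set of all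
  \<open>x\<close> with \<open>x e\<close> in \<open>J\<close>.\<close>

lemma left_ideal_complement:
  assumes L: "left_ideal R L" and JL: "J \<subseteq> L"
  shows "\<exists>e\<in>carrier R. \<one> \<ominus> e \<in> L \<and> (\<forall>x\<in>L. x \<otimes> e \<in> J)"
proof -
  have L': "\<And>x. x \<in> L \<Longrightarrow> x \<in> carrier R" "\<zero> \<in> L" "\<And>x y. x \<in> L \<Longrightarrow> y \<in> L \<Longrightarrow> x \<oplus> y \<in> L"
    "\<And>r x. r \<in> carrier R \<Longrightarrow> x \<in> L \<Longrightarrow> r \<otimes> x \<in> L"
    using L unfolding left_ideal_def by auto
  have "left_ideal Br (\<pi> ` L)"
    unfolding left_ideal_def
  proof (intro conjI ballI)
    show "\<pi> ` L \<subseteq> carrier Br" using L'(1) pi_B by auto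
    show "\<zero>\<^bsub>Br\<^esub> \<in> \<pi> ` L" using L'(2) pi.hom_zero by force
    show "x \<oplus>\<^bsub>Br\<^esub> y \<in> \<pi> ` L" if xy: "x \<in> \<pi> ` L" "y \<in> \<pi> ` L" for x y
    proof -
      obtain a b where *: "a \<in> L" "x = \<pi> a" "b \<in> L" "y = \<pi> b" using xy by blast
      have "x \<oplus>\<^bsub>Br\<^esub> y = \<pi> (a \<oplus> b)" using * pi_add L'(1) by simp
      then show ?thesis using L'(3)[OF *(1,3)] by blast
    qed
    show "r \<otimes>\<^bsub>Br\<^esub> x \<in> \<pi> ` L" if r: "r \<in> carrier Br" and x: "x \<in> \<pi> ` L" for r x
    proof -
      obtain a b where *: "a \<in> carrier R" "r = \<pi> a" "b \<in> L" "x = \<pi> b" using r x unfolding B_def by auto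
      have "r \<otimes>\<^bsub>Br\<^esub> x = \<pi> (a \<otimes> b)" using * pi_mult L'(1) by simp
      then show ?thesis using L'(4)[OF *(1,3)] by blast
    qed
  qed
  moreover have "idem_acc Br (\<pi> ` L)" using L'(1) pi_B by (intro Br_idem_acc) auto
  ultimately have "\<exists>g\<in>\<pi> ` L. g \<otimes>\<^bsub>Br\<^esub> g = g \<and> (\<forall>x\<in>\<pi> ` L. x \<otimes>\<^bsub>Br\<^esub> g = x)"
    by (rule Br.left_ideal_idempotent[OF U.B_regular])
  then obtain g where g: "g \<in> \<pi> ` L" "\<forall>x\<in>\<pi> ` L. x \<otimes>\<^bsub>T\<^esub> g = x" by auto
  then obtain d where d: "d \<in> L" "g = \<pi> d" by blast
  have dc: "d \<in> carrier R" using d L' by blast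
  have "x \<otimes> (\<one> \<ominus> d) \<in> J" if x: "x \<in> L" for x
  proof -
    have xc: "x \<in> carrier R" using x L' by blast
    have "\<pi> (x \<otimes> d) = \<pi> x" using g(2) x d(2) pi_mult[OF xc dc] by auto
    then have "x \<ominus> x \<otimes> d \<in> J" using pi_eq_iff[of x "x \<otimes> d"] xc dc by simp
    moreover have "x \<ominus> x \<otimes> d = x \<otimes> (\<one> \<ominus> d)" using xc dc by (simp add: R.minus_eq r_distr r_minus)
    ultimately show ?thesis by simp
  qed
  then show ?thesis using d(1) dc R.compl_compl[OF dc] by (intro bexI[of _ "\<one> \<ominus> d"]) auto
qed

text \<open>Because \<open>R/J\<close> is semisimple, the annihilator of \<open>J\<close> in
  \<open>E\<close> is the socle of \<open>E\<close>. Simple submodules are never mentioned;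
  \<open>annihilator_complement\<close> does their work.\<close>

definition P where "P = {m \<in> carrier E. \<forall>a\<in>J. a \<odot>\<^bsub>E\<^esub> m = \<zero>\<^bsub>E\<^esub>}"

lemma P_carrier: "p \<in> P \<Longrightarrow> p \<in> carrier E" and P_kill: "p \<in> P \<Longrightarrow> a \<in> J \<Longrightarrow> a \<odot>\<^bsub>E\<^esub> p = \<zero>\<^bsub>E\<^esub>"
  by (auto simp: P_def)

lemma P_endo:
  assumes p: "p \<in> P" and f: "f \<in> carrier S"
  shows "f p \<in> P"
proof -
  have "a \<odot>\<^bsub>E\<^esub> f p = \<zero>\<^bsub>E\<^esub>" if a: "a \<in> J" for a
    using endo_smult[OF f J_carrier[OF a] P_carrier[OF p]] P_kill[OF p a] endo_zero[OF f] by simp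
  then show ?thesis unfolding P_def using endo_closed[OF f P_carrier[OF p]] by simp
qed

lemma P_smult:
  assumes p: "p \<in> P" and r: "r \<in> carrier R"
  shows "r \<odot>\<^bsub>E\<^esub> p \<in> P"
proof -
  have "a \<odot>\<^bsub>E\<^esub> (r \<odot>\<^bsub>E\<^esub> p) = \<zero>\<^bsub>E\<^esub>" if a: "a \<in> J" for a
    using smult_assoc1[OF J_carrier[OF a] r P_carrier[OF p]] P_kill[OF p ideal.I_r_closed[OF J_ideal a r]]
    by simp
  then show ?thesis unfolding P_def using r P_carrier[OF p] by simp
qed

lemma P_diff:
  assumes "p \<in> P" "q \<in> P"
  shows "p \<ominus>\<^bsub>E\<^esub> q \<in> P"
  using assms unfolding P_def
  by (auto simp: M.minus_eq smult_r_distr smult_r_minus J_carrier M_minus_zero)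

text \<open>By nilpotency some power of \<open>J\<close> does not kill \<open>x\<close> while the
  next one does; multiples of \<open>x\<close> by elements of that power are killed by
  \<open>J\<close>.\<close>

lemma P_essential:
  assumes x: "x \<in> carrier E" "x \<noteq> \<zero>\<^bsub>E\<^esub>"
  shows "\<exists>r\<in>carrier R. r \<odot>\<^bsub>E\<^esub> x \<noteq> \<zero>\<^bsub>E\<^esub> \<and> r \<odot>\<^bsub>E\<^esub> x \<in> P"
proof -
  let ?K = "\<lambda>n. \<forall>a\<in>ideal_pow R J n. a \<odot>\<^bsub>E\<^esub> x = \<zero>\<^bsub>E\<^esub>"
  obtain n where n: "ideal_pow R J n = {\<zero>}" using J_nilpotent[OF acc] by blast
  have "?K n" unfolding n using smult_l_null[OF x(1)] by simp
  moreover have "\<not> ?K 0" using x by (auto intro!: bexI[of _ \<one>])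
  ultimately have "\<exists>k<n. (\<forall>i\<le>k. \<not> ?K i) \<and> ?K (Suc k)" by (intro ex_least_nat_less)
  then obtain k where k: "\<not> ?K k" "?K (Suc k)" by blast
  obtain a where a: "a \<in> ideal_pow R J k" "a \<odot>\<^bsub>E\<^esub> x \<noteq> \<zero>\<^bsub>E\<^esub>" using k(1) by blast
  have ac: "a \<in> carrier R" by (rule ideal.Icarr[OF ideal_pow_ideal[OF J_ideal] a(1)])
  have "b \<odot>\<^bsub>E\<^esub> (a \<odot>\<^bsub>E\<^esub> x) = \<zero>\<^bsub>E\<^esub>" if b: "b \<in> J" for b
  proof -
    have "b \<otimes> a \<in> ideal_pow R J (Suc k)" using ideal_prod.prod[OF b a(1)] by simp
    then show ?thesis using k(2) smult_assoc1[OF J_carrier[OF b] ac x(1)] by simp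
  qed
  then show ?thesis using a(2) ac x(1) unfolding P_def by blast
qed

text \<open>The annihilator of \<open>q\<close> contains \<open>J\<close> and thus has a complement
  \<open>e\<close>. The benefit: for every \<open>p\<close> in \<open>P\<close> there is a
  well-defined map from \<open>R q\<close> sending \<open>q\<close> to \<open>e p\<close>, because
  \<open>x q = 0\<close> puts \<open>x e\<close> into \<open>J\<close>.\<close>

lemma annihilator_complement:
  assumes q: "q \<in> P"
  shows "\<exists>e\<in>carrier R. e \<odot>\<^bsub>E\<^esub> q = q \<and>
    (\<forall>x\<in>carrier R. x \<odot>\<^bsub>E\<^esub> q = \<zero>\<^bsub>E\<^esub> \<longrightarrow> x \<otimes> e \<in> J)"
proof -
  have qc: "q \<in> carrier E" using P_carrier[OF q] .
  let ?L = "{x \<in> carrier R. x \<odot>\<^bsub>E\<^esub> q = \<zero>\<^bsub>E\<^esub>}"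
  have "left_ideal R ?L"
    unfolding left_ideal_def using qc
    by (auto simp: smult_l_null smult_l_distr smult_assoc1 smult_r_null)
  moreover have "J \<subseteq> ?L" using J_carrier P_kill[OF q] by blast
  ultimately obtain e where e: "e \<in> carrier R" "\<one> \<ominus> e \<in> ?L" "\<forall>x\<in>?L. x \<otimes> e \<in> J"
    using left_ideal_complement by blast
  have "q = e \<odot>\<^bsub>E\<^esub> q \<oplus>\<^bsub>E\<^esub> (\<one> \<ominus> e) \<odot>\<^bsub>E\<^esub> q"
    using smult_l_distr[of e "\<one> \<ominus> e" q] e(1) qc by (simp add: R.add_compl)
  then have "e \<odot>\<^bsub>E\<^esub> q = q" using e(1,2) qc by simp
  then show ?thesis using e by blast
qed

text \<open>With \<open>e\<close> chosen for \<open>h p\<close>, the element \<open>e p\<close> has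
  the same image as \<open>p\<close>, and \<open>h\<close> is injective on its multiples:
  \<open>r h p = 0\<close> puts \<open>r e\<close> into \<open>J\<close>, which kills
  \<open>p\<close>. An essential kernel leaves no room for such an element unless it is
  zero.\<close>

lemma ess_ker_P:
  assumes h: "h \<in> ess_ker" and p: "p \<in> P"
  shows "h p = \<zero>\<^bsub>E\<^esub>"
proof (rule ccontr)
  assume ne: "h p \<noteq> \<zero>\<^bsub>E\<^esub>"
  have hc: "h \<in> carrier S" by (rule ess_kerD(1)[OF h])
  have pc: "p \<in> carrier E" by (rule P_carrier[OF p])
  obtain e where e: "e \<in> carrier R" "e \<odot>\<^bsub>E\<^esub> h p = h p"
    "\<And>x. x \<in> carrier R \<Longrightarrow> x \<odot>\<^bsub>E\<^esub> h p = \<zero>\<^bsub>E\<^esub> \<Longrightarrow> x \<otimes> e \<in> J"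
    using annihilator_complement[OF P_endo[OF p hc]] by blast
  have he: "h (e \<odot>\<^bsub>E\<^esub> p) = h p" using endo_smult[OF hc e(1) pc] e(2) by simp
  then have "e \<odot>\<^bsub>E\<^esub> p \<noteq> \<zero>\<^bsub>E\<^esub>" using ne endo_zero[OF hc] by auto
  from ess_kerD(2)[OF h _ this] obtain r where r: "r \<in> carrier R" "r \<odot>\<^bsub>E\<^esub> (e \<odot>\<^bsub>E\<^esub> p) \<noteq> \<zero>\<^bsub>E\<^esub>"
    "h (r \<odot>\<^bsub>E\<^esub> (e \<odot>\<^bsub>E\<^esub> p)) = \<zero>\<^bsub>E\<^esub>" using e(1) pc by auto
  have "r \<odot>\<^bsub>E\<^esub> h p = \<zero>\<^bsub>E\<^esub>" using r(3) endo_smult[OF hc r(1)] e(1) pc he by simp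
  then have "(r \<otimes> e) \<odot>\<^bsub>E\<^esub> p = \<zero>\<^bsub>E\<^esub>" using e(3)[OF r(1)] P_kill[OF p] by blast
  then show False using r(2) smult_assoc1[OF r(1) e(1) pc] by simp
qed

text \<open>This makes the action of \<open>T\<close> on \<open>P\<close> well defined and faithful;
  faithfulness comes from \<open>P\<close> being essential.\<close>

lemma cls_eq_iff_P:
  assumes f: "f \<in> carrier S" and g: "g \<in> carrier S"
  shows "cls f = cls g \<longleftrightarrow> (\<forall>p\<in>P. f p = g p)"
proof
  assume "cls f = cls g"
  then have n: "f \<ominus>\<^bsub>S\<^esub> g \<in> ess_ker" using cls_eq_iff[OF f g] by blast
  show "\<forall>p\<in>P. f p = g p"
  proof
    fix p assume p: "p \<in> P"
    have "f p \<ominus>\<^bsub>E\<^esub> g p = \<zero>\<^bsub>E\<^esub>" using ess_ker_P[OF n p] endo_minus_apply[OF f g P_carrier[OF p]] by simp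
    then show "f p = g p"
      using endo_closed[OF f P_carrier[OF p]] endo_closed[OF g P_carrier[OF p]]
        M.minus_equality[of "f p" "\<ominus>\<^bsub>E\<^esub> g p"] by (simp add: M.minus_eq)
  qed
next
  assume *: "\<forall>p\<in>P. f p = g p"
  have "f \<ominus>\<^bsub>S\<^esub> g \<in> ess_ker"
    unfolding ess_ker_def
  proof (intro CollectI conjI ballI impI)
    fix x assume "x \<in> carrier E" "x \<noteq> \<zero>\<^bsub>E\<^esub>"
    then obtain r where r: "r \<in> carrier R" "r \<odot>\<^bsub>E\<^esub> x \<noteq> \<zero>\<^bsub>E\<^esub>" "r \<odot>\<^bsub>E\<^esub> x \<in> P" using P_essential by blast
    have "(f \<ominus>\<^bsub>S\<^esub> g) (r \<odot>\<^bsub>E\<^esub> x) = \<zero>\<^bsub>E\<^esub>"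
      using endo_minus_apply[OF f g P_carrier[OF r(3)]] *[rule_format, OF r(3)]
        endo_closed[OF g P_carrier[OF r(3)]] by (simp add: M.minus_eq M.r_neg)
    then show "\<exists>r\<in>carrier R. r \<odot>\<^bsub>E\<^esub> x \<noteq> \<zero>\<^bsub>E\<^esub> \<and> (f \<ominus>\<^bsub>S\<^esub> g) (r \<odot>\<^bsub>E\<^esub> x) = \<zero>\<^bsub>E\<^esub>" using r by blast
  qed (use f g in simp)
  then show "cls f = cls g" using cls_eq_iff[OF f g] by blast
qed

section \<open>Central idempotents of \<open>T\<close> acting on the socle\<close>

definition rep where "rep c = (SOME f. f \<in> carrier S \<and> c = cls f)"

lemma rep:
  assumes "c \<in> carrier T"
  shows "rep c \<in> carrier S" "cls (rep c) = c"
proof -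
  have "\<exists>f. f \<in> carrier S \<and> c = cls f" using cls_surj[OF assms] by blast
  from someI_ex[OF this] show "rep c \<in> carrier S" "cls (rep c) = c" unfolding rep_def by auto
qed

lemma central_rep_commute:
  assumes c: "c \<in> central_idempotents T" and h: "h \<in> carrier S" and p: "p \<in> P"
  shows "h (rep c p) = rep c (h p)"
proof -
  note C = T.S.central_idempotentsD[OF c]
  note f = rep[OF C(1)]
  have "cls (rep c \<otimes>\<^bsub>S\<^esub> h) = cls (h \<otimes>\<^bsub>S\<^esub> rep c)"
    using C(3)[of "cls h"] f h by simp
  then have "(rep c \<otimes>\<^bsub>S\<^esub> h) p = (h \<otimes>\<^bsub>S\<^esub> rep c) p"
    using cls_eq_iff_P[OF S.m_closed[OF f(1) h] S.m_closed[OF h f(1)]] p by blast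
  then show ?thesis using P_carrier[OF p] by simp
qed

lemma central_rep_idem:
  assumes c: "c \<in> central_idempotents T" and p: "p \<in> P"
  shows "rep c (rep c p) = rep c p"
proof -
  note C = T.S.central_idempotentsD[OF c]
  note f = rep[OF C(1)]
  have "cls (rep c \<otimes>\<^bsub>S\<^esub> rep c) = cls (rep c)" using C(2) f by simp
  then have "(rep c \<otimes>\<^bsub>S\<^esub> rep c) p = rep c p"
    using cls_eq_iff_P[OF S.m_closed[OF f(1) f(1)] f(1)] p by blast
  then show ?thesis using P_carrier[OF p] by simp
qed

text \<open>
  The ring \<open>T\<close> acts on the socle \<open>P\<close> of \<open>E\<close>. A central idempotent \<open>c\<close> cuts out
  a direct summand of \<open>P\<close> which shares no simple submodule with its complement, hence is
  determined by its annihilator \<open>A c\<close>.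
\<close>

definition A where "A c = {r \<in> carrier R. \<forall>p\<in>P. r \<odot>\<^bsub>E\<^esub> rep c p = \<zero>\<^bsub>E\<^esub>}"

lemma A_ideal:
  assumes c: "c \<in> carrier T"
  shows "ideal (A c) R"
proof -
  note f = rep[OF c]
  have fc: "\<And>p. p \<in> P \<Longrightarrow> rep c p \<in> carrier E" using endo_closed[OF f(1)] P_carrier by blast
  have "left_ideal R (A c)"
    unfolding left_ideal_def A_def using fc
    by (auto simp: smult_l_null smult_l_distr smult_assoc1 smult_r_null)
  moreover have "r \<otimes> s \<in> A c" if r: "r \<in> A c" and s: "s \<in> carrier R" for r s
  proof -
    have rc: "r \<in> carrier R" and rk: "\<And>p. p \<in> P \<Longrightarrow> r \<odot>\<^bsub>E\<^esub> rep c p = \<zero>\<^bsub>E\<^esub>" using r unfolding A_def by auto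
    have "(r \<otimes> s) \<odot>\<^bsub>E\<^esub> rep c p = \<zero>\<^bsub>E\<^esub>" if p: "p \<in> P" for p
      using rk[OF P_smult[OF p s]] endo_smult[OF f(1) s P_carrier[OF p]] smult_assoc1[OF rc s fc[OF p]]
      by simp
    then show ?thesis using rc s unfolding A_def by simp
  qed
  ultimately show ?thesis unfolding R.ideal_iff left_ideal_def right_ideal_def by auto
qed

lemma J_subset_A:
  assumes c: "c \<in> carrier T"
  shows "J \<subseteq> A c"
  using P_kill[OF P_endo[OF _ rep(1)[OF c]]] J_carrier unfolding A_def by blast

text \<open>The component \<open>q = y - f y\<close> is killed by \<open>f\<close> and also by
  \<open>A c\<close>. If it is not zero, its complement \<open>e\<close> is outside
  \<open>A c\<close>, so \<open>e f p\<close> is nonzero for some \<open>p\<close>. Some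
  endomorphism maps \<open>q\<close> to \<open>e f p\<close>; but \<open>f\<close> kills
  \<open>q\<close> and fixes \<open>e f p\<close>, contrary to centrality.\<close>

lemma central_summand:
  assumes c: "c \<in> central_idempotents T" and y: "y \<in> P" and Ay: "\<And>r. r \<in> A c \<Longrightarrow> r \<odot>\<^bsub>E\<^esub> y = \<zero>\<^bsub>E\<^esub>"
  shows "rep c y = y"
proof (rule ccontr)
  assume ne: "rep c y \<noteq> y"
  note C = T.S.central_idempotentsD[OF c]
  define f where "f = rep c"
  have f: "f \<in> carrier S" unfolding f_def by (rule rep[OF C(1)])
  have yc: "y \<in> carrier E" by (rule P_carrier[OF y])
  have fy: "f y \<in> P" "f y \<in> carrier E" using P_endo[OF y f] P_carrier by auto
  have ff: "f (f p) = f p" if "p \<in> P" for p unfolding f_def by (rule central_rep_idem[OF c that])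
  define q where "q = y \<ominus>\<^bsub>E\<^esub> f y"
  have q: "q \<in> P" unfolding q_def by (rule P_diff[OF y fy(1)])
  have qc: "q \<in> carrier E" by (rule P_carrier[OF q])
  have Aq: "r \<odot>\<^bsub>E\<^esub> q = \<zero>\<^bsub>E\<^esub>" if r: "r \<in> A c" for r
  proof -
    have "r \<odot>\<^bsub>E\<^esub> f y = \<zero>\<^bsub>E\<^esub>" "r \<in> carrier R" using r y unfolding A_def f_def by auto
    then show ?thesis using Ay[OF r] yc fy(2)
      by (simp add: q_def M.minus_eq smult_r_distr smult_r_minus M_minus_zero)
  qed
  have fq: "f q = \<zero>\<^bsub>E\<^esub>"
    using yc fy(2) ff[OF y] by (simp add: q_def M.minus_eq endoD[OF f] M.r_neg)
  have q0: "q \<noteq> \<zero>\<^bsub>E\<^esub>"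
    using ne yc fy(2) M.minus_equality[of y "\<ominus>\<^bsub>E\<^esub> f y"] unfolding q_def f_def by (auto simp: M.minus_eq)
  obtain e where e: "e \<in> carrier R" "e \<odot>\<^bsub>E\<^esub> q = q"
    "\<And>x. x \<in> carrier R \<Longrightarrow> x \<odot>\<^bsub>E\<^esub> q = \<zero>\<^bsub>E\<^esub> \<Longrightarrow> x \<otimes> e \<in> J"
    using annihilator_complement[OF q] by blast
  have "e \<notin> A c" using Aq e(2) q0 by auto
  then obtain p where p: "p \<in> P" "e \<odot>\<^bsub>E\<^esub> f p \<noteq> \<zero>\<^bsub>E\<^esub>" using e(1) unfolding A_def f_def by blast
  have fp: "f p \<in> P" "f p \<in> carrier E" using P_endo[OF p(1) f] P_carrier by auto
  have "\<exists>h\<in>carrier S. h q = e \<odot>\<^bsub>E\<^esub> f p"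
  proof (rule extend_element[OF qc])
    fix x assume x: "x \<in> carrier R" "x \<odot>\<^bsub>E\<^esub> q = \<zero>\<^bsub>E\<^esub>"
    show "x \<odot>\<^bsub>E\<^esub> (e \<odot>\<^bsub>E\<^esub> f p) = \<zero>\<^bsub>E\<^esub>"
      using P_kill[OF fp(1) e(3)[OF x]] smult_assoc1[OF x(1) e(1) fp(2)] by simp
  qed (use e(1) fp(2) in simp)
  then obtain h where h: "h \<in> carrier S" "h q = e \<odot>\<^bsub>E\<^esub> f p" by blast
  have "f (h q) = \<zero>\<^bsub>E\<^esub>"
    using central_rep_commute[OF c h(1) q] fq endo_zero[OF h(1)] unfolding f_def by simp
  moreover have "f (h q) = e \<odot>\<^bsub>E\<^esub> f p" unfolding h(2) using endo_smult[OF f e(1) fp(2)] ff[OF p(1)] by simp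
  ultimately show False using p(2) by simp
qed

text \<open>If the annihilators agree, \<open>c\<close> fixes what \<open>d\<close> produces and
  conversely. As the two actions commute, they coincide on \<open>P\<close>.\<close>

lemma A_inj: "inj_on A (central_idempotents T)"
proof (rule inj_onI)
  fix c d assume c: "c \<in> central_idempotents T" and d: "d \<in> central_idempotents T" and eq: "A c = A d"
  have cc: "c \<in> carrier T" "d \<in> carrier T" using T.S.central_idempotentsD(1) c d by auto
  have key: "rep c (rep d p) = rep d p"
    if c: "c \<in> central_idempotents T" and d: "d \<in> carrier T" and eq: "A c = A d" and p: "p \<in> P" for c d p
  proof (rule central_summand[OF c P_endo[OF p rep(1)[OF d]]])
    fix r assume "r \<in> A c"
    then show "r \<odot>\<^bsub>E\<^esub> rep d p = \<zero>\<^bsub>E\<^esub>" using p unfolding eq unfolding A_def by blast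
  qed
  have "rep c p = rep d p" if p: "p \<in> P" for p
    using key[OF c cc(2) eq p] key[OF d cc(1) eq[symmetric] p]
      central_rep_commute[OF c rep(1)[OF cc(2)] p] by simp
  then have "cls (rep c) = cls (rep d)" using cls_eq_iff_P[OF rep(1)[OF cc(1)] rep(1)[OF cc(2)]] by blast
  then show "c = d" using rep(2) cc by simp
qed

text \<open>Since \<open>A c\<close> contains \<open>J\<close>, it is the full preimage of an ideal
  of \<open>B\<close>, and \<open>B\<close> is regular with the chain condition on
  idempotents.\<close>

lemma A_generator:
  assumes c: "c \<in> carrier T"
  shows "\<exists>z\<in>central_idempotents Br. A c = {x \<in> carrier R. \<pi> x \<otimes>\<^bsub>T\<^esub> z = \<pi> x}"
proof -
  have Ac: "\<And>x. x \<in> A c \<Longrightarrow> x \<in> carrier R" by (simp add: A_def)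
  have mult: "r \<otimes>\<^bsub>Br\<^esub> x \<in> \<pi> ` A c" "x \<otimes>\<^bsub>Br\<^esub> r \<in> \<pi> ` A c" if r: "r \<in> carrier Br" and x: "x \<in> \<pi> ` A c" for r x
    proof -
      obtain a b where *: "a \<in> carrier R" "r = \<pi> a" "b \<in> A c" "x = \<pi> b" using r x unfolding B_def by auto
      have "r \<otimes>\<^bsub>Br\<^esub> x = \<pi> (a \<otimes> b)" "x \<otimes>\<^bsub>Br\<^esub> r = \<pi> (b \<otimes> a)" using * pi_mult Ac by simp_all
      then show "r \<otimes>\<^bsub>Br\<^esub> x \<in> \<pi> ` A c" "x \<otimes>\<^bsub>Br\<^esub> r \<in> \<pi> ` A c"
        using ideal.I_l_closed[OF A_ideal[OF c] *(3,1)] ideal.I_r_closed[OF A_ideal[OF c] *(3,1)] by auto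
    qed
  have sub: "\<pi> ` A c \<subseteq> carrier Br" using Ac pi_B by auto
  have zero: "\<zero>\<^bsub>Br\<^esub> \<in> \<pi> ` A c"
    using additive_subgroup.zero_closed[OF ideal.axioms(1)[OF A_ideal[OF c]]] pi.hom_zero by force
  have add: "x \<oplus>\<^bsub>Br\<^esub> y \<in> \<pi> ` A c" if xy: "x \<in> \<pi> ` A c" "y \<in> \<pi> ` A c" for x y
  proof -
    obtain a b where *: "a \<in> A c" "x = \<pi> a" "b \<in> A c" "y = \<pi> b" using xy by blast
    have "x \<oplus>\<^bsub>Br\<^esub> y = \<pi> (a \<oplus> b)" using * pi_add Ac by simp
    then show ?thesis using additive_subgroup.a_closed[OF ideal.axioms(1)[OF A_ideal[OF c]] *(1,3)] by blast
  qed
  have "ideal (\<pi> ` A c) Br"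
    unfolding Br.ideal_iff left_ideal_def right_ideal_def
    by (intro conjI ballI sub zero add mult; assumption)
  moreover have "idem_acc Br (\<pi> ` A c)" using Ac pi_B by (intro Br_idem_acc) auto
  ultimately have "\<exists>z\<in>\<pi> ` A c. z \<in> central_idempotents Br \<and> (\<forall>x\<in>\<pi> ` A c. x \<otimes>\<^bsub>Br\<^esub> z = x)"
    by (rule Br.ideal_central_idempotent[OF U.B_regular])
  then obtain z where z: "z \<in> \<pi> ` A c" "z \<in> central_idempotents Br" "\<forall>x\<in>\<pi> ` A c. x \<otimes>\<^bsub>T\<^esub> z = x"
    by auto
  obtain d where d: "d \<in> A c" "z = \<pi> d" using z(1) by blast
  have "x \<in> A c" if x: "x \<in> carrier R" "\<pi> x \<otimes>\<^bsub>T\<^esub> z = \<pi> x" for x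
  proof -
    have xd: "x \<otimes> d \<in> A c" by (rule ideal.I_l_closed[OF A_ideal[OF c] d(1) x(1)])
    have "\<pi> x = \<pi> (x \<otimes> d)" using x d(2) pi_mult[OF x(1) Ac[OF d(1)]] by simp
    then have "x \<ominus> x \<otimes> d \<in> A c" using pi_eq_iff[OF x(1) Ac[OF xd]] J_subset_A[OF c] by blast
    from additive_subgroup.a_closed[OF ideal.axioms(1)[OF A_ideal[OF c]] this xd]
    show ?thesis using x(1) Ac[OF xd] by (simp add: R.minus_eq R.a_assoc R.l_neg)
  qed
  then have "A c = {x \<in> carrier R. \<pi> x \<otimes>\<^bsub>T\<^esub> z = \<pi> x}" using z(3) Ac by blast
  then show ?thesis using z(2) by blast
qed

definition gen where "gen c = (SOME z. z \<in> central_idempotents Br \<and>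
  A c = {x \<in> carrier R. \<pi> x \<otimes>\<^bsub>T\<^esub> z = \<pi> x})"

lemma gen:
  assumes "c \<in> carrier T"
  shows "gen c \<in> central_idempotents Br" "A c = {x \<in> carrier R. \<pi> x \<otimes>\<^bsub>T\<^esub> gen c = \<pi> x}"
proof -
  have "\<exists>z. z \<in> central_idempotents Br \<and> A c = {x \<in> carrier R. \<pi> x \<otimes>\<^bsub>T\<^esub> z = \<pi> x}"
    using A_generator[OF assms] by blast
  from someI_ex[OF this] show "gen c \<in> central_idempotents Br" "A c = {x \<in> carrier R. \<pi> x \<otimes>\<^bsub>T\<^esub> gen c = \<pi> x}"
    unfolding gen_def by blast+
qed

lemma central_idempotents_Br_subset: "central_idempotents Br \<subseteq> central_idempotents T"
proof
  fix e assume e: "e \<in> central_idempotents Br"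
  show "e \<in> central_idempotents T"
  proof (rule U.central_in_B_imp_central)
    show "e \<in> B" "e \<otimes>\<^bsub>T\<^esub> e = e" using Br.central_idempotentsD(1,2)[OF e] by simp_all
    show "e \<otimes>\<^bsub>T\<^esub> x = x \<otimes>\<^bsub>T\<^esub> e" if "x \<in> B" for x
      using Br.central_idempotentsD(3)[OF e, of x] that by simp
  qed
qed

text \<open>The map \<open>gen\<close> sends the larger set injectively into the smaller one, which
  is finite. Surjectivity of \<open>gen\<close> is recorded as well, for
  \<open>P_faithful\<close>.\<close>

lemma central_idempotents_bij:
  "central_idempotents Br = central_idempotents T" "gen ` central_idempotents T = central_idempotents T"
proof -
  let ?C = "central_idempotents T" and ?D = "central_idempotents Br"
  have fin: "finite ?D" using Br.finite_central_idempotents[OF Br_idem_acc] by simp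
  have inj: "inj_on gen ?C"
  proof (rule inj_onI)
    fix c d assume *: "c \<in> ?C" "d \<in> ?C" "gen c = gen d"
    then have "A c = A d" using gen(2) T.S.central_idempotentsD(1) by simp
    then show "c = d" using inj_onD[OF A_inj] * by blast
  qed
  have im: "gen ` ?C \<subseteq> ?D" using gen(1) T.S.central_idempotentsD(1) by blast
  have fC: "finite ?C" by (rule inj_on_finite[OF inj im fin])
  have "card ?C \<le> card ?D" by (rule card_inj_on_le[OF inj im fin])
  then show eq: "?D = ?C" by (rule card_seteq[OF fC central_idempotents_Br_subset])
  show "gen ` ?C = ?C" by (rule endo_inj_surj[OF fC _ inj]) (use im eq in simp)
qed

text \<open>All central idempotents of \<open>T\<close> are now in \<open>B\<close>, so
  \<open>B = T\<close>. Every \<open>m\<close> is the value at \<open>u\<close> of an endomorphism,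
  and \<open>B_iff\<close> says where such values lie.\<close>

lemma generated_by_u:
  assumes m: "m \<in> carrier E"
  shows "\<exists>r\<in>carrier R. m = r \<odot>\<^bsub>E\<^esub> u"
proof -
  have "central_idempotents T \<subseteq> B"
    unfolding central_idempotents_bij(1)[symmetric] using Br.central_idempotentsD(1) by auto
  then have B: "B = carrier T" by (rule U.eq_carrier)
  obtain f where f: "f \<in> carrier S" "f u = m" using extend_u[OF m] by blast
  have "cls f \<in> B" unfolding B using f(1) by simp
  then show ?thesis using B_iff[OF f(1)] f(2) by simp
qed

text \<open>Surjectivity of \<open>gen\<close> provides a central idempotent \<open>c\<close> with
  \<open>gen c = 0\<close>, that is, with \<open>A c = J\<close>; and whatever kills
  \<open>P\<close> lies in \<open>A c\<close>.\<close>

lemma P_faithful: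
  assumes r: "r \<in> carrier R" and kill: "\<And>p. p \<in> P \<Longrightarrow> r \<odot>\<^bsub>E\<^esub> p = \<zero>\<^bsub>E\<^esub>"
  shows "r \<in> J"
proof -
  have "\<zero>\<^bsub>T\<^esub> \<in> gen ` central_idempotents T"
    unfolding central_idempotents_bij(2) by (rule T.S.zero_central_idempotent)
  then obtain c where c: "c \<in> central_idempotents T" "gen c = \<zero>\<^bsub>T\<^esub>" by (rule imageE) simp
  have cT: "c \<in> carrier T" by (rule T.S.central_idempotentsD(1)[OF c(1)])
  have "r \<in> A c" unfolding A_def using r kill P_endo[OF _ rep(1)[OF cT]] by blast
  then have "\<pi> r \<otimes>\<^bsub>T\<^esub> gen c = \<pi> r" using gen(2)[OF cT] by blast
  then have "\<pi> r = \<zero>\<^bsub>T\<^esub>" unfolding c(2) T.S.r_null[OF pi.hom_closed[OF r]] by (rule sym)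
  then show ?thesis using r J_iff by blast
qed

end

section \<open>Descending chains and the opposite ring\<close>

definition left_dcc :: "('a, 'm) ring_scheme \<Rightarrow> bool"
  where "left_dcc R \<longleftrightarrow> (\<forall>C :: nat \<Rightarrow> 'a set. (\<forall>n. left_ideal R (C n) \<and> C (Suc n) \<subseteq> C n) \<longrightarrow>
    (\<exists>k. \<forall>n\<ge>k. C n = C k))"

text \<open>Set complements turn the descending condition into the ascending one.\<close>

lemma left_dcc_minimal:
  assumes dcc: "left_dcc R" and ne: "X0 \<in> F" and F: "\<And>X. X \<in> F \<Longrightarrow> left_ideal R X"
  shows "\<exists>M\<in>F. \<forall>X\<in>F. X \<subseteq> M \<longrightarrow> X = M"
proof -
  have "\<exists>M\<in>uminus ` F. \<forall>X\<in>uminus ` F. M \<subseteq> X \<longrightarrow> X = M"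
  proof (rule acc_maximal)
    fix C :: "nat \<Rightarrow> 'a set" assume C: "\<And>n. C n \<in> uminus ` F \<and> C n \<subseteq> C (Suc n)"
    have "left_ideal R (- C n) \<and> - C (Suc n) \<subseteq> - C n" for n using C[of n] F by auto
    then obtain k where "\<forall>n\<ge>k. - C n = - C k"
      using dcc[unfolded left_dcc_def, rule_format, of "\<lambda>n. - C n"] by blast
    then show "\<exists>k. \<forall>n\<ge>k. C n = C k" by auto
  qed (use ne in blast)
  then show ?thesis by auto
qed

lemma antitone_sequence_le:
  fixes C :: "nat \<Rightarrow> 'a set"
  assumes "\<And>n. C (Suc n) \<subseteq> C n" "m \<le> n"
  shows "C n \<subseteq> C m"
  using lift_Suc_antimono_le[of C, OF assms(1) assms(2)] .

text \<open>
  A maximal left ideal \<open>X\<close> with the descending chain condition below it is the whole ring: otherwise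
  some \<open>Y\<close> covers \<open>X\<close>, as \<open>R/X\<close> has a simple submodule when \<open>R/J\<close> is semisimple and \<open>J\<close> is nilpotent.
\<close>

lemma (in ring) left_acc_imp_left_dcc:
  assumes J: "ideal J R"
    and nil: "\<And>X. left_ideal R X \<Longrightarrow> X \<noteq> carrier R \<Longrightarrow> \<exists>m\<in>carrier R. m \<notin> X \<and> (\<forall>j\<in>J. j \<otimes> m \<in> X)"
    and compl: "\<And>L. left_ideal R L \<Longrightarrow> J \<subseteq> L \<Longrightarrow> \<exists>e\<in>carrier R. \<one> \<ominus> e \<in> L \<and> (\<forall>x\<in>L. x \<otimes> e \<in> J)"
    and acc: "left_acc R"
  shows "left_dcc R"
proof -
  have Jc: "\<And>x. x \<in> J \<Longrightarrow> x \<in> carrier R" using ideal.Icarr[OF J] .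
  define D where "D X \<longleftrightarrow> left_ideal R X \<and> (\<forall>C :: nat \<Rightarrow> 'a set.
    (\<forall>n. left_ideal R (C n) \<and> C n \<subseteq> X \<and> C (Suc n) \<subseteq> C n) \<longrightarrow> (\<exists>k. \<forall>n\<ge>k. C n = C k))" for X
  have "D {\<zero>}"
    unfolding D_def
  proof (intro conjI allI impI)
    show "left_ideal R {\<zero>}" unfolding left_ideal_def by auto
    fix C :: "nat \<Rightarrow> 'a set" assume *: "\<forall>n. left_ideal R (C n) \<and> C n \<subseteq> {\<zero>} \<and> C (Suc n) \<subseteq> C n"
    have "C n = {\<zero>}" for n using *[rule_format, of n] unfolding left_ideal_def by blast
    then show "\<exists>k. \<forall>n\<ge>k. C n = C k" by simp
  qed
  then have "{\<zero>} \<in> Collect D" by simp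
  from left_acc_maximal[OF acc this] obtain X where X: "D X" and Xmax: "\<And>Y. D Y \<Longrightarrow> X \<subseteq> Y \<Longrightarrow> Y = X"
    unfolding D_def by auto
  have lX: "left_ideal R X" using X unfolding D_def by blast
  have X': "\<And>x. x \<in> X \<Longrightarrow> x \<in> carrier R" "\<zero> \<in> X" "\<And>x y. x \<in> X \<Longrightarrow> y \<in> X \<Longrightarrow> x \<oplus> y \<in> X"
    "\<And>r x. r \<in> carrier R \<Longrightarrow> x \<in> X \<Longrightarrow> r \<otimes> x \<in> X"
    using lX unfolding left_ideal_def by auto
  have "X = carrier R"
  proof (rule ccontr)
    assume "X \<noteq> carrier R"
    then obtain m where m: "m \<in> carrier R" "m \<notin> X" "\<And>j. j \<in> J \<Longrightarrow> j \<otimes> m \<in> X" using nil[OF lX] by blast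
    \<comment> \<open>The annihilator of \<open>m\<close> modulo \<open>X\<close>, which contains
      \<open>J\<close>. If \<open>e\<close> is a complement of a maximal left ideal \<open>K\<close>
      above it, then \<open>y = e m\<close> generates a simple module modulo
      \<open>X\<close>.\<close>
    define L where "L = {r \<in> carrier R. r \<otimes> m \<in> X}"
    have L: "left_ideal R L"
      unfolding left_ideal_def L_def using m(1) X' by (auto simp: l_distr m_assoc)
    have "L \<in> {K. left_ideal R K \<and> L \<subseteq> K \<and> \<one> \<notin> K}" using L m by (simp add: L_def)
    from left_acc_maximal[OF acc this] obtain K where
      KF: "K \<in> {K. left_ideal R K \<and> L \<subseteq> K \<and> \<one> \<notin> K}"
      "\<forall>Y\<in>{K. left_ideal R K \<and> L \<subseteq> K \<and> \<one> \<notin> K}. K \<subseteq> Y \<longrightarrow> Y = K" by auto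
    have K: "left_ideal R K" "L \<subseteq> K" "\<one> \<notin> K" using KF(1) by auto
    have Kmax: "Y = K" if "left_ideal R Y" "\<one> \<notin> Y" "K \<subseteq> Y" for Y using KF(2) K(2) that by auto
    have K': "\<And>x. x \<in> K \<Longrightarrow> x \<in> carrier R" "\<zero> \<in> K" "\<And>x y. x \<in> K \<Longrightarrow> y \<in> K \<Longrightarrow> x \<oplus> y \<in> K"
      "\<And>r x. r \<in> carrier R \<Longrightarrow> x \<in> K \<Longrightarrow> r \<otimes> x \<in> K"
      using K(1) unfolding left_ideal_def by auto
    have JK: "J \<subseteq> K" using m(3) Jc K(2) unfolding L_def by blast
    obtain e where e: "e \<in> carrier R" "\<one> \<ominus> e \<in> K" "\<And>x. x \<in> K \<Longrightarrow> x \<otimes> e \<in> J"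
      using compl[OF K(1) JK] by blast
    have "e \<notin> K"
    proof
      assume "e \<in> K"
      from K'(3)[OF this e(2)] show False using K(3) add_compl[OF e(1)] by simp
    qed
    define y where "y = e \<otimes> m"
    have y: "y \<in> carrier R" "y \<notin> X" using e(1) m(1) \<open>e \<notin> K\<close> K(2) unfolding y_def L_def by auto
    have ee: "(\<one> \<ominus> e) \<otimes> e \<in> J" by (rule e(3)[OF e(2)])
    \<comment> \<open>As \<open>e\<close> is idempotent only modulo \<open>J\<close>, the elements
      \<open>y\<close> and \<open>e y\<close> differ by an element of \<open>J m\<close>, which lies
      in \<open>X\<close>.\<close>
    have split: "r \<otimes> y = r \<otimes> e \<otimes> y \<oplus> r \<otimes> ((\<one> \<ominus> e) \<otimes> e) \<otimes> m" if r: "r \<in> carrier R" for r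
    proof -
      have "r \<otimes> e \<otimes> y \<oplus> r \<otimes> ((\<one> \<ominus> e) \<otimes> e) \<otimes> m = r \<otimes> (e \<oplus> (\<one> \<ominus> e)) \<otimes> (e \<otimes> m)"
        using r e(1) m(1) unfolding y_def by (simp add: l_distr r_distr m_assoc)
      then show ?thesis using r e(1) m(1) add_compl[OF e(1)] unfolding y_def by simp
    qed
    have tail: "r \<otimes> ((\<one> \<ominus> e) \<otimes> e) \<otimes> m \<in> X" if r: "r \<in> carrier R" for r
      by (rule m(3)[OF ideal.I_l_closed[OF J ee r]])
    have simple: "\<exists>s\<in>carrier R. \<exists>x\<in>X. y = s \<otimes> (r \<otimes> y) \<oplus> x" if r: "r \<in> carrier R" "r \<otimes> y \<notin> X" for r
    proof -
      have re: "r \<otimes> e \<in> carrier R" using r e by simp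
      have reK: "r \<otimes> e \<notin> K"
      proof
        assume "r \<otimes> e \<in> K"
        then have "r \<otimes> e \<otimes> e \<otimes> m \<in> X" using m(3) e(3) by blast
        then have "r \<otimes> e \<otimes> y \<in> X" using r e(1) m(1) by (simp add: y_def m_assoc)
        then show False using split[OF r(1)] tail[OF r(1)] X'(3) r(2) by simp
      qed
      let ?Y = "{a \<oplus> b |a b. a \<in> K \<and> b \<in> {s \<otimes> (r \<otimes> e) |s. s \<in> carrier R}}"
      note sum = left_ideal_sum[OF K(1) left_ideal_principal(1)[OF re]]
      have "?Y \<noteq> K" using sum(3) left_ideal_principal(2)[OF re] reK by blast
      then have "\<one> \<in> ?Y" using Kmax[OF sum(1) _ sum(2)] by blast
      then obtain k s where ks: "k \<in> K" "s \<in> carrier R" "\<one> = k \<oplus> s \<otimes> (r \<otimes> e)" by blast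
      have kc: "k \<in> carrier R" using K'(1) ks by blast
      have "y = (k \<oplus> s \<otimes> (r \<otimes> e)) \<otimes> y" unfolding ks(3)[symmetric] using y by simp
      also have "\<dots> = k \<otimes> y \<oplus> s \<otimes> (r \<otimes> e \<otimes> y)" using kc ks(2) re y r(1) e(1) by (simp add: l_distr m_assoc)
      finally have y1: "y = k \<otimes> y \<oplus> s \<otimes> (r \<otimes> e \<otimes> y)" .
      define t where "t = r \<otimes> ((\<one> \<ominus> e) \<otimes> e) \<otimes> m"
      have t: "t \<in> X" unfolding t_def by (rule tail[OF r(1)])
      have "r \<otimes> e \<otimes> y = r \<otimes> y \<oplus> \<ominus> t"
        unfolding split[OF r(1)] t_def[symmetric] using X'(1)[OF t] re y by (simp add: a_assoc r_neg)
      then have "s \<otimes> (r \<otimes> e \<otimes> y) = s \<otimes> (r \<otimes> y) \<oplus> s \<otimes> (\<ominus> t)"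
        using ks(2) r(1) y X'(1)[OF t] by (simp add: r_distr)
      then have y2: "y = k \<otimes> y \<oplus> (s \<otimes> (r \<otimes> y) \<oplus> s \<otimes> (\<ominus> t))" using y1 by simp
      have "k \<otimes> y \<oplus> (s \<otimes> (r \<otimes> y) \<oplus> s \<otimes> (\<ominus> t)) = s \<otimes> (r \<otimes> y) \<oplus> (s \<otimes> (\<ominus> t) \<oplus> k \<otimes> y)"
        using ks(2) r(1) y(1) X'(1)[OF t] kc by (simp add: a_ac)
      from trans[OF y2 this] have "y = s \<otimes> (r \<otimes> y) \<oplus> (s \<otimes> (\<ominus> t) \<oplus> k \<otimes> y)" .
      moreover have "k \<otimes> y \<in> X"
        using m(3)[OF e(3)[OF ks(1)]] kc e(1) m(1) by (simp add: y_def m_assoc)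
      then have "s \<otimes> (\<ominus> t) \<oplus> k \<otimes> y \<in> X" using X'(3,4) left_ideal_a_inv[OF lX t] ks(2) by blast
      ultimately show ?thesis using ks(2) by blast
    qed
    define Y where "Y = {a \<oplus> b |a b. a \<in> X \<and> b \<in> {r \<otimes> y |r. r \<in> carrier R}}"
    note sum = left_ideal_sum[OF lX left_ideal_principal(1)[OF y(1)], folded Y_def]
    have lY: "left_ideal R Y" and XY: "X \<subseteq> Y" and yY: "y \<in> Y"
      using sum left_ideal_principal(2)[OF y(1)] by blast+
    have "D Y"
      unfolding D_def
    proof (intro conjI allI impI lY)
      fix C :: "nat \<Rightarrow> 'a set" assume C: "\<forall>n. left_ideal R (C n) \<and> C n \<subseteq> Y \<and> C (Suc n) \<subseteq> C n"
      have mono: "C n \<subseteq> C k" if "k \<le> n" for k n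
        by (rule antitone_sequence_le[OF _ that]) (use C in blast)
      have "left_ideal R (C n \<inter> X) \<and> C n \<inter> X \<subseteq> X \<and> C (Suc n) \<inter> X \<subseteq> C n \<inter> X" for n
        using C[rule_format, of n] lX unfolding left_ideal_def by blast
      then obtain k where k: "\<And>n. n \<ge> k \<Longrightarrow> C n \<inter> X = C k \<inter> X"
        using conjunct2[OF X[unfolded D_def], rule_format, of "\<lambda>n. C n \<inter> X"] by blast
      show "\<exists>k. \<forall>n\<ge>k. C n = C k"
      proof (cases "\<exists>n. C n \<subseteq> X")
        case True
        then obtain n where n: "C n \<subseteq> X" by blast
        have "C i = C (max n k)" if i: "i \<ge> max n k" for i
        proof -
          have "C i \<subseteq> X" "C (max n k) \<subseteq> X" using mono[of n i] mono[of n "max n k"] n i by auto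
          moreover have "C i \<inter> X = C (max n k) \<inter> X" using k[of i] k[of "max n k"] i by simp
          ultimately show ?thesis by blast
        qed
        then show ?thesis by blast
      next
        case False
        \<comment> \<open>No member of the chain lies in \<open>X\<close>, so by simplicity of
          \<open>Y/X\<close> each one spans \<open>Y\<close> together with \<open>X\<close>. The
          modular law then compares \<open>C k\<close> with \<open>C n\<close>, whose intersections
          with \<open>X\<close> agree.\<close>
        have "C k \<subseteq> C n" if n: "n \<ge> k" for n
        proof
          fix c assume c: "c \<in> C k"
          have lC: "left_ideal R (C n)" "C n \<subseteq> Y" "left_ideal R (C k)" "C k \<subseteq> Y" using C by blast+
          have C': "\<And>x. x \<in> C n \<Longrightarrow> x \<in> carrier R" "\<And>x y. x \<in> C n \<Longrightarrow> y \<in> C n \<Longrightarrow> x \<oplus> y \<in> C n"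
            "\<And>r x. r \<in> carrier R \<Longrightarrow> x \<in> C n \<Longrightarrow> r \<otimes> x \<in> C n"
            using lC(1) unfolding left_ideal_def by auto
          have Ck: "\<And>x y. x \<in> C k \<Longrightarrow> y \<in> C k \<Longrightarrow> x \<oplus> y \<in> C k" using lC(3) unfolding left_ideal_def by auto
          obtain z where z: "z \<in> C n" "z \<notin> X" using False by blast
          then obtain x r where xr: "x \<in> X" "r \<in> carrier R" "z = x \<oplus> r \<otimes> y" using lC(2) unfolding Y_def by blast
          have "r \<otimes> y \<notin> X" using xr z(2) X'(3) by auto
          then obtain s x1 where s: "s \<in> carrier R" "x1 \<in> X" "y = s \<otimes> (r \<otimes> y) \<oplus> x1" using simple[OF xr(2)] by blast
          obtain x2 t where t: "x2 \<in> X" "t \<in> carrier R" "c = x2 \<oplus> t \<otimes> y" using c lC(4) unfolding Y_def by blast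
          define w where "w = t \<otimes> (s \<otimes> z)"
          have w: "w \<in> C n" unfolding w_def by (intro C'(3) z(1) s(1) t(2))
          have xc: "x \<in> carrier R" "x1 \<in> carrier R" "x2 \<in> carrier R" using X'(1) xr(1) s(2) t(1) by auto
          have zc: "z \<in> carrier R" using C'(1) z(1) by blast
          have "r \<otimes> y = z \<oplus> \<ominus> x" using xr(2,3) xc(1) y(1) by (simp add: a_ac r_neg r_neg1 r_neg2)
          then have "y = s \<otimes> (z \<oplus> \<ominus> x) \<oplus> x1" using s(3) by simp
          then have "t \<otimes> y = t \<otimes> (s \<otimes> (z \<oplus> \<ominus> x) \<oplus> x1)" by simp
          also have "\<dots> = w \<oplus> (t \<otimes> (s \<otimes> \<ominus> x) \<oplus> t \<otimes> x1)"
            unfolding w_def using t(2) s(1) zc xc by (simp add: r_distr a_assoc)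
          finally have ty: "t \<otimes> y = w \<oplus> (t \<otimes> (s \<otimes> \<ominus> x) \<oplus> t \<otimes> x1)" .
          define x3 where "x3 = x2 \<oplus> (t \<otimes> (s \<otimes> \<ominus> x) \<oplus> t \<otimes> x1)"
          have x3: "x3 \<in> X"
            unfolding x3_def
            by (intro X'(3) X'(4) t(1,2) s(1,2) left_ideal_a_inv[OF lX xr(1)])
          have wc: "w \<in> carrier R" using w C'(1) by blast
          have vc: "t \<otimes> (s \<otimes> \<ominus> x) \<oplus> t \<otimes> x1 \<in> carrier R" using t(2) s(1) xc by simp
          have cw: "c = w \<oplus> x3"
            unfolding t(3) ty x3_def by (rule a_lcomm[OF xc(3) wc vc])
          have "\<ominus> w \<in> C k" using left_ideal_a_inv[OF lC(3)] w mono[OF n] by blast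
          then have "\<ominus> w \<oplus> c \<in> C k" using Ck c by blast
          then have "x3 \<in> C k" unfolding cw using r_neg1[OF wc X'(1)[OF x3]] by simp
          then have "x3 \<in> C n" using k[OF n] x3 by blast
          then show "c \<in> C n" unfolding cw using C'(2) w by blast
        qed
        then show ?thesis using mono by blast
      qed
    qed
    from Xmax[OF this XY] show False using yY y(2) by blast
  qed
  then have D: "D (carrier R)" using X by simp
  show ?thesis
    unfolding left_dcc_def
  proof (intro allI impI)
    fix C :: "nat \<Rightarrow> 'a set" assume C: "\<forall>n. left_ideal R (C n) \<and> C (Suc n) \<subseteq> C n"
    then have "\<forall>n. left_ideal R (C n) \<and> C n \<subseteq> carrier R \<and> C (Suc n) \<subseteq> C n"
      unfolding left_ideal_def by blast
    then show "\<exists>k. \<forall>n\<ge>k. C n = C k" using D unfolding D_def by blast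
  qed
qed

section \<open>Opposite rings and chain conditions of the regular module\<close>

lemma left_acc_opposite [simp]: "left_acc (opposite_ring R) \<longleftrightarrow> right_acc R"
  unfolding left_acc_def right_acc_def by simp

lemma (in ring) minus_opposite: "x \<in> carrier R \<Longrightarrow> y \<in> carrier R \<Longrightarrow> x \<ominus>\<^bsub>opposite_ring R\<^esub> y = x \<ominus> y"
  by (simp add: a_minus_def a_inv_def)

lemma (in ring) submodule_regular_module: "submodule L R (regular_module R) \<longleftrightarrow> left_ideal R L"
  unfolding left_module.submodule_iff[OF regular_left_module] left_ideal_def
  by (simp add: regular_module_def)

lemma (in ring) left_noetherian_imp_left_acc: "left_noetherian R \<Longrightarrow> left_acc R"
  unfolding left_noetherian_def noetherian_module_def left_acc_def submodule_regular_module by blast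

lemma (in ring) left_dcc_imp_left_artinian: "left_dcc R \<Longrightarrow> left_artinian R"
  unfolding left_artinian_def artinian_module_def left_dcc_def submodule_regular_module
  using regular_left_module by blast

section \<open>Baer's criterion\<close>

text \<open>Zorn's lemma gives a maximal partial extension, kept as a graph \<open>G\<close>. If it
  missed some \<open>b\<close>, its values on the multiples of \<open>b\<close> that it does reach
  would be those of a map on a left ideal, and by \<open>baer\<close> the assignment of
  \<open>m\<close> to \<open>b\<close> would prolong it.\<close>

lemma baer_criterion:
  fixes R :: "('a, 'm) ring_scheme" and M :: "('a, 'b, 'n) module_scheme"
  assumes lM: "left_module R M"
    and baer: "\<And>L k. left_ideal R L \<Longrightarrow> (\<And>x. x \<in> L \<Longrightarrow> k x \<in> carrier M) \<Longrightarrow>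
      (\<And>x y. x \<in> L \<Longrightarrow> y \<in> L \<Longrightarrow> k (x \<oplus>\<^bsub>R\<^esub> y) = k x \<oplus>\<^bsub>M\<^esub> k y) \<Longrightarrow>
      (\<And>r x. r \<in> carrier R \<Longrightarrow> x \<in> L \<Longrightarrow> k (r \<otimes>\<^bsub>R\<^esub> x) = r \<odot>\<^bsub>M\<^esub> k x) \<Longrightarrow>
      \<exists>m\<in>carrier M. \<forall>x\<in>L. k x = x \<odot>\<^bsub>M\<^esub> m"
  shows "injective_module TYPE('c) R M"
  unfolding injective_module_def
proof (intro conjI lM allI impI, elim conjE)
  interpret M: left_module R M by fact
  fix A B :: "('a, 'c) module" and i f
  assume lA: "left_module R A" and lB: "left_module R B" and i: "i \<in> module_homs R A B"
    and inj: "inj_on i (carrier A)" and f: "f \<in> module_homs R A M"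
  interpret A: left_module R A by fact
  interpret B: left_module R B by fact
  define lin where "lin G \<longleftrightarrow> G \<subseteq> carrier B \<times> carrier M \<and> (\<zero>\<^bsub>B\<^esub>, \<zero>\<^bsub>M\<^esub>) \<in> G \<and>
    (\<forall>x p y q. (x, p) \<in> G \<longrightarrow> (y, q) \<in> G \<longrightarrow> (x \<oplus>\<^bsub>B\<^esub> y, p \<oplus>\<^bsub>M\<^esub> q) \<in> G) \<and>
    (\<forall>r x p. r \<in> carrier R \<longrightarrow> (x, p) \<in> G \<longrightarrow> (r \<odot>\<^bsub>B\<^esub> x, r \<odot>\<^bsub>M\<^esub> p) \<in> G)" for G
  \<comment> \<open>For a linear relation it is enough to ask single-valuedness at zero.\<close>
  define fn where "fn G \<longleftrightarrow> (\<forall>p. (\<zero>\<^bsub>B\<^esub>, p) \<in> G \<longrightarrow> p = \<zero>\<^bsub>M\<^esub>)" for G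
  have linD: "x \<in> carrier B" "p \<in> carrier M" if "lin G" "(x, p) \<in> G" for G x p
    using that unfolding lin_def by auto
  have lin_add: "(x \<oplus>\<^bsub>B\<^esub> y, p \<oplus>\<^bsub>M\<^esub> q) \<in> G" if "lin G" "(x, p) \<in> G" "(y, q) \<in> G" for G x y p q
    using that unfolding lin_def by blast
  have lin_smult: "(r \<odot>\<^bsub>B\<^esub> x, r \<odot>\<^bsub>M\<^esub> p) \<in> G" if "lin G" "r \<in> carrier R" "(x, p) \<in> G" for G r x p
    using that unfolding lin_def by blast
  have lin_minus: "(\<ominus>\<^bsub>B\<^esub> x, \<ominus>\<^bsub>M\<^esub> p) \<in> G" if "lin G" "(x, p) \<in> G" for G x p
    using lin_smult[OF that(1) _ that(2), of "\<ominus>\<^bsub>R\<^esub> \<one>\<^bsub>R\<^esub>"] linD[OF that]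
    by (simp add: B.smult_minus_one M.smult_minus_one)
  have fn_eq: "p = q" if "lin G" "fn G" "(x, p) \<in> G" "(x, q) \<in> G" for G x p q
  proof -
    note c = linD[OF that(1,3)] linD[OF that(1,4)]
    have "(x \<oplus>\<^bsub>B\<^esub> \<ominus>\<^bsub>B\<^esub> x, p \<oplus>\<^bsub>M\<^esub> \<ominus>\<^bsub>M\<^esub> q) \<in> G"
      by (rule lin_add[OF that(1,3) lin_minus[OF that(1,4)]])
    then have "p \<oplus>\<^bsub>M\<^esub> \<ominus>\<^bsub>M\<^esub> q = \<zero>\<^bsub>M\<^esub>" using that(2) c unfolding fn_def by (simp add: B.M.r_neg)
    then show ?thesis using c M.M.minus_equality[of p "\<ominus>\<^bsub>M\<^esub> q"] by simp
  qed
  let ?G0 = "(\<lambda>a. (i a, f a)) ` carrier A"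
  let ?F = "{G. lin G \<and> fn G \<and> ?G0 \<subseteq> G}"
  have "?G0 \<in> ?F"
  proof -
    have "(\<zero>\<^bsub>B\<^esub>, \<zero>\<^bsub>M\<^esub>) = (i \<zero>\<^bsub>A\<^esub>, f \<zero>\<^bsub>A\<^esub>)"
      using module_homs_zero[OF i lA lB] module_homs_zero[OF f lA lM] by simp
    then have "(\<zero>\<^bsub>B\<^esub>, \<zero>\<^bsub>M\<^esub>) \<in> ?G0" by blast
    moreover have "(x \<oplus>\<^bsub>B\<^esub> y, p \<oplus>\<^bsub>M\<^esub> q) \<in> ?G0" if xy: "(x, p) \<in> ?G0" "(y, q) \<in> ?G0" for x p y q
    proof -
      obtain a b where *: "a \<in> carrier A" "b \<in> carrier A" "x = i a" "p = f a" "y = i b" "q = f b"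
        using xy by blast
      then show ?thesis
        using module_homsD(2)[OF i *(1,2)] module_homsD(2)[OF f *(1,2)]
        by (intro image_eqI[of _ _ "a \<oplus>\<^bsub>A\<^esub> b"]) auto
    qed
    moreover have "(r \<odot>\<^bsub>B\<^esub> x, r \<odot>\<^bsub>M\<^esub> p) \<in> ?G0" if r: "r \<in> carrier R" and x: "(x, p) \<in> ?G0" for r x p
    proof -
      obtain a where *: "a \<in> carrier A" "x = i a" "p = f a" using x by blast
      then show ?thesis
        using module_homsD(3)[OF i r *(1)] module_homsD(3)[OF f r *(1)] r
        by (intro image_eqI[of _ _ "r \<odot>\<^bsub>A\<^esub> a"]) auto
    qed
    moreover have "?G0 \<subseteq> carrier B \<times> carrier M" using module_homsD(1)[OF i] module_homsD(1)[OF f] by auto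
    ultimately have "lin ?G0" unfolding lin_def by blast
    moreover have "fn ?G0"
      unfolding fn_def
    proof (intro allI impI)
      fix p assume "(\<zero>\<^bsub>B\<^esub>, p) \<in> ?G0"
      then obtain a where a: "a \<in> carrier A" "i a = i \<zero>\<^bsub>A\<^esub>" "p = f a"
        using module_homs_zero[OF i lA lB] by auto
      have "a = \<zero>\<^bsub>A\<^esub>" by (rule inj_onD[OF inj a(2,1)]) simp
      then show "p = \<zero>\<^bsub>M\<^esub>" using a(3) module_homs_zero[OF f lA lM] by simp
    qed
    ultimately show ?thesis by blast
  qed
  moreover have "\<Union>\<C> \<in> ?F" if ne: "\<C> \<noteq> {}" and ch: "subset.chain ?F \<C>" for \<C>
  proof -
    have F: "lin G" "fn G" "?G0 \<subseteq> G" if "G \<in> \<C>" for G using ch that unfolding subset.chain_def by auto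
    have two: "\<exists>G\<in>\<C>. v \<in> G \<and> w \<in> G" if "v \<in> \<Union>\<C>" "w \<in> \<Union>\<C>" for v w
      using that ch unfolding subset.chain_def by blast
    have "lin (\<Union>\<C>)"
      unfolding lin_def
    proof (intro conjI allI impI)
      show "\<Union>\<C> \<subseteq> carrier B \<times> carrier M" using F(1) unfolding lin_def by blast
      show "(\<zero>\<^bsub>B\<^esub>, \<zero>\<^bsub>M\<^esub>) \<in> \<Union>\<C>" using F(1) ne unfolding lin_def by blast
      show "(x \<oplus>\<^bsub>B\<^esub> y, p \<oplus>\<^bsub>M\<^esub> q) \<in> \<Union>\<C>" if "(x, p) \<in> \<Union>\<C>" "(y, q) \<in> \<Union>\<C>" for x p y q
        using two[OF that] lin_add[OF F(1)] by blast
      show "(r \<odot>\<^bsub>B\<^esub> x, r \<odot>\<^bsub>M\<^esub> p) \<in> \<Union>\<C>" if "r \<in> carrier R" "(x, p) \<in> \<Union>\<C>" for r x p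
        using that lin_smult[OF F(1)] by blast
    qed
    moreover have "fn (\<Union>\<C>)" using F(2) unfolding fn_def by blast
    ultimately show ?thesis using F(3) ne by blast
  qed
  ultimately obtain G where GF: "G \<in> ?F" and Gmax: "\<forall>H\<in>?F. G \<subseteq> H \<longrightarrow> H = G"
    using subset_Zorn_nonempty[of ?F] by blast
  have G: "lin G" "fn G" "?G0 \<subseteq> G" using GF by auto
  have total: "\<exists>p. (b, p) \<in> G" if b: "b \<in> carrier B" for b
  proof -
    define L where "L = {r \<in> carrier R. \<exists>p. (r \<odot>\<^bsub>B\<^esub> b, p) \<in> G}"
    define k where "k r = (SOME p. (r \<odot>\<^bsub>B\<^esub> b, p) \<in> G)" for r
    have kG: "(r \<odot>\<^bsub>B\<^esub> b, k r) \<in> G" if "r \<in> L" for r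
      unfolding k_def by (rule someI_ex) (use that in \<open>simp add: L_def\<close>)
    have k_eq: "k r = p" if "r \<in> L" "(r \<odot>\<^bsub>B\<^esub> b, p) \<in> G" for r p
      by (rule fn_eq[OF G(1,2) kG[OF that(1)] that(2)])
    have Lc: "r \<in> carrier R" if "r \<in> L" for r using that by (simp add: L_def)
    have addG: "((r \<oplus>\<^bsub>R\<^esub> s) \<odot>\<^bsub>B\<^esub> b, k r \<oplus>\<^bsub>M\<^esub> k s) \<in> G" if "r \<in> L" "s \<in> L" for r s
      using lin_add[OF G(1) kG[OF that(1)] kG[OF that(2)]] Lc that b by (simp add: B.smult_l_distr)
    have smG: "((s \<otimes>\<^bsub>R\<^esub> r) \<odot>\<^bsub>B\<^esub> b, s \<odot>\<^bsub>M\<^esub> k r) \<in> G" if "s \<in> carrier R" "r \<in> L" for r s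
      using lin_smult[OF G(1) that(1) kG[OF that(2)]] Lc that b by (simp add: B.smult_assoc1)
    have "(\<zero>\<^bsub>R\<^esub> \<odot>\<^bsub>B\<^esub> b, \<zero>\<^bsub>M\<^esub>) \<in> G" using G(1) B.smult_l_null[OF b] unfolding lin_def by simp
    then have L0: "\<zero>\<^bsub>R\<^esub> \<in> L" by (auto simp: L_def)
    have Ladd: "r \<oplus>\<^bsub>R\<^esub> s \<in> L" if "r \<in> L" "s \<in> L" for r s
      using addG[OF that] Lc that by (auto simp: L_def)
    have Lsm: "s \<otimes>\<^bsub>R\<^esub> r \<in> L" if "s \<in> carrier R" "r \<in> L" for r s
      using smG[OF that] Lc that by (auto simp: L_def)
    have "\<exists>m\<in>carrier M. \<forall>x\<in>L. k x = x \<odot>\<^bsub>M\<^esub> m"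
    proof (rule baer)
      show "left_ideal R L" unfolding left_ideal_def using Lc L0 Ladd Lsm by blast
      show "k x \<in> carrier M" if "x \<in> L" for x by (rule linD(2)[OF G(1) kG[OF that]])
      show "k (x \<oplus>\<^bsub>R\<^esub> y) = k x \<oplus>\<^bsub>M\<^esub> k y" if "x \<in> L" "y \<in> L" for x y
        by (rule k_eq[OF Ladd[OF that] addG[OF that]])
      show "k (r \<otimes>\<^bsub>R\<^esub> x) = r \<odot>\<^bsub>M\<^esub> k x" if "r \<in> carrier R" "x \<in> L" for r x
        by (rule k_eq[OF Lsm[OF that] smG[OF that]])
    qed
    then obtain m where m: "m \<in> carrier M" "\<And>x. x \<in> L \<Longrightarrow> k x = x \<odot>\<^bsub>M\<^esub> m" by blast
    define H where "H = {(x \<oplus>\<^bsub>B\<^esub> r \<odot>\<^bsub>B\<^esub> b, p \<oplus>\<^bsub>M\<^esub> r \<odot>\<^bsub>M\<^esub> m) |x p r. (x, p) \<in> G \<and> r \<in> carrier R}"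
    have HI: "(y, q) \<in> H" if "(x, p) \<in> G" "r \<in> carrier R" "y = x \<oplus>\<^bsub>B\<^esub> r \<odot>\<^bsub>B\<^esub> b" "q = p \<oplus>\<^bsub>M\<^esub> r \<odot>\<^bsub>M\<^esub> m"
      for x p r y q using that unfolding H_def by blast
    have HE: "\<exists>x p r. (x, p) \<in> G \<and> r \<in> carrier R \<and> y = x \<oplus>\<^bsub>B\<^esub> r \<odot>\<^bsub>B\<^esub> b \<and> q = p \<oplus>\<^bsub>M\<^esub> r \<odot>\<^bsub>M\<^esub> m"
      if "(y, q) \<in> H" for y q using that unfolding H_def by blast
    have GH: "G \<subseteq> H"
    proof clarify
      fix x p assume xp: "(x, p) \<in> G"
      show "(x, p) \<in> H"
        by (rule HI[OF xp M.R.zero_closed])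
           (use linD[OF G(1) xp] b m(1) in \<open>simp_all add: B.smult_l_null M.smult_l_null\<close>)
    qed
    have "lin H"
      unfolding lin_def
    proof (intro conjI allI impI)
      show "H \<subseteq> carrier B \<times> carrier M" unfolding H_def using linD[OF G(1)] b m(1) by auto
      show "(\<zero>\<^bsub>B\<^esub>, \<zero>\<^bsub>M\<^esub>) \<in> H" using G(1) GH unfolding lin_def by blast
    next
      fix x p y q assume xy: "(x, p) \<in> H" "(y, q) \<in> H"
      obtain v v' r where *: "(v, v') \<in> G" "r \<in> carrier R" "x = v \<oplus>\<^bsub>B\<^esub> r \<odot>\<^bsub>B\<^esub> b" "p = v' \<oplus>\<^bsub>M\<^esub> r \<odot>\<^bsub>M\<^esub> m"
        using HE[OF xy(1)] by blast
      obtain w w' s where **: "(w, w') \<in> G" "s \<in> carrier R" "y = w \<oplus>\<^bsub>B\<^esub> s \<odot>\<^bsub>B\<^esub> b" "q = w' \<oplus>\<^bsub>M\<^esub> s \<odot>\<^bsub>M\<^esub> m"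
        using HE[OF xy(2)] by blast
      note c = linD[OF G(1) *(1)] linD[OF G(1) **(1)]
      show "(x \<oplus>\<^bsub>B\<^esub> y, p \<oplus>\<^bsub>M\<^esub> q) \<in> H"
        by (rule HI[OF lin_add[OF G(1) *(1) **(1)] M.R.a_closed[OF *(2) **(2)]])
           (use c * ** b m(1) in \<open>simp_all add: B.smult_l_distr B.M.a_ac M.smult_l_distr M.M.a_ac\<close>)
    next
      fix t x p assume t: "t \<in> carrier R" and x: "(x, p) \<in> H"
      obtain v v' r where *: "(v, v') \<in> G" "r \<in> carrier R" "x = v \<oplus>\<^bsub>B\<^esub> r \<odot>\<^bsub>B\<^esub> b" "p = v' \<oplus>\<^bsub>M\<^esub> r \<odot>\<^bsub>M\<^esub> m"
        using HE[OF x] by blast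
      note c = linD[OF G(1) *(1)]
      show "(t \<odot>\<^bsub>B\<^esub> x, t \<odot>\<^bsub>M\<^esub> p) \<in> H"
        by (rule HI[OF lin_smult[OF G(1) t *(1)] M.R.m_closed[OF t *(2)]])
           (use c * t b m(1) in \<open>simp_all add: B.smult_r_distr B.smult_assoc1 M.smult_r_distr M.smult_assoc1\<close>)
    qed
    moreover have "fn H"
      unfolding fn_def
    proof (intro allI impI)
      fix p assume "(\<zero>\<^bsub>B\<^esub>, p) \<in> H"
      then obtain v v' r where *: "(v, v') \<in> G" "r \<in> carrier R" "\<zero>\<^bsub>B\<^esub> = v \<oplus>\<^bsub>B\<^esub> r \<odot>\<^bsub>B\<^esub> b"
        "p = v' \<oplus>\<^bsub>M\<^esub> r \<odot>\<^bsub>M\<^esub> m" using HE by blast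
      note c = linD[OF G(1) *(1)]
      have "\<ominus>\<^bsub>B\<^esub> v = r \<odot>\<^bsub>B\<^esub> b"
        using c(1) *(2,3) b by (intro B.M.minus_equality) (simp_all add: B.M.a_comm)
      then have g: "(r \<odot>\<^bsub>B\<^esub> b, \<ominus>\<^bsub>M\<^esub> v') \<in> G" using lin_minus[OF G(1) *(1)] by simp
      then have rL: "r \<in> L" using *(2) by (auto simp: L_def)
      have "r \<odot>\<^bsub>M\<^esub> m = \<ominus>\<^bsub>M\<^esub> v'" using m(2)[OF rL] k_eq[OF rL g] by simp
      then show "p = \<zero>\<^bsub>M\<^esub>" using *(4) c(2) by (simp add: M.M.r_neg)
    qed
    ultimately have "H = G" using Gmax GH G(3) by blast
    moreover have "(b, m) \<in> H"
      by (rule HI[of "\<zero>\<^bsub>B\<^esub>" "\<zero>\<^bsub>M\<^esub>" "\<one>\<^bsub>R\<^esub>"]) (use G(1) b m(1) in \<open>simp_all add: lin_def\<close>)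
    ultimately show ?thesis by blast
  qed
  define g where "g x = (SOME p. (x, p) \<in> G)" for x
  have gG: "(x, g x) \<in> G" if "x \<in> carrier B" for x
    unfolding g_def by (rule someI_ex[OF total[OF that]])
  have g_eq: "g x = p" if "(x, p) \<in> G" for x p
    by (rule fn_eq[OF G(1,2) gG[OF linD(1)[OF G(1) that]] that])
  have "g \<in> module_homs R B M"
    unfolding module_homs_def
  proof (intro CollectI conjI ballI Pi_I)
    show "g x \<in> carrier M" if "x \<in> carrier B" for x by (rule linD(2)[OF G(1) gG[OF that]])
    show "g (x \<oplus>\<^bsub>B\<^esub> y) = g x \<oplus>\<^bsub>M\<^esub> g y" if "x \<in> carrier B" "y \<in> carrier B" for x y
      by (rule g_eq[OF lin_add[OF G(1) gG[OF that(1)] gG[OF that(2)]]])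
    show "g (r \<odot>\<^bsub>B\<^esub> x) = r \<odot>\<^bsub>M\<^esub> g x" if "r \<in> carrier R" "x \<in> carrier B" for r x
      by (rule g_eq[OF lin_smult[OF G(1) that(1) gG[OF that(2)]]])
  qed
  moreover have "\<forall>a\<in>carrier A. g (i a) = f a" using g_eq G(3) by blast
  ultimately show "\<exists>g\<in>module_homs R B M. \<forall>a\<in>carrier A. g (i a) = f a" by blast
qed

section \<open>Annihilator duality\<close>

definition right_span :: "('a, 'm) ring_scheme \<Rightarrow> 'a list \<Rightarrow> 'a set"
  where "right_span R as = \<Inter>{K. right_ideal R K \<and> set as \<subseteq> K}"

context ring
begin

lemma right_ideal_right_span: "set as \<subseteq> carrier R \<Longrightarrow> right_ideal R (right_span R as)"
proof -
  assume as: "set as \<subseteq> carrier R"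
  have "right_ideal R (carrier R)" unfolding right_ideal_def by auto
  then show ?thesis using as unfolding right_ideal_def right_span_def by auto
qed

lemma right_span_least: "right_ideal R K \<Longrightarrow> set as \<subseteq> K \<Longrightarrow> right_span R as \<subseteq> K"
  unfolding right_span_def by blast

lemma right_span_superset: "set as \<subseteq> right_span R as"
  unfolding right_span_def by blast

lemma right_generated_right_span: "right_generated R (right_span R as) as"
  unfolding right_generated_def using right_span_superset right_span_least by blast

lemma right_generated_subset: "right_generated R I as \<Longrightarrow> right_ideal R I \<Longrightarrow> set as \<subseteq> carrier R"
  unfolding right_generated_def right_ideal_def by blast

text \<open>The elements killed by a fixed \<open>r\<close> on the left form a right ideal, so it is
  enough that \<open>r\<close> kills generators.\<close>

lemma lann_right_generated:
  assumes I: "right_ideal R I" and gen: "right_generated R I as"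
  shows "lann R (set as) = lann R I"
proof
  have asI: "set as \<subseteq> I" using gen unfolding right_generated_def by blast
  have Ic: "I \<subseteq> carrier R" using I unfolding right_ideal_def by blast
  show "lann R I \<subseteq> lann R (set as)" using asI unfolding lann_def by blast
  show "lann R (set as) \<subseteq> lann R I"
  proof
    fix r assume r: "r \<in> lann R (set as)"
    then have "set as \<subseteq> rann R {r}" using asI Ic by (auto simp: lann_def rann_def)
    moreover have "right_ideal R (rann R {r})" using r by (intro right_ideal_rann) (simp add: lann_def)
    ultimately have "I \<subseteq> rann R {r}" using gen unfolding right_generated_def by blast
    then show "r \<in> lann R I" using r by (auto simp: lann_def rann_def)
  qed
qed

text \<open>From \<open>b = 1 + a b\<close> it follows that \<open>b\<close> is itself
  \<open>1\<close> minus an element of \<open>J\<close>. So besides its left inverse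
  \<open>1 - a\<close> it has a right inverse, and the two agree.\<close>

lemma left_inverse_one_minus:
  assumes J: "ideal J R" and unit: "\<And>a. a \<in> J \<Longrightarrow> \<exists>b\<in>carrier R. (\<one> \<ominus> a) \<otimes> b = \<one>" and a: "a \<in> J"
  shows "\<exists>b\<in>carrier R. b \<otimes> (\<one> \<ominus> a) = \<one>"
proof -
  have ac: "a \<in> carrier R" by (rule ideal.Icarr[OF J a])
  obtain b where b: "b \<in> carrier R" "(\<one> \<ominus> a) \<otimes> b = \<one>" using unit[OF a] by blast
  have "(\<one> \<ominus> a) \<otimes> b \<oplus> a \<otimes> b = b" using ac b(1) by (simp add: expand_simps a_assoc l_neg)
  then have b': "\<one> \<oplus> a \<otimes> b = b" unfolding b(2) .
  have "\<ominus> (a \<otimes> b) \<in> J"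
    using left_ideal_a_inv[OF ideal_imp_left_ideal[OF J] ideal.I_r_closed[OF J a b(1)]] .
  from unit[OF this] obtain d where d: "d \<in> carrier R" "(\<one> \<ominus> \<ominus> (a \<otimes> b)) \<otimes> d = \<one>" by blast
  have bd: "b \<otimes> d = \<one>" using d(2) b' ac b(1) by (simp add: minus_eq)
  have "d = (\<one> \<ominus> a) \<otimes> b \<otimes> d" unfolding b(2) using d(1) by simp
  also have "\<dots> = \<one> \<ominus> a" using ac b(1) d(1) bd by (simp add: m_assoc)
  finally show ?thesis using b(1) bd by blast
qed

end

section \<open>Left self-injectivity and double annihilators\<close>

context noetherian_invariant_ring
begin

text \<open>Transported to \<open>R u\<close>, the map extends to an endomorphism of
  \<open>E\<close>, whose value at \<open>u\<close> is a multiple of \<open>u\<close> because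
  \<open>E = R u\<close>.\<close>

lemma self_injective:
  assumes L: "left_ideal R L" and k: "\<And>x. x \<in> L \<Longrightarrow> k x \<in> carrier R"
    and k_add: "\<And>x y. x \<in> L \<Longrightarrow> y \<in> L \<Longrightarrow> k (x \<oplus> y) = k x \<oplus> k y"
    and k_mult: "\<And>r x. r \<in> carrier R \<Longrightarrow> x \<in> L \<Longrightarrow> k (r \<otimes> x) = r \<otimes> k x"
  shows "\<exists>c\<in>carrier R. \<forall>x\<in>L. k x = x \<otimes> c"
proof -
  have Lc: "\<And>x. x \<in> L \<Longrightarrow> x \<in> carrier R" and L0: "\<zero> \<in> L" using L unfolding left_ideal_def by auto
  have "k \<zero> = \<zero> \<otimes> k \<zero>" using k_mult[of \<zero> \<zero>] L0 by simp
  then have k0: "k \<zero> = \<zero>" using k[OF L0] by simp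
  have "\<exists>g\<in>carrier S. \<forall>x\<in>L. g (x \<odot>\<^bsub>E\<^esub> u) = k x \<odot>\<^bsub>E\<^esub> u"
  proof (rule extend_hom_cyclic[OF L u])
    fix x assume "x \<in> L" "x \<odot>\<^bsub>E\<^esub> u = \<zero>\<^bsub>E\<^esub>"
    then show "k x \<odot>\<^bsub>E\<^esub> u = \<zero>\<^bsub>E\<^esub>" using free[OF Lc] k0 smult_l_null[OF u] by auto
  qed (use k k_add k_mult u in \<open>simp_all add: smult_l_distr smult_assoc1\<close>)
  then obtain g where g: "g \<in> carrier S" "\<And>x. x \<in> L \<Longrightarrow> g (x \<odot>\<^bsub>E\<^esub> u) = k x \<odot>\<^bsub>E\<^esub> u" by blast
  obtain c where c: "c \<in> carrier R" "g u = c \<odot>\<^bsub>E\<^esub> u" using generated_by_u[OF endo_closed[OF g(1) u]] by blast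
  have "k x = x \<otimes> c" if x: "x \<in> L" for x
  proof (rule u_cancel)
    show "k x \<odot>\<^bsub>E\<^esub> u = (x \<otimes> c) \<odot>\<^bsub>E\<^esub> u"
      using g(2)[OF x] endo_smult[OF g(1) Lc[OF x] u] c smult_assoc1[OF Lc[OF x] c(1) u] by simp
  qed (use k[OF x] Lc[OF x] c(1) in auto)
  then show ?thesis using c(1) by blast
qed

text \<open>An instance of \<open>finitely_generated_annihilator\<close> with
  \<open>Q = I u\<close>; that \<open>a E\<close> lies in \<open>I u\<close> uses
  \<open>E = R u\<close>. Finite generation is removed in \<open>rann_lann_eq\<close>.\<close>

lemma rann_lann:
  assumes I: "right_ideal R I" and gen: "right_generated R I as"
  shows "rann R (lann R I) = I"
proof
  have I': "\<And>x. x \<in> I \<Longrightarrow> x \<in> carrier R" "\<zero> \<in> I" "\<And>x y. x \<in> I \<Longrightarrow> y \<in> I \<Longrightarrow> x \<oplus> y \<in> I"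
    "\<And>r x. r \<in> carrier R \<Longrightarrow> x \<in> I \<Longrightarrow> x \<otimes> r \<in> I"
    using I unfolding right_ideal_def by auto
  show "I \<subseteq> rann R (lann R I)" using I'(1) unfolding lann_def rann_def by blast
  show "rann R (lann R I) \<subseteq> I"
  proof
    fix m assume m: "m \<in> rann R (lann R I)"
    then have mc: "m \<in> carrier R" by (simp add: rann_def)
    let ?Q = "{y \<odot>\<^bsub>E\<^esub> u |y. y \<in> I}"
    have "m \<odot>\<^bsub>E\<^esub> u \<in> ?Q"
    proof (rule finitely_generated_annihilator[OF right_generated_subset[OF gen I]])
      show "a \<odot>\<^bsub>E\<^esub> e \<in> ?Q" if a: "a \<in> set as" and e: "e \<in> carrier E" for a e
      proof -
        have aI: "a \<in> I" using a gen unfolding right_generated_def by blast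
        obtain r where r: "r \<in> carrier R" "e = r \<odot>\<^bsub>E\<^esub> u" using generated_by_u[OF e] by blast
        have "a \<odot>\<^bsub>E\<^esub> e = (a \<otimes> r) \<odot>\<^bsub>E\<^esub> u" using r I'(1)[OF aI] u by (simp add: smult_assoc1)
        then show ?thesis using I'(4)[OF r(1) aI] by blast
      qed
      show "\<zero>\<^bsub>E\<^esub> \<in> ?Q" using smult_l_null[OF u, symmetric] I'(2) by blast
      show "v \<oplus>\<^bsub>E\<^esub> w \<in> ?Q" if vw: "v \<in> ?Q" "w \<in> ?Q" for v w
      proof -
        obtain a b where *: "a \<in> I" "b \<in> I" "v = a \<odot>\<^bsub>E\<^esub> u" "w = b \<odot>\<^bsub>E\<^esub> u" using vw by blast
        have "v \<oplus>\<^bsub>E\<^esub> w = (a \<oplus> b) \<odot>\<^bsub>E\<^esub> u"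
          using *(3,4) I'(1)[OF *(1)] I'(1)[OF *(2)] u by (simp add: smult_l_distr)
        then show ?thesis using I'(3)[OF *(1,2)] by blast
      qed
      fix r assume "r \<in> lann R (set as)"
      then have r: "r \<in> lann R I" using lann_right_generated[OF I gen] by simp
      then have "r \<otimes> m = \<zero>" "r \<in> carrier R" using m unfolding rann_def lann_def by auto
      then show "r \<odot>\<^bsub>E\<^esub> (m \<odot>\<^bsub>E\<^esub> u) = \<zero>\<^bsub>E\<^esub>" using smult_assoc1[of r m u] mc u smult_l_null[OF u] by simp
    qed (use mc u in simp)
    then obtain y where y: "y \<in> I" "m \<odot>\<^bsub>E\<^esub> u = y \<odot>\<^bsub>E\<^esub> u" by blast
    then show "m \<in> I" using u_cancel[OF mc I'(1)[OF y(1)]] by simp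
  qed
qed

text \<open>A nonzero \<open>m\<close> is found that is killed by every \<open>r\<close> with
  \<open>r x\<close> in \<open>L\<close>. Then \<open>l + r x |-> r m\<close> is well defined on
  \<open>L + R x\<close>, and by self-injectivity it is right multiplication by some
  \<open>c\<close>, for which \<open>L c = 0\<close> and \<open>x c = m\<close>.\<close>

lemma separate_left_ideal:
  assumes L: "left_ideal R L" and x: "x \<in> carrier R" "x \<notin> L"
  shows "\<exists>c\<in>rann R L. x \<otimes> c \<noteq> \<zero>"
proof -
  have L': "\<And>x. x \<in> L \<Longrightarrow> x \<in> carrier R" "\<zero> \<in> L" "\<And>x y. x \<in> L \<Longrightarrow> y \<in> L \<Longrightarrow> x \<oplus> y \<in> L"
    "\<And>r x. r \<in> carrier R \<Longrightarrow> x \<in> L \<Longrightarrow> r \<otimes> x \<in> L"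
    using L unfolding left_ideal_def by auto
  have J0: "\<zero> \<in> J" and Jadd: "\<And>a b. a \<in> J \<Longrightarrow> b \<in> J \<Longrightarrow> a \<oplus> b \<in> J"
    using additive_subgroup.zero_closed[OF ideal.axioms(1)[OF J_ideal]]
      additive_subgroup.a_closed[OF ideal.axioms(1)[OF J_ideal]] by auto
  have Jmult: "\<And>a r. a \<in> J \<Longrightarrow> r \<in> carrier R \<Longrightarrow> r \<otimes> a \<in> J" using ideal.I_l_closed[OF J_ideal] .
  \<comment> \<open>The annihilator of \<open>x\<close> modulo \<open>L\<close>, enlarged by
    \<open>J\<close> so that \<open>left_ideal_complement\<close> applies. It stays proper because
    \<open>1 + j\<close> is left invertible for \<open>j\<close> in \<open>J\<close>.\<close>
  define K where "K = {r \<in> carrier R. \<exists>j\<in>J. (r \<oplus> j) \<otimes> x \<in> L}"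
  have K: "left_ideal R K"
    unfolding left_ideal_def
  proof (intro conjI ballI)
    show "K \<subseteq> carrier R" unfolding K_def by blast
    show "\<zero> \<in> K" unfolding K_def using J0 L'(2) x by (auto intro!: bexI[of _ \<zero>])
    show "r \<oplus> s \<in> K" if rs: "r \<in> K" "s \<in> K" for r s
    proof -
      obtain i j where *: "r \<in> carrier R" "s \<in> carrier R" "i \<in> J" "j \<in> J" "(r \<oplus> i) \<otimes> x \<in> L" "(s \<oplus> j) \<otimes> x \<in> L"
        using rs unfolding K_def by blast
      have "(r \<oplus> s \<oplus> (i \<oplus> j)) \<otimes> x = (r \<oplus> i) \<otimes> x \<oplus> (s \<oplus> j) \<otimes> x"
        using * J_carrier x by (simp add: l_distr R.a_ac)
      then have "(r \<oplus> s \<oplus> (i \<oplus> j)) \<otimes> x \<in> L" using L'(3)[OF *(5,6)] by simp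
      then show ?thesis using Jadd[OF *(3,4)] R.a_closed[OF *(1,2)] unfolding K_def by blast
    qed
    show "s \<otimes> r \<in> K" if s: "s \<in> carrier R" and r: "r \<in> K" for s r
    proof -
      obtain j where *: "r \<in> carrier R" "j \<in> J" "(r \<oplus> j) \<otimes> x \<in> L" using r unfolding K_def by blast
      have "(s \<otimes> r \<oplus> s \<otimes> j) \<otimes> x = s \<otimes> ((r \<oplus> j) \<otimes> x)"
        using * J_carrier x s by (simp add: l_distr r_distr m_assoc)
      then have "(s \<otimes> r \<oplus> s \<otimes> j) \<otimes> x \<in> L" using L'(4)[OF s *(3)] by simp
      then show ?thesis using Jmult[OF *(2) s] R.m_closed[OF s *(1)] unfolding K_def by blast
    qed
  qed
  have JK: "J \<subseteq> K"
  proof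
    fix j assume j: "j \<in> J"
    have "\<ominus> j \<in> J" by (rule R.left_ideal_a_inv[OF R.ideal_imp_left_ideal[OF J_ideal] j])
    moreover have "(j \<oplus> \<ominus> j) \<otimes> x \<in> L" using J_carrier[OF j] x(1) L'(2) by (simp add: R.r_neg)
    ultimately show "j \<in> K" unfolding K_def using J_carrier[OF j] by blast
  qed
  have K1: "\<one> \<notin> K"
  proof
    assume "\<one> \<in> K"
    then obtain j where j: "j \<in> J" "(\<one> \<oplus> j) \<otimes> x \<in> L" unfolding K_def by blast
    have jc: "j \<in> carrier R" by (rule J_carrier[OF j(1)])
    have "\<ominus> j \<in> J" by (rule R.left_ideal_a_inv[OF R.ideal_imp_left_ideal[OF J_ideal] j(1)])
    from R.left_inverse_one_minus[OF J_ideal J_unit this] obtain b where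
      b: "b \<in> carrier R" "b \<otimes> (\<one> \<oplus> j) = \<one>" using jc by (auto simp: R.minus_eq)
    have "b \<otimes> ((\<one> \<oplus> j) \<otimes> x) = x" using b jc x(1) m_assoc[of b "\<one> \<oplus> j" x] by simp
    then show False using L'(4)[OF b(1) j(2)] x(2) by simp
  qed
  obtain e where e: "e \<in> carrier R" "\<one> \<ominus> e \<in> K" "\<And>r. r \<in> K \<Longrightarrow> r \<otimes> e \<in> J"
    using left_ideal_complement[OF K JK] by blast
  have "e \<notin> J"
  proof
    assume "e \<in> J"
    then have "e \<oplus> (\<one> \<ominus> e) \<in> K" using JK e(2) K unfolding left_ideal_def by blast
    then show False using K1 R.add_compl[OF e(1)] by simp
  qed
  then obtain p where p: "p \<in> P" "e \<odot>\<^bsub>E\<^esub> p \<noteq> \<zero>\<^bsub>E\<^esub>" using P_faithful[OF e(1)] by blast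
  obtain t where t: "t \<in> carrier R" "p = t \<odot>\<^bsub>E\<^esub> u" using generated_by_u[OF P_carrier[OF p(1)]] by blast
  \<comment> \<open>Here \<open>K e\<close> lies in \<open>J\<close> and so kills
    \<open>p = t u\<close>, which gives \<open>K m = 0\<close> by freeness of \<open>u\<close>; and
    \<open>m u = e p\<close> is not zero.\<close>
  define m where "m = e \<otimes> t"
  have mc: "m \<in> carrier R" using e(1) t(1) by (simp add: m_def)
  have m0: "m \<noteq> \<zero>"
  proof
    assume "m = \<zero>"
    then have "e \<odot>\<^bsub>E\<^esub> p = \<zero>\<^bsub>E\<^esub>" using t e(1) u smult_assoc1[of e t u] smult_l_null[OF u] by (simp add: m_def)
    then show False using p(2) by blast
  qed
  have Km: "r \<otimes> m = \<zero>" if r: "r \<in> K" for r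
  proof -
    have rc: "r \<in> carrier R" using r unfolding K_def by blast
    have "(r \<otimes> e) \<odot>\<^bsub>E\<^esub> p = \<zero>\<^bsub>E\<^esub>" by (rule P_kill[OF p(1) e(3)[OF r]])
    then have "(r \<otimes> m) \<odot>\<^bsub>E\<^esub> u = \<zero>\<^bsub>E\<^esub>" using t rc e(1) u by (simp add: m_def smult_assoc1)
    then show ?thesis using free[of "r \<otimes> m"] rc mc by blast
  qed
  \<comment> \<open>This is \<open>L + R x\<close>, and \<open>k\<close> sends
    \<open>l + r x\<close> to \<open>r m\<close>.\<close>
  define X where "X = {y \<in> carrier R. \<exists>r\<in>carrier R. y \<ominus> r \<otimes> x \<in> L}"
  define k where "k y = (SOME r. r \<in> carrier R \<and> y \<ominus> r \<otimes> x \<in> L) \<otimes> m" for y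
  have k_eq: "k y = r \<otimes> m" if y: "y \<in> carrier R" and r: "r \<in> carrier R" "y \<ominus> r \<otimes> x \<in> L" for y r
  proof -
    have "\<exists>r. r \<in> carrier R \<and> y \<ominus> r \<otimes> x \<in> L" using r by blast
    from someI_ex[OF this] obtain s where s: "s \<in> carrier R" "y \<ominus> s \<otimes> x \<in> L" "k y = s \<otimes> m"
      unfolding k_def by blast
    have "(y \<ominus> r \<otimes> x) \<oplus> (\<ominus> (y \<ominus> s \<otimes> x)) = (s \<oplus> \<ominus> r \<oplus> \<zero>) \<otimes> x"
      using y r(1) s(1) x(1)
      by (simp add: R.expand_simps R.a_ac R.r_neg R.r_neg1 R.r_neg2)
    moreover have "(y \<ominus> r \<otimes> x) \<oplus> (\<ominus> (y \<ominus> s \<otimes> x)) \<in> L"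
      using L'(3)[OF r(2) R.left_ideal_a_inv[OF L s(2)]] .
    ultimately have "s \<oplus> \<ominus> r \<in> K" unfolding K_def using J0 r(1) s(1) by (auto intro!: bexI[of _ \<zero>])
    from Km[OF this] have "s \<otimes> m \<oplus> \<ominus> (r \<otimes> m) = \<zero>" using r(1) s(1) mc by (simp add: l_distr l_minus)
    then have "s \<otimes> m = r \<otimes> m" using r(1) s(1) mc R.minus_equality[of "s \<otimes> m" "\<ominus> (r \<otimes> m)"] by simp
    then show ?thesis using s(3) by simp
  qed
  have addX: "(y \<oplus> z) \<ominus> (r \<oplus> s) \<otimes> x \<in> L"
    if *: "y \<in> carrier R" "z \<in> carrier R" "r \<in> carrier R" "s \<in> carrier R" "y \<ominus> r \<otimes> x \<in> L" "z \<ominus> s \<otimes> x \<in> L" for y z r s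
  proof -
    have "(y \<oplus> z) \<ominus> (r \<oplus> s) \<otimes> x = (y \<ominus> r \<otimes> x) \<oplus> (z \<ominus> s \<otimes> x)"
      using *(1-4) x(1) by (simp add: R.expand_simps R.a_ac)
    then show ?thesis using L'(3)[OF *(5,6)] by simp
  qed
  have multX: "(a \<otimes> y) \<ominus> (a \<otimes> r) \<otimes> x \<in> L"
    if *: "a \<in> carrier R" "y \<in> carrier R" "r \<in> carrier R" "y \<ominus> r \<otimes> x \<in> L" for a y r
  proof -
    have "(a \<otimes> y) \<ominus> (a \<otimes> r) \<otimes> x = a \<otimes> (y \<ominus> r \<otimes> x)"
      using *(1-3) x(1) by (simp add: R.expand_simps m_assoc)
    then show ?thesis using L'(4)[OF *(1,4)] by simp
  qed
  have "\<exists>c\<in>carrier R. \<forall>y\<in>X. k y = y \<otimes> c"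
  proof (rule self_injective)
    show "left_ideal R X"
      unfolding left_ideal_def
    proof (intro conjI ballI)
      show "X \<subseteq> carrier R" unfolding X_def by blast
      show "\<zero> \<in> X" unfolding X_def using L'(2) x(1) by (auto intro!: bexI[of _ \<zero>] simp: R.minus_eq)
      show "y \<oplus> z \<in> X" if yz: "y \<in> X" "z \<in> X" for y z
      proof -
        obtain r s where *: "y \<in> carrier R" "z \<in> carrier R" "r \<in> carrier R" "s \<in> carrier R"
          "y \<ominus> r \<otimes> x \<in> L" "z \<ominus> s \<otimes> x \<in> L"
          using yz unfolding X_def by blast
        show ?thesis
          using addX[OF *] R.a_closed[OF *(1,2)] R.a_closed[OF *(3,4)] unfolding X_def by blast
      qed
      show "a \<otimes> y \<in> X" if a: "a \<in> carrier R" and y: "y \<in> X" for a y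
      proof -
        obtain r where *: "y \<in> carrier R" "r \<in> carrier R" "y \<ominus> r \<otimes> x \<in> L" using y unfolding X_def by blast
        show ?thesis
          using multX[OF a *] R.m_closed[OF a *(1)] R.m_closed[OF a *(2)] unfolding X_def by blast
      qed
    qed
    show "k y \<in> carrier R" if "y \<in> X" for y
      using that k_eq mc unfolding X_def by auto
    show "k (y \<oplus> z) = k y \<oplus> k z" if "y \<in> X" "z \<in> X" for y z
    proof -
      obtain r s where *: "y \<in> carrier R" "z \<in> carrier R" "r \<in> carrier R" "s \<in> carrier R" "y \<ominus> r \<otimes> x \<in> L" "z \<ominus> s \<otimes> x \<in> L"
        using \<open>y \<in> X\<close> \<open>z \<in> X\<close> unfolding X_def by blast
      show ?thesis
        using k_eq[OF *(1,3,5)] k_eq[OF *(2,4,6)] k_eq[OF _ _ addX[OF *]] * mc by (simp add: l_distr)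
    qed
    show "k (a \<otimes> y) = a \<otimes> k y" if a: "a \<in> carrier R" and y: "y \<in> X" for a y
    proof -
      obtain r where *: "y \<in> carrier R" "r \<in> carrier R" "y \<ominus> r \<otimes> x \<in> L" using y unfolding X_def by blast
      show ?thesis using k_eq[OF *] k_eq[OF _ _ multX[OF a *]] * a mc by (simp add: m_assoc)
    qed
  qed
  then obtain c where c: "c \<in> carrier R" "\<And>y. y \<in> X \<Longrightarrow> k y = y \<otimes> c" by blast
  have "y \<otimes> c = \<zero>" if y: "y \<in> L" for y
  proof -
    have y0: "y \<ominus> \<zero> \<otimes> x \<in> L" using y L'(1)[OF y] x(1) by (simp add: R.minus_eq)
    have "y \<in> X" unfolding X_def using y0 L'(1)[OF y] by blast
    then show ?thesis using c(2) k_eq[OF L'(1)[OF y] R.zero_closed y0] mc by simp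
  qed
  moreover have "x \<otimes> c \<noteq> \<zero>"
  proof -
    have x1: "x \<ominus> \<one> \<otimes> x \<in> L" using x(1) L'(2) by (simp add: R.minus_eq R.r_neg)
    have "x \<in> X" unfolding X_def using x1 x(1) by blast
    then show ?thesis using c(2) k_eq[OF x(1) R.one_closed x1] mc m0 by simp
  qed
  ultimately show ?thesis using c(1) unfolding rann_def by blast
qed

lemma lann_rann:
  assumes L: "left_ideal R L"
  shows "lann R (rann R L) = L"
proof
  have Lc: "L \<subseteq> carrier R" using L unfolding left_ideal_def by blast
  show "L \<subseteq> lann R (rann R L)" using Lc unfolding lann_def rann_def by blast
  show "lann R (rann R L) \<subseteq> L" using separate_left_ideal[OF L] unfolding lann_def by blast
qed

lemma right_ideal_complement:
  assumes I: "right_ideal R I" and JI: "J \<subseteq> I"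
  shows "\<exists>e\<in>carrier R. \<one> \<ominus> e \<in> I \<and> (\<forall>x\<in>I. e \<otimes> x \<in> J)"
proof -
  have I': "\<And>x. x \<in> I \<Longrightarrow> x \<in> carrier R" "\<zero> \<in> I" "\<And>x y. x \<in> I \<Longrightarrow> y \<in> I \<Longrightarrow> x \<oplus> y \<in> I"
    "\<And>r x. r \<in> carrier R \<Longrightarrow> x \<in> I \<Longrightarrow> x \<otimes> r \<in> I"
    using I unfolding right_ideal_def by auto
  have "right_ideal Br (\<pi> ` I)"
    unfolding right_ideal_def
  proof (intro conjI ballI)
    show "\<pi> ` I \<subseteq> carrier Br" using I'(1) pi_B by auto
    show "\<zero>\<^bsub>Br\<^esub> \<in> \<pi> ` I" using I'(2) pi.hom_zero by force
    show "x \<oplus>\<^bsub>Br\<^esub> y \<in> \<pi> ` I" if xy: "x \<in> \<pi> ` I" "y \<in> \<pi> ` I" for x y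
    proof -
      obtain a b where *: "a \<in> I" "x = \<pi> a" "b \<in> I" "y = \<pi> b" using xy by blast
      have "x \<oplus>\<^bsub>Br\<^esub> y = \<pi> (a \<oplus> b)" using * pi_add I'(1) by simp
      then show ?thesis using I'(3)[OF *(1,3)] by blast
    qed
    show "x \<otimes>\<^bsub>Br\<^esub> r \<in> \<pi> ` I" if r: "r \<in> carrier Br" and x: "x \<in> \<pi> ` I" for r x
    proof -
      obtain a b where *: "a \<in> carrier R" "r = \<pi> a" "b \<in> I" "x = \<pi> b" using r x unfolding B_def by auto
      have "x \<otimes>\<^bsub>Br\<^esub> r = \<pi> (b \<otimes> a)" using * pi_mult I'(1) by simp
      then show ?thesis using I'(4)[OF *(1,3)] by blast
    qed
  qed
  moreover have "idem_acc Br (\<pi> ` I)" using I'(1) pi_B by (intro Br_idem_acc) auto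
  ultimately have "\<exists>g\<in>\<pi> ` I. g \<otimes>\<^bsub>Br\<^esub> g = g \<and> (\<forall>x\<in>\<pi> ` I. g \<otimes>\<^bsub>Br\<^esub> x = x)"
    by (rule Br.right_ideal_idempotent[OF U.B_regular])
  then obtain g where g: "g \<in> \<pi> ` I" "\<forall>x\<in>\<pi> ` I. g \<otimes>\<^bsub>T\<^esub> x = x" by auto
  then obtain d where d: "d \<in> I" "g = \<pi> d" by blast
  have dc: "d \<in> carrier R" using d I' by blast
  have "(\<one> \<ominus> d) \<otimes> x \<in> J" if x: "x \<in> I" for x
  proof -
    have xc: "x \<in> carrier R" using x I' by blast
    have "\<pi> (d \<otimes> x) = \<pi> x" using g(2) x d(2) pi_mult[OF dc xc] by auto
    then have "x \<ominus> d \<otimes> x \<in> J" using pi_eq_iff[of x "d \<otimes> x"] xc dc by simp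
    moreover have "x \<ominus> d \<otimes> x = (\<one> \<ominus> d) \<otimes> x" using xc dc by (simp add: R.minus_eq l_distr l_minus)
    ultimately show ?thesis by simp
  qed
  then show ?thesis using d(1) dc R.compl_compl[OF dc] by (intro bexI[of _ "\<one> \<ominus> d"]) auto
qed

section \<open>Chain conditions and finite generation on both sides\<close>

lemma nilpotent_step:
  assumes X: "X \<noteq> carrier R" "X \<subseteq> carrier R" "\<zero> \<in> X"
  shows "\<exists>k. \<not> ideal_pow R J k \<subseteq> X \<and> ideal_pow R J (Suc k) \<subseteq> X"
proof -
  obtain n where n: "ideal_pow R J n = {\<zero>}" using J_nilpotent[OF acc] by blast
  have "ideal_pow R J n \<subseteq> X" "\<not> ideal_pow R J 0 \<subseteq> X" using X by (auto simp: n)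
  then have "\<exists>k<n. (\<forall>i\<le>k. \<not> ideal_pow R J i \<subseteq> X) \<and> ideal_pow R J (Suc k) \<subseteq> X"
    by (intro ex_least_nat_less)
  then show ?thesis by blast
qed

lemma left_acc_dcc:
  assumes "left_acc R"
  shows "left_dcc R"
proof (rule R.left_acc_imp_left_dcc[OF J_ideal _ _ assms])
  fix X assume X: "left_ideal R X" "X \<noteq> carrier R"
  obtain k where k: "\<not> ideal_pow R J k \<subseteq> X" "ideal_pow R J (Suc k) \<subseteq> X"
    using nilpotent_step[of X] X unfolding left_ideal_def by blast
  then obtain m where m: "m \<in> ideal_pow R J k" "m \<notin> X" by blast
  have "j \<otimes> m \<in> X" if "j \<in> J" for j using ideal_prod.prod[OF that m(1), of R] k(2) by auto
  then show "\<exists>m\<in>carrier R. m \<notin> X \<and> (\<forall>j\<in>J. j \<otimes> m \<in> X)"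
    using m ideal.Icarr[OF R.ideal_pow_ideal[OF J_ideal]] by blast
qed (rule left_ideal_complement)

lemma right_acc_dcc:
  assumes "right_acc R"
  shows "left_dcc (opposite_ring R)"
proof (rule ring.left_acc_imp_left_dcc[OF R.opposite_ring_ring R.ideal_opposite[OF J_ideal]])
  show "left_acc (opposite_ring R)" using assms by simp
next
  fix X assume X: "left_ideal (opposite_ring R) X" "X \<noteq> carrier (opposite_ring R)"
  obtain k where k: "\<not> ideal_pow R J k \<subseteq> X" "ideal_pow R J (Suc k) \<subseteq> X"
    using nilpotent_step[of X] X unfolding left_ideal_opposite right_ideal_def by auto
  then obtain m where m: "m \<in> ideal_pow R J k" "m \<notin> X" by blast
  have "m \<otimes> j \<in> X" if "j \<in> J" for j
    using ideal_prod.prod[OF m(1) that, of R] k(2) unfolding R.ideal_pow_Suc_right[OF J_ideal] by auto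
  then show "\<exists>m\<in>carrier (opposite_ring R). m \<notin> X \<and> (\<forall>j\<in>J. j \<otimes>\<^bsub>opposite_ring R\<^esub> m \<in> X)"
    using m ideal.Icarr[OF R.ideal_pow_ideal[OF J_ideal]] by auto
next
  fix L assume L: "left_ideal (opposite_ring R) L" "J \<subseteq> L"
  then have "right_ideal R L" by simp
  from right_ideal_complement[OF this L(2)]
  obtain e where "e \<in> carrier R" "\<one> \<ominus> e \<in> L" "\<forall>x\<in>L. e \<otimes> x \<in> J" by blast
  then show "\<exists>e\<in>carrier (opposite_ring R). \<one>\<^bsub>opposite_ring R\<^esub> \<ominus>\<^bsub>opposite_ring R\<^esub> e \<in> L \<and>
      (\<forall>x\<in>L. x \<otimes>\<^bsub>opposite_ring R\<^esub> e \<in> J)"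
    using R.minus_opposite[OF R.one_closed] by auto
qed

text \<open>Failing the right noetherian hypothesis, the left one yields the descending condition on
  left ideals. Then a finite list in \<open>I\<close> with minimal left annihilator generates
  \<open>I\<close>: a further \<open>x\<close> leaves the annihilator unchanged and so lies in the
  double annihilator of the list, which is its span by \<open>rann_lann\<close>.\<close>

lemma right_finitely_generated:
  assumes I: "right_ideal R I"
  shows "\<exists>as. right_generated R I as"
proof (cases "right_acc R")
  case True
  then show ?thesis using R.right_acc_finitely_generated I by blast
next
  case False
  then have dcc: "left_dcc R" using acc left_acc_dcc by blast
  have Ic: "I \<subseteq> carrier R" using I unfolding right_ideal_def by blast
  let ?F = "{lann R (set as) |as. set as \<subseteq> I}"
  have F: "left_ideal R X" if "X \<in> ?F" for X using that R.left_ideal_lann Ic by force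
  have "lann R (set []) \<in> ?F" by (intro CollectI exI[of _ "[]"]) simp
  from left_dcc_minimal[OF dcc this F] obtain as where as: "set as \<subseteq> I"
    and min: "\<forall>X\<in>?F. X \<subseteq> lann R (set as) \<longrightarrow> X = lann R (set as)" by blast
  have asc: "set as \<subseteq> carrier R" using as Ic by blast
  have rs: "right_ideal R (right_span R as)" by (rule R.right_ideal_right_span[OF asc])
  have "I \<subseteq> right_span R as"
  proof
    fix x assume x: "x \<in> I"
    have "lann R (set (x # as)) \<in> ?F" using as x by (intro CollectI exI[of _ "x # as"]) simp
    moreover have "lann R (set (x # as)) \<subseteq> lann R (set as)" by (rule R.lann_antimono) auto
    ultimately have "lann R (set as) = lann R (set (x # as))" using min by blast
    then have "x \<in> rann R (lann R (set as))" using x Ic unfolding rann_def by (auto simp: lann_def)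
    then show "x \<in> right_span R as"
      using rann_lann[OF rs R.right_generated_right_span]
        R.lann_right_generated[OF rs R.right_generated_right_span] by simp
  qed
  then have "I = right_span R as" using R.right_span_least[OF I as] by blast
  then show ?thesis using R.right_generated_right_span by blast
qed

lemma rann_lann_eq:
  assumes "right_ideal R I"
  shows "rann R (lann R I) = I"
  using right_finitely_generated[OF assms] rann_lann[OF assms] by blast

text \<open>In the right noetherian case \<open>rann\<close> turns a descending chain of left ideals
  into an ascending chain of right ideals, and by \<open>lann_rann\<close> no information is
  lost.\<close>

lemma is_left_dcc: "left_dcc R"
proof (cases "left_acc R")
  case True
  then show ?thesis by (rule left_acc_dcc)
next
  case False
  then have acc: "right_acc R" using acc by blast
  show ?thesis
    unfolding left_dcc_def
  proof (intro allI impI)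
    fix C :: "nat \<Rightarrow> 'a set" assume C: "\<forall>n. left_ideal R (C n) \<and> C (Suc n) \<subseteq> C n"
    have "C n \<subseteq> carrier R" "C (Suc n) \<subseteq> C n" for n using C unfolding left_ideal_def by blast+
    then have "right_ideal R (rann R (C n)) \<and> rann R (C n) \<subseteq> rann R (C (Suc n))" for n
      using R.right_ideal_rann R.rann_antimono by simp
    then obtain k where k: "\<And>n. n \<ge> k \<Longrightarrow> rann R (C n) = rann R (C k)"
      using acc[unfolded right_acc_def, rule_format, of "\<lambda>n. rann R (C n)"] by blast
    have "C n = C k" if "n \<ge> k" for n
    proof -
      have "left_ideal R (C n)" "left_ideal R (C k)" using C by blast+
      from this[THEN lann_rann] show ?thesis unfolding k[OF that] by (rule trans[OF sym])
    qed
    then show "\<exists>k. \<forall>n\<ge>k. C n = C k" by blast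
  qed
qed

lemma is_right_dcc: "left_dcc (opposite_ring R)"
proof (cases "right_acc R")
  case True
  then show ?thesis by (rule right_acc_dcc)
next
  case False
  then have acc: "left_acc R" using acc by blast
  show ?thesis
    unfolding left_dcc_def left_ideal_opposite
  proof (intro allI impI)
    fix C :: "nat \<Rightarrow> 'a set" assume C: "\<forall>n. right_ideal R (C n) \<and> C (Suc n) \<subseteq> C n"
    have "C n \<subseteq> carrier R" "C (Suc n) \<subseteq> C n" for n using C unfolding right_ideal_def by blast+
    then have "left_ideal R (lann R (C n)) \<and> lann R (C n) \<subseteq> lann R (C (Suc n))" for n
      using R.left_ideal_lann R.lann_antimono by simp
    then obtain k where k: "\<And>n. n \<ge> k \<Longrightarrow> lann R (C n) = lann R (C k)"
      using acc[unfolded left_acc_def, rule_format, of "\<lambda>n. lann R (C n)"] by blast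
    have "C n = C k" if "n \<ge> k" for n
    proof -
      have "right_ideal R (C n)" "right_ideal R (C k)" using C by blast+
      from this[THEN rann_lann_eq] show ?thesis unfolding k[OF that] by (rule trans[OF sym])
    qed
    then show "\<exists>k. \<forall>n\<ge>k. C n = C k" by blast
  qed
qed

section \<open>Right self-injectivity\<close>

lemma lann_Int:
  assumes I: "right_ideal R I" and K: "right_ideal R K" and d: "d \<in> lann R (I \<inter> K)"
  shows "\<exists>a\<in>lann R I. \<exists>b\<in>lann R K. d = a \<oplus> b"
proof -
  have Ic: "I \<subseteq> carrier R" "K \<subseteq> carrier R" using I K unfolding right_ideal_def by auto
  let ?L = "{a \<oplus> b |a b. a \<in> lann R I \<and> b \<in> lann R K}"
  have lI: "left_ideal R (lann R I)" "left_ideal R (lann R K)" using R.left_ideal_lann Ic by auto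
  note L = R.left_ideal_sum[OF lI]
  \<comment> \<open>The right annihilator of the sum lies in \<open>I\<close> and in
    \<open>K\<close>. Annihilating once more, the sum, which is its own double annihilator, contains
    the left annihilator of the intersection.\<close>
  have "rann R ?L \<subseteq> rann R (lann R I) \<inter> rann R (lann R K)"
    using R.rann_antimono[OF L(2)] R.rann_antimono[OF L(3)] by blast
  then have "rann R ?L \<subseteq> I \<inter> K" using rann_lann_eq I K by simp
  then have "lann R (I \<inter> K) \<subseteq> lann R (rann R ?L)" by (rule R.lann_antimono)
  then have "d \<in> ?L" using d lann_rann[OF L(1)] by blast
  then show ?thesis by blast
qed

text \<open>The Ikeda-Nakayama argument: let \<open>c\<close> represent \<open>k\<close> on the span
  of \<open>as\<close> and \<open>d\<close> on that of \<open>a\<close>. Then \<open>c - d\<close>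
  kills the intersection, so by \<open>lann_Int\<close> it is \<open>v + w\<close>, where
  \<open>v\<close> kills the first span and \<open>w\<close> the second. The element
  \<open>c - v = d + w\<close> represents \<open>k\<close> on both.\<close>

lemma right_hom_list:
  assumes I: "right_ideal R I" and k: "\<And>x. x \<in> I \<Longrightarrow> k x \<in> carrier R"
    and k_add: "\<And>x y. x \<in> I \<Longrightarrow> y \<in> I \<Longrightarrow> k (x \<oplus> y) = k x \<oplus> k y"
    and k_mult: "\<And>r x. r \<in> carrier R \<Longrightarrow> x \<in> I \<Longrightarrow> k (x \<otimes> r) = k x \<otimes> r"
    and as: "set as \<subseteq> I"
  shows "\<exists>c\<in>carrier R. \<forall>x\<in>right_span R as. k x = c \<otimes> x"
  using as
proof (induction as)
  case Nil
  have "right_ideal R {\<zero>}" unfolding right_ideal_def by auto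
  then have "right_span R [] \<subseteq> {\<zero>}" by (rule R.right_span_least) simp
  moreover have "k \<zero> = \<zero>"
    using k_mult[of \<zero> \<zero>] k[of \<zero>] I unfolding right_ideal_def by simp
  ultimately show ?case by (intro bexI[of _ \<zero>]) auto
next
  case (Cons a as)
  have I': "\<And>x. x \<in> I \<Longrightarrow> x \<in> carrier R" "\<zero> \<in> I" "\<And>x y. x \<in> I \<Longrightarrow> y \<in> I \<Longrightarrow> x \<oplus> y \<in> I"
    "\<And>r x. r \<in> carrier R \<Longrightarrow> x \<in> I \<Longrightarrow> x \<otimes> r \<in> I"
    using I unfolding right_ideal_def by auto
  have k0: "k \<zero> = \<zero>" using k_mult[of \<zero> \<zero>] k[of \<zero>] I'(2) by simp
  have a: "a \<in> I" and as: "set as \<subseteq> I" using Cons.prems by auto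
  have ac: "a \<in> carrier R" and asc: "set as \<subseteq> carrier R" using I'(1) a as by auto
  have agree: "right_ideal R {x \<in> I. k x = c \<otimes> x}" if c: "c \<in> carrier R" for c
    unfolding right_ideal_def using I' c
    by (auto simp: k0 k_add k_mult r_distr m_assoc)
  obtain c where c: "c \<in> carrier R" "\<And>x. x \<in> right_span R as \<Longrightarrow> k x = c \<otimes> x"
    using Cons.IH[OF as] by blast
  \<comment> \<open>For one generator: whatever is killed by \<open>a\<close> from the left is also
    killed by \<open>k a\<close>, so \<open>k a\<close> lies in the double annihilator of
    \<open>R a\<close>, which is \<open>R a\<close>.\<close>
  have "k a \<in> lann R (rann R {r \<otimes> a |r. r \<in> carrier R})"
  proof -
    have "k a \<otimes> s = \<zero>" if s: "s \<in> rann R {r \<otimes> a |r. r \<in> carrier R}" for s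
    proof -
      have sc: "s \<in> carrier R" using s by (simp add: rann_def)
      have "a \<otimes> s = \<zero>" using s R.left_ideal_principal(2)[OF ac] unfolding rann_def by blast
      then show ?thesis using k_mult[OF sc a] k0 by simp
    qed
    then show ?thesis using k[OF a] unfolding lann_def by blast
  qed
  then have "k a \<in> {r \<otimes> a |r. r \<in> carrier R}"
    unfolding lann_rann[OF R.left_ideal_principal(1)[OF ac]] .
  then obtain d where d: "d \<in> carrier R" "k a = d \<otimes> a" by blast
  have span_a: "k x = d \<otimes> x" if x: "x \<in> right_span R [a]" for x
  proof -
    have "right_span R [a] \<subseteq> {x \<in> I. k x = d \<otimes> x}"
      by (rule R.right_span_least[OF agree[OF d(1)]]) (use a d(2) in simp)
    then show ?thesis using x by blast
  qed
  have r1: "right_ideal R (right_span R as)" by (rule R.right_ideal_right_span[OF asc])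
  have r2: "right_ideal R (right_span R [a])" by (rule R.right_ideal_right_span) (use ac in simp)
  have rc: "x \<in> carrier R" if "x \<in> right_span R as \<inter> right_span R [a]" for x
    using that r1 unfolding right_ideal_def by blast
  have "c \<oplus> \<ominus> d \<in> lann R (right_span R as \<inter> right_span R [a])"
    unfolding lann_def
  proof (intro CollectI conjI ballI)
    fix x assume x: "x \<in> right_span R as \<inter> right_span R [a]"
    have "c \<otimes> x = d \<otimes> x" using c(2)[of x, symmetric] span_a[of x] x by simp
    then show "(c \<oplus> \<ominus> d) \<otimes> x = \<zero>" using rc[OF x] c(1) d(1) by (simp add: l_distr l_minus R.r_neg)
  qed (use c(1) d(1) in simp)
  then obtain v w where v: "v \<in> lann R (right_span R as)" and w: "w \<in> lann R (right_span R [a])"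
    and vw: "c \<oplus> \<ominus> d = v \<oplus> w" using lann_Int[OF r1 r2] by blast
  have vc: "v \<in> carrier R" "w \<in> carrier R" using v w by (auto simp: lann_def)
  define b where "b = c \<oplus> \<ominus> v"
  have b: "b \<in> carrier R" using c(1) vc by (simp add: b_def)
  have bd: "b = d \<oplus> w"
  proof -
    have "c = (c \<oplus> \<ominus> d) \<oplus> d" using c(1) d(1) by (simp add: R.a_assoc R.l_neg)
    then have "c = v \<oplus> w \<oplus> d" unfolding vw .
    then have "b = v \<oplus> w \<oplus> d \<oplus> \<ominus> v" by (simp add: b_def)
    then show ?thesis using vc d(1) R.a_lcomm[of v w "\<ominus> v"] by (simp add: R.a_ac R.r_neg)
  qed
  have "set (a # as) \<subseteq> {x \<in> I. k x = b \<otimes> x}"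
  proof
    fix x assume x: "x \<in> set (a # as)"
    have xI: "x \<in> I" using x Cons.prems by blast
    have xc: "x \<in> carrier R" by (rule I'(1)[OF xI])
    show "x \<in> {x \<in> I. k x = b \<otimes> x}"
    proof (cases "x = a")
      case True
      have "a \<in> right_span R [a]" using R.right_span_superset[of "[a]"] by simp
      then have "w \<otimes> a = \<zero>" using w unfolding lann_def by blast
      then show ?thesis using True xI d vc ac unfolding bd by (simp add: l_distr)
    next
      case False
      then have xs: "x \<in> right_span R as" using x R.right_span_superset[of as] by auto
      then have "v \<otimes> x = \<zero>" using v unfolding lann_def by blast
      then show ?thesis using xI c(2)[OF xs] c(1) vc xc unfolding b_def by (simp add: l_distr l_minus)
    qed
  qed
  then have "right_span R (a # as) \<subseteq> {x \<in> I. k x = b \<otimes> x}" by (rule R.right_span_least[OF agree[OF b]])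
  then show ?case using b by blast
qed

lemma is_right_self_injective: "right_self_injective TYPE('t) R"
  unfolding right_self_injective_def left_self_injective_def
proof (rule baer_criterion)
  show "left_module (opposite_ring R) (regular_module (opposite_ring R))"
    by (rule ring.regular_left_module[OF R.opposite_ring_ring])
  fix L k assume L: "left_ideal (opposite_ring R) L"
    and k: "\<And>x. x \<in> L \<Longrightarrow> k x \<in> carrier (regular_module (opposite_ring R))"
    "\<And>x y. x \<in> L \<Longrightarrow> y \<in> L \<Longrightarrow> k (x \<oplus>\<^bsub>opposite_ring R\<^esub> y) = k x \<oplus>\<^bsub>regular_module (opposite_ring R)\<^esub> k y"
    "\<And>r x. r \<in> carrier (opposite_ring R) \<Longrightarrow> x \<in> L \<Longrightarrow>
      k (r \<otimes>\<^bsub>opposite_ring R\<^esub> x) = r \<odot>\<^bsub>regular_module (opposite_ring R)\<^esub> k x"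
  have I: "right_ideal R L" using L by simp
  obtain as where as: "right_generated R L as" using right_finitely_generated[OF I] by blast
  then have "L \<subseteq> right_span R as" unfolding right_generated_def right_span_def by blast
  moreover have "\<exists>c\<in>carrier R. \<forall>x\<in>right_span R as. k x = c \<otimes> x"
    by (rule right_hom_list[OF I])
       (use k as in \<open>auto simp: regular_module_def right_generated_def\<close>)
  ultimately show "\<exists>m\<in>carrier (regular_module (opposite_ring R)).
      \<forall>x\<in>L. k x = x \<odot>\<^bsub>regular_module (opposite_ring R)\<^esub> m"
    by (auto simp: regular_module_def)
qed

lemma is_left_self_injective: "left_self_injective TYPE('t) R"
  unfolding left_self_injective_def
proof (rule baer_criterion[OF R.regular_left_module])
  fix L k assume L: "left_ideal R L"
    and k: "\<And>x. x \<in> L \<Longrightarrow> k x \<in> carrier (regular_module R)"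
    "\<And>x y. x \<in> L \<Longrightarrow> y \<in> L \<Longrightarrow> k (x \<oplus> y) = k x \<oplus>\<^bsub>regular_module R\<^esub> k y"
    "\<And>r x. r \<in> carrier R \<Longrightarrow> x \<in> L \<Longrightarrow> k (r \<otimes> x) = r \<odot>\<^bsub>regular_module R\<^esub> k x"
  have "\<exists>c\<in>carrier R. \<forall>x\<in>L. k x = x \<otimes> c"
    by (rule self_injective[OF L]) (use k in \<open>simp_all add: regular_module_def\<close>)
  then show "\<exists>m\<in>carrier (regular_module R). \<forall>x\<in>L. k x = x \<odot>\<^bsub>regular_module R\<^esub> m"
    by (simp add: regular_module_def)
qed

lemma is_quasi_frobenius: "quasi_frobenius TYPE('t) R"
  unfolding quasi_frobenius_def right_artinian_def
  using R.ring_axioms R.left_dcc_imp_left_artinian[OF is_left_dcc]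
    ring.left_dcc_imp_left_artinian[OF R.opposite_ring_ring is_right_dcc]
    is_left_self_injective is_right_self_injective by blast

end

theorem theorem2p9:
  fixes R :: "('a, 'm) ring_scheme"
  assumes "ring R"
    and "left_noetherian R \<or> right_noetherian R"
    and "left_automorphism_invariant TYPE('e) R"
  shows "quasi_frobenius TYPE('c) R"
proof -
  interpret R: ring R by fact
  obtain E :: "('a, 'e) module" and \<iota> where env: "injective_envelope R (regular_module R) E \<iota>"
    and st: "\<And>\<phi>. \<phi> \<in> module_auts R E \<Longrightarrow> \<phi> ` (\<iota> ` carrier (regular_module R)) \<subseteq> \<iota> ` carrier (regular_module R)"
    using assms(3) unfolding left_automorphism_invariant_def automorphism_invariant_def
    by (elim exE conjE) (rule that, assumption, erule (1) bspec)
  have E: "injective_module TYPE('a) R E" and \<iota>: "\<iota> \<in> module_homs R (regular_module R) E"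
    "inj_on \<iota> (carrier (regular_module R))"
    and es: "essential_submodule R (\<iota> ` carrier (regular_module R)) E"
    using env[unfolded injective_envelope_def] by simp_all
  have lE: "left_module R E" by (rule injective_module_imp_left_module[OF E])
  interpret E: left_module R E by fact
  have cR: "carrier (regular_module R) = carrier R" by (simp add: regular_module_def)
  \<comment> \<open>The embedding is multiplication onto this one element, so its properties
    translate into those of \<open>R u\<close>.\<close>
  define u where "u = \<iota> \<one>\<^bsub>R\<^esub>"
  have u: "u \<in> carrier E" unfolding u_def using module_homsD(1)[OF \<iota>(1)] cR by simp
  have iu: "\<iota> s = s \<odot>\<^bsub>E\<^esub> u" if "s \<in> carrier R" for s
    using module_homsD(3)[OF \<iota>(1) that, of "\<one>\<^bsub>R\<^esub>"] that by (simp add: u_def regular_module_def)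
  have i0: "\<iota> \<zero>\<^bsub>R\<^esub> = \<zero>\<^bsub>E\<^esub>"
    using module_homs_zero[OF \<iota>(1) R.regular_left_module lE] by (simp add: regular_module_def)
  have "automorphism_invariant_ring R E u"
  proof (intro automorphism_invariant_ring.intro injective_left_module.intro lE
      injective_left_module_axioms.intro E automorphism_invariant_ring_axioms.intro u)
    show "r = \<zero>\<^bsub>R\<^esub>" if r: "r \<in> carrier R" "r \<odot>\<^bsub>E\<^esub> u = \<zero>\<^bsub>E\<^esub>" for r
      by (rule inj_onD[OF \<iota>(2)]) (use r iu i0 cR in simp_all)
    show "\<exists>s\<in>carrier R. \<phi> u = s \<odot>\<^bsub>E\<^esub> u" if \<phi>: "\<phi> \<in> module_auts R E" for \<phi>
    proof -
      have "\<phi> u \<in> \<iota> ` carrier R" using st[OF \<phi>] unfolding u_def cR by blast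
      then show ?thesis using iu by auto
    qed
    show "\<exists>r\<in>carrier R. r \<odot>\<^bsub>E\<^esub> x \<noteq> \<zero>\<^bsub>E\<^esub> \<and> (\<exists>s\<in>carrier R. r \<odot>\<^bsub>E\<^esub> x = s \<odot>\<^bsub>E\<^esub> u)"
      if x: "x \<in> carrier E" "x \<noteq> \<zero>\<^bsub>E\<^esub>" for x
    proof -
      let ?K = "(\<lambda>r. r \<odot>\<^bsub>E\<^esub> x) ` carrier R"
      have "submodule ?K R E"
        unfolding E.submodule_iff
      proof (intro conjI ballI)
        show "?K \<subseteq> carrier E" using x(1) by auto
        show "\<zero>\<^bsub>E\<^esub> \<in> ?K" using E.smult_l_null[OF x(1)] by (metis R.zero_closed image_eqI)
      next
        fix y z assume "y \<in> ?K" "z \<in> ?K"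
        then obtain r s where "r \<in> carrier R" "s \<in> carrier R" "y = r \<odot>\<^bsub>E\<^esub> x" "z = s \<odot>\<^bsub>E\<^esub> x" by blast
        then show "y \<oplus>\<^bsub>E\<^esub> z \<in> ?K" using x(1)
          by (intro image_eqI[of _ _ "r \<oplus>\<^bsub>R\<^esub> s"]) (simp_all add: E.smult_l_distr)
      next
        fix s y assume "s \<in> carrier R" "y \<in> ?K"
        then obtain r where "r \<in> carrier R" "s \<in> carrier R" "y = r \<odot>\<^bsub>E\<^esub> x" by blast
        then show "s \<odot>\<^bsub>E\<^esub> y \<in> ?K" using x(1)
          by (intro image_eqI[of _ _ "s \<otimes>\<^bsub>R\<^esub> r"]) (simp_all add: E.smult_assoc1)
      qed
      moreover have "x \<in> ?K" using x(1) by (intro image_eqI[of _ _ "\<one>\<^bsub>R\<^esub>"]) simp_all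
      ultimately have "\<iota> ` carrier R \<inter> ?K \<noteq> {\<zero>\<^bsub>E\<^esub>}"
        using es x(2) unfolding essential_submodule_def cR by blast
      moreover have "\<zero>\<^bsub>E\<^esub> \<in> \<iota> ` carrier R" using i0 by (metis R.zero_closed image_eqI)
      moreover have "\<zero>\<^bsub>E\<^esub> \<in> ?K" using E.smult_l_null[OF x(1)] by (metis R.zero_closed image_eqI)
      ultimately obtain y where y: "y \<in> \<iota> ` carrier R" "y \<in> ?K" "y \<noteq> \<zero>\<^bsub>E\<^esub>" by blast
      obtain s where s: "s \<in> carrier R" "y = s \<odot>\<^bsub>E\<^esub> u" using y(1) iu by auto
      obtain r where "r \<in> carrier R" "y = r \<odot>\<^bsub>E\<^esub> x" using y(2) by blast
      then show ?thesis using y(3) s by blast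
    qed
  qed
  moreover have "left_acc R \<or> right_acc R"
    using assms(2) R.left_noetherian_imp_left_acc ring.left_noetherian_imp_left_acc[OF R.opposite_ring_ring]
    unfolding right_noetherian_def by auto
  ultimately interpret noetherian_invariant_ring R E u
    by (intro noetherian_invariant_ring.intro noetherian_invariant_ring_axioms.intro)
  show ?thesis by (rule is_quasi_frobenius)
qed

end
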